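(* Let $B$ be a non-empty finite set. Then $\mathrm{FUCVL}(B)$ is Riesz isomorphic to $\mathrm{FBL}(B)$, to $H(\Delta_B)$, and to $H(\mathbb{R}^B)$.
   Context: All vector lattices are real. A net $x_\alpha$ in a vector lattice $V$ r-converges to $x\in V$ with regulator $u\in V$ if for each $k\in\mathbb{N}$ there is $\alpha_k$ with $|x_\alpha-x|\le\frac1k|u|$ for all $\alpha\ge\alpha_k$. It is r$(u)$-Cauchy (with $u\in V$) if for each $k\in\mathbb{N}$ there is $\alpha_k$ with $|x_{\alpha'}-x_{\alpha''}|\le\frac1k|u|$ for all $\alpha',\alpha''\ge\alpha_k$. A UCVL (uniformly complete vector lattice) is an Archimedean vector lattice $V$ such that for every $u\in V$, every r$(u)$-Cauchy net in $V$ r-converges to some element of $V$ with some regulator in $V$ (sequences suffice). For a non-empty set $A$, $\mathrm{FUCVL}(A)$, the free UCVL over $A$, is a pair $(F,f)$ with $F$ a UCVL and $f:A\to F$ an embedding (injective map) such that for every UCVL $E$ and every embedding (injective map) $q:A\to E$ there is a unique Riesz homomorphism $T:F\to E$ with $q=T\circ f$; it is unique up to Riesz isomorphism. $\mathrm{FBL}(A)$, the free Banach lattice over $A$ (de Pagter–Wickstead), is a pair $(X,\iota)$ with $X$ a Banach lattice and $\iota:A\to X$ a bounded map such that for every Banach lattice $Y$ and every bounded map $\kappa:A\to Y$ there is a unique Riesz homomorphism $T:X\to Y$ with $\kappa=T\circ\iota$ and $\|T\|=\sup_{a\in A}\|\kappa(a)\|$; it exists and is unique up to isometric Riesz isomorphism.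 $\Delta_A:=[-1,1]^A$. $H(\mathbb{R}^A)$ (respectively $H(\Delta_A)$) is the vector lattice, under pointwise operations and order, of all real-valued functions on $\mathbb{R}^A$ (respectively $\Delta_A$) that are continuous in the product topology and positively homogeneous, i.e. $h(t\xi)=t\,h(\xi)$ whenever $t\ge 0$ and both $\xi,t\xi$ are in the domain. *)

theory Defs
  imports
    "HOL-Analysis.Analysis"
    "HOL-Algebra.Module"
    "HOL-Algebra.Lattice"
begin

section \<open>Vector lattices\<close>

text \<open>
  The universal properties below quantify over vector lattices, so a vector lattice is a
  record with a carrier set rather than a type class instance. The record extends the module
  record of HOL-Algebra, whose ring multiplication and unit play no role here.
\<close>

record 'v riesz = "(real, 'v) module" +
  rle :: "'v \<Rightarrow> 'v \<Rightarrow> bool"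

definition real_scalars :: "real ring" where
  "real_scalars = \<lparr>carrier = UNIV, mult = (*), one = 1, zero = 0, add = (+)\<rparr>"

definition riesz_order :: "('v, 'm) riesz_scheme \<Rightarrow> 'v gorder" where
  "riesz_order V = \<lparr>carrier = carrier V, eq = (=), le = rle V\<rparr>"

definition rjoin :: "('v, 'm) riesz_scheme \<Rightarrow> 'v \<Rightarrow> 'v \<Rightarrow> 'v" where
  "rjoin V x y = Lattice.join (riesz_order V) x y"

definition rmeet :: "('v, 'm) riesz_scheme \<Rightarrow> 'v \<Rightarrow> 'v \<Rightarrow> 'v" where
  "rmeet V x y = Lattice.meet (riesz_order V) x y"

definition rabs :: "('v, 'm) riesz_scheme \<Rightarrow> 'v \<Rightarrow> 'v" where
  "rabs V x = rjoin V x (\<ominus>\<^bsub>V\<^esub> x)"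

definition vector_lattice :: "('v, 'm) riesz_scheme \<Rightarrow> bool" where
  "vector_lattice V \<longleftrightarrow>
     Module.module real_scalars V \<and>
     Lattice.lattice (riesz_order V) \<and>
     (\<forall>x\<in>carrier V. \<forall>y\<in>carrier V. \<forall>z\<in>carrier V.
        rle V x y \<longrightarrow> rle V (x \<oplus>\<^bsub>V\<^esub> z) (y \<oplus>\<^bsub>V\<^esub> z)) \<and>
     (\<forall>x\<in>carrier V. \<forall>y\<in>carrier V. \<forall>c\<ge>0.
        rle V x y \<longrightarrow> rle V (c \<odot>\<^bsub>V\<^esub> x) (c \<odot>\<^bsub>V\<^esub> y))"

definition archimedean_vl :: "('v, 'm) riesz_scheme \<Rightarrow> bool" where
  "archimedean_vl V \<longleftrightarrow>
     (\<forall>x\<in>carrier V. \<forall>y\<in>carrier V.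
        rle V \<zero>\<^bsub>V\<^esub> x \<and> (\<forall>n::nat. rle V (real n \<odot>\<^bsub>V\<^esub> x) y) \<longrightarrow> x = \<zero>\<^bsub>V\<^esub>)"

definition r_converges ::
  "('v, 'm) riesz_scheme \<Rightarrow> (nat \<Rightarrow> 'v) \<Rightarrow> 'v \<Rightarrow> 'v \<Rightarrow> bool" where
  "r_converges V s x u \<longleftrightarrow>
     (\<forall>k::nat. k \<ge> 1 \<longrightarrow>
        (\<exists>m. \<forall>n\<ge>m. rle V (rabs V (s n \<ominus>\<^bsub>V\<^esub> x)) ((1 / real k) \<odot>\<^bsub>V\<^esub> rabs V u)))"

definition r_cauchy :: "('v, 'm) riesz_scheme \<Rightarrow> 'v \<Rightarrow> (nat \<Rightarrow> 'v) \<Rightarrow> bool" where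
  "r_cauchy V u s \<longleftrightarrow>
     (\<forall>k::nat. k \<ge> 1 \<longrightarrow>
        (\<exists>m. \<forall>n\<ge>m. \<forall>n'\<ge>m.
           rle V (rabs V (s n \<ominus>\<^bsub>V\<^esub> s n')) ((1 / real k) \<odot>\<^bsub>V\<^esub> rabs V u)))"

text \<open>
  Uniform completeness is expressed with sequences; this is equivalent to the version with
  nets. As usual, the regulator of the limit may differ from that of the Cauchy sequence.
\<close>

definition ucvl :: "('v, 'm) riesz_scheme \<Rightarrow> bool" where
  "ucvl V \<longleftrightarrow>
     vector_lattice V \<and> archimedean_vl V \<and>
     (\<forall>u\<in>carrier V. \<forall>s. range s \<subseteq> carrier V \<and> r_cauchy V u s \<longrightarrow>
        (\<exists>x\<in>carrier V. \<exists>w\<in>carrier V. r_converges V s x w))"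

definition riesz_hom ::
  "('v, 'm) riesz_scheme \<Rightarrow> ('w, 'n) riesz_scheme \<Rightarrow> ('v \<Rightarrow> 'w) \<Rightarrow> bool" where
  "riesz_hom V W T \<longleftrightarrow>
     T \<in> carrier V \<rightarrow> carrier W \<and>
     (\<forall>x\<in>carrier V. \<forall>y\<in>carrier V. T (x \<oplus>\<^bsub>V\<^esub> y) = T x \<oplus>\<^bsub>W\<^esub> T y) \<and>
     (\<forall>c. \<forall>x\<in>carrier V. T (c \<odot>\<^bsub>V\<^esub> x) = c \<odot>\<^bsub>W\<^esub> T x) \<and>
     (\<forall>x\<in>carrier V. \<forall>y\<in>carrier V. T (rjoin V x y) = rjoin W (T x) (T y)) \<and>
     (\<forall>x\<in>carrier V. \<forall>y\<in>carrier V. T (rmeet V x y) = rmeet W (T x) (T y))"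

definition riesz_isomorphic ::
  "('v, 'm) riesz_scheme \<Rightarrow> ('w, 'n) riesz_scheme \<Rightarrow> bool" where
  "riesz_isomorphic V W \<longleftrightarrow> (\<exists>T. riesz_hom V W T \<and> bij_betw T (carrier V) (carrier W))"


section \<open>Banach lattices\<close>

record 'v normed_riesz = "'v riesz" +
  rnorm :: "'v \<Rightarrow> real"

definition banach_lattice :: "('v, 'm) normed_riesz_scheme \<Rightarrow> bool" where
  "banach_lattice X \<longleftrightarrow>
     vector_lattice X \<and>
     (\<forall>x\<in>carrier X. rnorm X x \<ge> 0 \<and> (rnorm X x = 0 \<longleftrightarrow> x = \<zero>\<^bsub>X\<^esub>)) \<and>
     (\<forall>c. \<forall>x\<in>carrier X. rnorm X (c \<odot>\<^bsub>X\<^esub> x) = \<bar>c\<bar> * rnorm X x) \<and>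
     (\<forall>x\<in>carrier X. \<forall>y\<in>carrier X. rnorm X (x \<oplus>\<^bsub>X\<^esub> y) \<le> rnorm X x + rnorm X y) \<and>
     (\<forall>x\<in>carrier X. \<forall>y\<in>carrier X.
        rle X (rabs X x) (rabs X y) \<longrightarrow> rnorm X x \<le> rnorm X y) \<and>
     (\<forall>s. range s \<subseteq> carrier X \<and>
        (\<forall>e>0. \<exists>m. \<forall>n\<ge>m. \<forall>n'\<ge>m. rnorm X (s n \<ominus>\<^bsub>X\<^esub> s n') < e) \<longrightarrow>
        (\<exists>x\<in>carrier X. (\<lambda>n. rnorm X (s n \<ominus>\<^bsub>X\<^esub> x)) \<longlonglongrightarrow> 0))"

text \<open>The operator norm is extended-real valued, so that it is meaningful for unbounded maps.\<close>

definition op_norm ::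
  "('v, 'm) normed_riesz_scheme \<Rightarrow> ('w, 'n) normed_riesz_scheme \<Rightarrow> ('v \<Rightarrow> 'w) \<Rightarrow> ereal" where
  "op_norm X Y T = (SUP x\<in>{x\<in>carrier X. rnorm X x \<le> 1}. ereal (rnorm Y (T x)))"

definition bounded_map_into ::
  "'a set \<Rightarrow> ('v, 'm) normed_riesz_scheme \<Rightarrow> ('a \<Rightarrow> 'v) \<Rightarrow> bool" where
  "bounded_map_into A X k \<longleftrightarrow> k \<in> A \<rightarrow> carrier X \<and> (\<exists>M. \<forall>a\<in>A. rnorm X (k a) \<le> M)"


section \<open>Free objects\<close>

text \<open>
  HOL cannot quantify over types inside a formula. The type argument is the universe from which
  the test objects of the universal property are taken: they are all structures whose carrier
  is any subset of that type. The full universal property is the one for all such types.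
  Accordingly, existence of a free object is to be stated for an arbitrary test type, whereas
  a hypothesis that a given object is free may be restricted to the test types it needs.
  Homomorphisms are made unique as functions by fixing their values outside of the carrier.
\<close>

definition is_FUCVL ::
  "'e itself \<Rightarrow> 'a set \<Rightarrow> 'v riesz \<Rightarrow> ('a \<Rightarrow> 'v) \<Rightarrow> bool" where
  "is_FUCVL _ A F f \<longleftrightarrow>
     ucvl F \<and> f \<in> A \<rightarrow> carrier F \<and> inj_on f A \<and>
     (\<forall>(E :: 'e riesz) q. ucvl E \<and> q \<in> A \<rightarrow> carrier E \<and> inj_on q A \<longrightarrow>
        (\<exists>!T. T \<in> extensional (carrier F) \<and> riesz_hom F E T \<and> (\<forall>a\<in>A. q a = T (f a))))"

definition is_FBL ::
  "'e itself \<Rightarrow> 'a set \<Rightarrow> 'v normed_riesz \<Rightarrow> ('a \<Rightarrow> 'v) \<Rightarrow> bool" where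
  "is_FBL _ A X i \<longleftrightarrow>
     banach_lattice X \<and> bounded_map_into A X i \<and>
     (\<forall>(Y :: 'e normed_riesz) k. banach_lattice Y \<and> bounded_map_into A Y k \<longrightarrow>
        (\<exists>!T. T \<in> extensional (carrier X) \<and> riesz_hom X Y T \<and> (\<forall>a\<in>A. k a = T (i a)) \<and>
              op_norm X Y T = (SUP a\<in>A. ereal (rnorm Y (k a)))))"


section \<open>Positively homogeneous continuous functions\<close>

text \<open>
  Points of the power of \<open>I\<close> with exponent \<open>A\<close> are functions that are
  \<^const>\<open>undefined\<close> outside \<open>A\<close>; likewise functions on that power are
  \<^const>\<open>undefined\<close> outside of it.
\<close>

definition pos_homogeneous_on :: "'a set \<Rightarrow> real set \<Rightarrow> (('a \<Rightarrow> real) \<Rightarrow> real) \<Rightarrow> bool" where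
  "pos_homogeneous_on A I h \<longleftrightarrow>
     (\<forall>t\<ge>0. \<forall>\<xi>\<in>A \<rightarrow>\<^sub>E I. (\<lambda>a\<in>A. t * \<xi> a) \<in> A \<rightarrow>\<^sub>E I \<longrightarrow> h (\<lambda>a\<in>A. t * \<xi> a) = t * h \<xi>)"

definition H_lattice :: "'a set \<Rightarrow> real set \<Rightarrow> (('a \<Rightarrow> real) \<Rightarrow> real) riesz" where
  "H_lattice A I =
     \<lparr>carrier = {h \<in> extensional (A \<rightarrow>\<^sub>E I).
          continuous_map (product_topology (\<lambda>_. top_of_set I) A) euclideanreal h \<and>
          pos_homogeneous_on A I h},
      mult = undefined, one = undefined,
      zero = (\<lambda>\<xi>\<in>A \<rightarrow>\<^sub>E I. 0),
      add = (\<lambda>g h. \<lambda>\<xi>\<in>A \<rightarrow>\<^sub>E I. g \<xi> + h \<xi>),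
      smult = (\<lambda>c h. \<lambda>\<xi>\<in>A \<rightarrow>\<^sub>E I. c * h \<xi>),
      rle = (\<lambda>g h. \<forall>\<xi>\<in>A \<rightarrow>\<^sub>E I. g \<xi> \<le> h \<xi>)\<rparr>"

definition H_real :: "'a set \<Rightarrow> (('a \<Rightarrow> real) \<Rightarrow> real) riesz" where
  "H_real A = H_lattice A UNIV"

definition H_Delta :: "'a set \<Rightarrow> (('a \<Rightarrow> real) \<Rightarrow> real) riesz" where
  "H_Delta A = H_lattice A {-1..1}"

end

theory Submission
  imports Defs
begin

text \<open>
  The free objects over a finite set \<open>B\<close> are all realised by the lattice \<open>H_Delta B\<close> of homogeneous
  continuous functions on the cube, with the coordinate functions as generators.

  Let \<open>E\<close> be a uniformly complete vector lattice and \<open>q\<close> a map from \<open>B\<close> into it. A homomorphism from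
  \<open>H_Delta B\<close> that sends the coordinates to \<open>q\<close> has no choice on functions given by lattice-linear
  terms \<open>t\<close>: these must go to the value of \<open>t\<close> at \<open>q\<close>. Two facts make this a definition on all of
  \<open>H_Delta B\<close>. First, an inequality between terms that holds for real numbers holds in every vector
  lattice (\<open>eval_nonneg\<close>, \<open>eval_mono\<close>). The reason is of a finite nature and independent of \<open>E\<close>: a term
  is a difference of two maxima of linear forms, and pointwise domination of a linear form by a
  maximum of linear forms has, by Gordan's alternative (\<open>Gordan_alternative\<close>), a certificate in form of
  a nonnegative combination, which can be evaluated in \<open>E\<close>. Second, every function in \<open>H_Delta B\<close> is
  approximated by terms with an error that is a small multiple of the \<open>l1\<close>-norm
  (\<open>lterm_approximation\<close>). Uniform completeness of \<open>E\<close> then provides the limits (\<open>calc_total\<close>),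
  and the Archimedean property their uniqueness (\<open>riesz_hom_unique\<close>); see \<open>ex1_riesz_hom\<close>. As
  \<open>H_Delta B\<close> is itself uniformly complete by compactness of the cube, it is the free uniformly complete
  vector lattice (\<open>is_FUCVL_H_Delta\<close>).

  Banach lattices are uniformly complete, so the same homomorphisms are available there. With the
  norm \<open>\<parallel>h\<parallel> = inf {\<Sum>b. c b | c. c \<ge> 0, \<bar>h\<bar> \<le> (\<Sum>b. c b * \<bar>x b\<bar>)}\<close>, where \<open>x b\<close> are the coordinate functions,
  \<open>H_Delta B\<close> becomes a Banach lattice and the norm of such a homomorphism is the supremum of the norms
  of its values at the coordinates. Hence \<open>H_Delta B\<close> is also the free Banach lattice
  (\<open>is_FBL_FBL_Delta\<close>).

  Free objects are unique up to isomorphism. For Banach lattices this requires care, because the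
  universal property asserts uniqueness only among homomorphisms of a prescribed norm; see
  \<open>riesz_isomorphic_of_FBL\<close>. Finally, restriction from the whole space to the cube is an isomorphism,
  as homogeneous functions extend uniquely (\<open>riesz_isomorphic_H_Delta_H_real\<close>).
\<close>

section \<open>Vector lattices\<close>

lemma real_scalars_simps [simp]:
  "carrier real_scalars = UNIV" "a \<oplus>\<^bsub>real_scalars\<^esub> b = a + b" "a \<otimes>\<^bsub>real_scalars\<^esub> b = a * b"
  "\<zero>\<^bsub>real_scalars\<^esub> = 0" "\<one>\<^bsub>real_scalars\<^esub> = 1"
  by (simp_all add: real_scalars_def)

lemma cring_real_scalars: "cring real_scalars"
proof (rule cringI)
  show "abelian_group real_scalars"
  proof (rule abelian_groupI)
    show "\<exists>y\<in>carrier real_scalars. y \<oplus>\<^bsub>real_scalars\<^esub> x = \<zero>\<^bsub>real_scalars\<^esub>" for x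
      by (rule bexI[of _ "- x"]) auto
  qed auto
  show "Group.comm_monoid real_scalars"
    by (rule Group.comm_monoidI) auto
qed (auto simp: algebra_simps)

lemma uminus_real_scalars [simp]: "\<ominus>\<^bsub>real_scalars\<^esub> a = - a"
proof -
  interpret cring real_scalars by (rule cring_real_scalars)
  show ?thesis by (rule minus_equality) auto
qed

lemma riesz_order_simps [simp]:
  "carrier (riesz_order V) = carrier V" "x \<sqsubseteq>\<^bsub>riesz_order V\<^esub> y = rle V x y"
  "x .=\<^bsub>riesz_order V\<^esub> y \<longleftrightarrow> x = y"
  by (simp_all add: riesz_order_def)

lemma least_Upper_pair_iff:
  assumes "x \<in> carrier V" "y \<in> carrier V"
  shows "least (riesz_order V) s (Upper (riesz_order V) {x, y}) \<longleftrightarrow>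
    s \<in> carrier V \<and> rle V x s \<and> rle V y s \<and>
    (\<forall>z\<in>carrier V. rle V x z \<and> rle V y z \<longrightarrow> rle V s z)"
  using assms by (auto simp: least_def Upper_def)

lemma greatest_Lower_pair_iff:
  assumes "x \<in> carrier V" "y \<in> carrier V"
  shows "greatest (riesz_order V) s (Lower (riesz_order V) {x, y}) \<longleftrightarrow>
    s \<in> carrier V \<and> rle V s x \<and> rle V s y \<and>
    (\<forall>z\<in>carrier V. rle V z x \<and> rle V z y \<longrightarrow> rle V z s)"
  using assms by (auto simp: greatest_def Lower_def)

locale vlat =
  fixes V :: "('v, 'm) riesz_scheme" (structure)
  assumes vector_lattice: "vector_lattice V"
begin

lemma module: "module real_scalars V"
  using vector_lattice by (simp add: vector_lattice_def)

sublocale module real_scalars V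
  by (rule module)


abbreviation le (infix "\<preceq>" 50) where
  "x \<preceq> y \<equiv> rle V x y"

lemma lattice: "Lattice.lattice (riesz_order V)"
  using vector_lattice by (simp add: vector_lattice_def)

interpretation L: Lattice.lattice "riesz_order V"
  by (rule lattice)

lemma le_refl: "x \<in> carrier V \<Longrightarrow> x \<preceq> x"
  using L.le_refl[of x] by simp

lemma
  assumes "x \<in> carrier V" "y \<in> carrier V"
  shows le_antisym: "x \<preceq> y \<Longrightarrow> y \<preceq> x \<Longrightarrow> x = y"
    and join_closed [simp]: "rjoin V x y \<in> carrier V"
    and join_ge1: "x \<preceq> rjoin V x y" and join_ge2: "y \<preceq> rjoin V x y"
    and meet_closed [simp]: "rmeet V x y \<in> carrier V"
    and meet_le1: "rmeet V x y \<preceq> x" and meet_le2: "rmeet V x y \<preceq> y"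
  using assms L.le_antisym[of x y] L.join_closed[of x y] L.join_left[of x y] L.join_right[of x y]
    L.meet_closed[of x y] L.meet_left[of x y] L.meet_right[of x y]
  by (simp_all add: rjoin_def rmeet_def)

lemma le_trans: "\<lbrakk>x \<preceq> y; y \<preceq> z; x \<in> carrier V; y \<in> carrier V; z \<in> carrier V\<rbrakk> \<Longrightarrow> x \<preceq> z"
  and join_least: "\<lbrakk>x \<preceq> z; y \<preceq> z; x \<in> carrier V; y \<in> carrier V; z \<in> carrier V\<rbrakk> \<Longrightarrow> rjoin V x y \<preceq> z"
  and meet_greatest: "\<lbrakk>z \<preceq> x; z \<preceq> y; x \<in> carrier V; y \<in> carrier V; z \<in> carrier V\<rbrakk> \<Longrightarrow> z \<preceq> rmeet V x y"
  using L.le_trans[of x y z] L.join_le[of x z y] L.meet_le[of z x y]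
  by (simp_all add: rjoin_def rmeet_def)

end

context vlat
begin

lemma join_eqI:
  assumes "x \<preceq> s" "y \<preceq> s" "x \<in> carrier V" "y \<in> carrier V" "s \<in> carrier V"
    and "\<And>z. \<lbrakk>z \<in> carrier V; x \<preceq> z; y \<preceq> z\<rbrakk> \<Longrightarrow> s \<preceq> z"
  shows "rjoin V x y = s"
  using assms by (intro le_antisym join_least join_ge1 join_ge2 assms(6)) simp_all

lemma meet_eqI:
  assumes "s \<preceq> x" "s \<preceq> y" "x \<in> carrier V" "y \<in> carrier V" "s \<in> carrier V"
    and "\<And>z. \<lbrakk>z \<in> carrier V; z \<preceq> x; z \<preceq> y\<rbrakk> \<Longrightarrow> z \<preceq> s"
  shows "rmeet V x y = s"
  using assms by (intro le_antisym meet_greatest meet_le1 meet_le2 assms(6)) simp_all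

lemma smult_in [simp]: "x \<in> carrier V \<Longrightarrow> c \<odot> x \<in> carrier V"
  and smult_distrib_left: "x \<in> carrier V \<Longrightarrow> (c + d) \<odot> x = c \<odot> x \<oplus> d \<odot> x"
  and smult_distrib_right: "\<lbrakk>x \<in> carrier V; y \<in> carrier V\<rbrakk> \<Longrightarrow> c \<odot> (x \<oplus> y) = c \<odot> x \<oplus> c \<odot> y"
  and smult_smult: "x \<in> carrier V \<Longrightarrow> c \<odot> (d \<odot> x) = (c * d) \<odot> x"
  and one_smult [simp]: "x \<in> carrier V \<Longrightarrow> 1 \<odot> x = x"
  and zero_smult [simp]: "x \<in> carrier V \<Longrightarrow> 0 \<odot> x = \<zero>"
  and smult_zero [simp]: "c \<odot> \<zero> = \<zero>"
  using smult_closed[of c x] smult_l_distr[of c d x] smult_r_distr[of c x y]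
    smult_assoc1[of c d x] smult_one[of x] smult_l_null[of x] smult_r_null[of c]
  by simp_all

lemma uminus_smult: "x \<in> carrier V \<Longrightarrow> (- c) \<odot> x = \<ominus> (c \<odot> x)"
  using smult_l_minus[of c x] by simp

lemma smult_uminus: "x \<in> carrier V \<Longrightarrow> c \<odot> (\<ominus> x) = \<ominus> (c \<odot> x)"
  using smult_r_minus[of c x] by simp

lemma neg_eq_smult: "x \<in> carrier V \<Longrightarrow> \<ominus> x = (- 1) \<odot> x"
  by (simp add: uminus_smult)

lemma add_le_cancel_right: "x \<preceq> y \<Longrightarrow> \<lbrakk>x \<in> carrier V; y \<in> carrier V; z \<in> carrier V\<rbrakk> \<Longrightarrow> x \<oplus> z \<preceq> y \<oplus> z"
  using vector_lattice by (simp add: vector_lattice_def)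

lemma smult_le: "x \<preceq> y \<Longrightarrow> \<lbrakk>0 \<le> c; x \<in> carrier V; y \<in> carrier V\<rbrakk> \<Longrightarrow> c \<odot> x \<preceq> c \<odot> y"
  using vector_lattice by (simp add: vector_lattice_def)

lemma add_mono:
  assumes "x \<preceq> x'" "y \<preceq> y'" "x \<in> carrier V" "x' \<in> carrier V" "y \<in> carrier V" "y' \<in> carrier V"
  shows "x \<oplus> y \<preceq> x' \<oplus> y'"
proof (rule le_trans)
  show "x \<oplus> y \<preceq> x' \<oplus> y"
    using assms by (intro add_le_cancel_right)
  show "x' \<oplus> y \<preceq> x' \<oplus> y'"
    using add_le_cancel_right[of y y' x'] assms by (simp add: M.a_comm)
qed (use assms in simp_all)

lemma diff_add_cancel [simp]:
  "\<lbrakk>x \<in> carrier V; z \<in> carrier V\<rbrakk> \<Longrightarrow> (x \<ominus> z) \<oplus> z = x"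
  "\<lbrakk>x \<in> carrier V; z \<in> carrier V\<rbrakk> \<Longrightarrow> (x \<oplus> z) \<ominus> z = x"
  by (simp_all add: a_minus_def M.a_assoc M.l_neg M.r_neg)

lemma le_diff_iff:
  assumes "x \<in> carrier V" "y \<in> carrier V" "z \<in> carrier V"
  shows "x \<preceq> y \<ominus> z \<longleftrightarrow> x \<oplus> z \<preceq> y"
proof
  assume "x \<preceq> y \<ominus> z"
  from add_le_cancel_right[OF this, of z] show "x \<oplus> z \<preceq> y"
    using assms by simp
next
  assume "x \<oplus> z \<preceq> y"
  from add_le_cancel_right[OF this, of "\<ominus> z"] show "x \<preceq> y \<ominus> z"
    using assms by (simp add: a_minus_def M.a_assoc M.r_neg)
qed

lemma diff_le_iff:
  assumes "x \<in> carrier V" "y \<in> carrier V" "z \<in> carrier V"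
  shows "x \<ominus> z \<preceq> y \<longleftrightarrow> x \<preceq> y \<oplus> z"
proof
  assume "x \<ominus> z \<preceq> y"
  from add_le_cancel_right[OF this, of z] show "x \<preceq> y \<oplus> z"
    using assms by simp
next
  assume "x \<preceq> y \<oplus> z"
  from add_le_cancel_right[OF this, of "\<ominus> z"] show "x \<ominus> z \<preceq> y"
    using assms by (simp add: a_minus_def M.a_assoc M.r_neg)
qed

lemma uminus_le:
  assumes "x \<preceq> y" "x \<in> carrier V" "y \<in> carrier V"
  shows "\<ominus> y \<preceq> \<ominus> x"
proof -
  from add_le_cancel_right[OF assms(1), of "\<ominus> x \<oplus> \<ominus> y"] assms(2,3)
  show ?thesis
    by (simp add: M.r_neg2 M.a_lcomm[of y "\<ominus> x"] M.r_neg)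
qed

lemma uminus_le_swap:
  assumes "\<ominus> x \<preceq> y" "x \<in> carrier V" "y \<in> carrier V"
  shows "\<ominus> y \<preceq> x"
  using uminus_le[OF assms(1)] assms by simp

lemma le_uminus_swap:
  assumes "x \<preceq> \<ominus> y" "x \<in> carrier V" "y \<in> carrier V"
  shows "y \<preceq> \<ominus> x"
  using uminus_le[OF assms(1)] assms by simp

lemma smult_le_cancel:
  assumes "c \<odot> x \<preceq> c \<odot> y" "0 < c" "x \<in> carrier V" "y \<in> carrier V"
  shows "x \<preceq> y"
  using smult_le[OF assms(1), of "1 / c"] assms(2-) by (simp add: smult_smult)

lemma meet_eq_join:
  assumes "x \<in> carrier V" "y \<in> carrier V"
  shows "rmeet V x y = \<ominus> (rjoin V (\<ominus> x) (\<ominus> y))"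
proof (rule meet_eqI)
  show "\<ominus> rjoin V (\<ominus> x) (\<ominus> y) \<preceq> x" "\<ominus> rjoin V (\<ominus> x) (\<ominus> y) \<preceq> y"
    using assms by (auto intro: uminus_le_swap[OF join_ge1] uminus_le_swap[OF join_ge2])
  fix z
  assume "z \<in> carrier V" "z \<preceq> x" "z \<preceq> y"
  then show "z \<preceq> \<ominus> rjoin V (\<ominus> x) (\<ominus> y)"
    using assms by (intro le_uminus_swap[OF join_least] uminus_le) simp_all
qed (use assms in simp_all)

lemma join_add:
  assumes "x \<in> carrier V" "y \<in> carrier V" "z \<in> carrier V"
  shows "rjoin V x y \<oplus> z = rjoin V (x \<oplus> z) (y \<oplus> z)"
proof (rule join_eqI[symmetric])
  show "x \<oplus> z \<preceq> rjoin V x y \<oplus> z" "y \<oplus> z \<preceq> rjoin V x y \<oplus> z"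
    using assms by (intro add_le_cancel_right join_ge1 join_ge2; simp)+
  fix w
  assume "w \<in> carrier V" "x \<oplus> z \<preceq> w" "y \<oplus> z \<preceq> w"
  then have "rjoin V x y \<preceq> w \<ominus> z"
    using assms by (intro join_least) (simp_all add: le_diff_iff)
  then show "rjoin V x y \<oplus> z \<preceq> w"
    using assms \<open>w \<in> carrier V\<close> by (simp add: le_diff_iff)
qed (use assms in simp_all)

end

text \<open>
  Joins and meets are chosen by Hilbert's operator. For a concrete vector lattice the second
  conclusion identifies the chosen join with the expected one; meets then follow through
  \<open>x \<sqinter> y = - (- x \<squnion> - y)\<close>.
\<close>

lemma vector_latticeI:
  fixes V :: "('v, 'm) riesz_scheme" (structure)
  assumes "\<zero> \<in> carrier V"
    and "\<And>x y. \<lbrakk>x \<in> carrier V; y \<in> carrier V\<rbrakk> \<Longrightarrow> x \<oplus> y \<in> carrier V"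
    and "\<And>c x. x \<in> carrier V \<Longrightarrow> c \<odot> x \<in> carrier V"
    and "\<And>x y z. \<lbrakk>x \<in> carrier V; y \<in> carrier V; z \<in> carrier V\<rbrakk> \<Longrightarrow> (x \<oplus> y) \<oplus> z = x \<oplus> (y \<oplus> z)"
    and "\<And>x y. \<lbrakk>x \<in> carrier V; y \<in> carrier V\<rbrakk> \<Longrightarrow> x \<oplus> y = y \<oplus> x"
    and "\<And>x. x \<in> carrier V \<Longrightarrow> \<zero> \<oplus> x = x"
    and "\<And>x. x \<in> carrier V \<Longrightarrow> (- 1) \<odot> x \<oplus> x = \<zero>"
    and "\<And>c d x. x \<in> carrier V \<Longrightarrow> (c + d) \<odot> x = c \<odot> x \<oplus> d \<odot> x"
    and "\<And>c x y. \<lbrakk>x \<in> carrier V; y \<in> carrier V\<rbrakk> \<Longrightarrow> c \<odot> (x \<oplus> y) = c \<odot> x \<oplus> c \<odot> y"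
    and "\<And>c d x. x \<in> carrier V \<Longrightarrow> (c * d) \<odot> x = c \<odot> (d \<odot> x)"
    and "\<And>x. x \<in> carrier V \<Longrightarrow> 1 \<odot> x = x"
    and refl: "\<And>x. x \<in> carrier V \<Longrightarrow> rle V x x"
    and antisym: "\<And>x y. \<lbrakk>rle V x y; rle V y x; x \<in> carrier V; y \<in> carrier V\<rbrakk> \<Longrightarrow> x = y"
    and trans: "\<And>x y z. \<lbrakk>rle V x y; rle V y z; x \<in> carrier V; y \<in> carrier V; z \<in> carrier V\<rbrakk> \<Longrightarrow> rle V x z"
    and "\<And>x y z. \<lbrakk>rle V x y; x \<in> carrier V; y \<in> carrier V; z \<in> carrier V\<rbrakk> \<Longrightarrow> rle V (x \<oplus> z) (y \<oplus> z)"
    and "\<And>c x y. \<lbrakk>rle V x y; 0 \<le> c; x \<in> carrier V; y \<in> carrier V\<rbrakk> \<Longrightarrow> rle V (c \<odot> x) (c \<odot> y)"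
    and join: "\<And>x y. \<lbrakk>x \<in> carrier V; y \<in> carrier V\<rbrakk> \<Longrightarrow>
      j x y \<in> carrier V \<and> rle V x (j x y) \<and> rle V y (j x y) \<and>
      (\<forall>z\<in>carrier V. rle V x z \<and> rle V y z \<longrightarrow> rle V (j x y) z)"
    and meet: "\<And>x y. \<lbrakk>x \<in> carrier V; y \<in> carrier V\<rbrakk> \<Longrightarrow>
      m x y \<in> carrier V \<and> rle V (m x y) x \<and> rle V (m x y) y \<and>
      (\<forall>z\<in>carrier V. rle V z x \<and> rle V z y \<longrightarrow> rle V z (m x y))"
  shows "vector_lattice V"
    and "\<And>x y. \<lbrakk>x \<in> carrier V; y \<in> carrier V\<rbrakk> \<Longrightarrow> rjoin V x y = j x y"
proof -
  have "abelian_group V"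
  proof (rule abelian_groupI)
    show "\<exists>y\<in>carrier V. y \<oplus> x = \<zero>" if "x \<in> carrier V" for x
      using that assms(3,7) by blast
  qed (use assms in simp_all)
  then have "Module.module real_scalars V"
    using assms(3,8-11) by (intro moduleI cring_real_scalars) simp_all
  moreover have "partial_order (riesz_order V)"
    using refl antisym trans by unfold_locales (auto simp: riesz_order_def)
  then interpret partial_order "riesz_order V" .
  have "Lattice.lattice (riesz_order V)"
  proof (unfold_locales, goal_cases)
    case (1 x y)
    then show ?case
      using join[of x y] by (auto simp: least_Upper_pair_iff)
  next
    case (2 x y)
    then show ?case
      using meet[of x y] by (auto simp: greatest_Lower_pair_iff)
  qed
  ultimately show V: "vector_lattice V"
    using assms(15,16) by (simp add: vector_lattice_def)
  then interpret vlat V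
    by unfold_locales
  show "\<And>x y. \<lbrakk>x \<in> carrier V; y \<in> carrier V\<rbrakk> \<Longrightarrow> rjoin V x y = j x y"
    using join by (intro join_eqI) auto
qed

section \<open>Riesz homomorphisms\<close>

text \<open>
  Preservation of meets comes for free: \<open>x \<sqinter> y = - (- x \<squnion> - y)\<close> holds in both lattices.
\<close>

lemma riesz_homI:
  assumes "vector_lattice V" "vector_lattice W"
    and "T \<in> carrier V \<rightarrow> carrier W"
    and "\<And>x y. \<lbrakk>x \<in> carrier V; y \<in> carrier V\<rbrakk> \<Longrightarrow> T (x \<oplus>\<^bsub>V\<^esub> y) = T x \<oplus>\<^bsub>W\<^esub> T y"
    and smult: "\<And>c x. x \<in> carrier V \<Longrightarrow> T (c \<odot>\<^bsub>V\<^esub> x) = c \<odot>\<^bsub>W\<^esub> T x"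
    and "\<And>x y. \<lbrakk>x \<in> carrier V; y \<in> carrier V\<rbrakk> \<Longrightarrow> T (rjoin V x y) = rjoin W (T x) (T y)"
  shows "riesz_hom V W T"
proof -
  interpret V: vlat V by unfold_locales fact
  interpret W: vlat W by unfold_locales fact
  have "T (rmeet V x y) = rmeet W (T x) (T y)" if "x \<in> carrier V" "y \<in> carrier V" for x y
    using that assms(3,6)
    by (simp add: V.meet_eq_join W.meet_eq_join V.neg_eq_smult W.neg_eq_smult smult Pi_iff)
  then show ?thesis
    using assms(3-) by (simp add: riesz_hom_def)
qed

lemma riesz_hom_closed: "riesz_hom V W T \<Longrightarrow> x \<in> carrier V \<Longrightarrow> T x \<in> carrier W"
  by (auto simp: riesz_hom_def)

lemma riesz_hom_mono:
  assumes "vector_lattice V" "vector_lattice W" "riesz_hom V W T"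
    and "rle V x y" "x \<in> carrier V" "y \<in> carrier V"
  shows "rle W (T x) (T y)"
proof -
  interpret V: vlat V by unfold_locales fact
  interpret W: vlat W by unfold_locales fact
  have "rjoin V x y = y"
    using assms by (intro V.join_eqI V.le_refl) auto
  moreover have "T (rjoin V x y) = rjoin W (T x) (T y)"
    using assms by (simp add: riesz_hom_def)
  ultimately have "rjoin W (T x) (T y) = T y"
    by simp
  then show ?thesis
    using W.join_ge1[of "T x" "T y"] assms by (auto simp: riesz_hom_def)
qed

lemma riesz_hom_comp:
  assumes "riesz_hom U V S" "riesz_hom V W T"
  shows "riesz_hom U W (T \<circ> S)"
  using assms by (auto simp: riesz_hom_def Pi_iff)

lemma riesz_hom_cong:
  assumes "vector_lattice V" "riesz_hom V W T" "\<And>x. x \<in> carrier V \<Longrightarrow> T x = T' x"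
  shows "riesz_hom V W T'"
proof -
  interpret V: vlat V by unfold_locales fact
  show ?thesis
    using assms(2,3) by (auto simp: riesz_hom_def Pi_iff)
qed

lemma riesz_isomorphic_trans:
  assumes "riesz_isomorphic U V" "riesz_isomorphic V W"
  shows "riesz_isomorphic U W"
  using assms by (meson riesz_isomorphic_def riesz_hom_comp bij_betw_trans)

lemma riesz_isomorphicI:
  assumes "riesz_hom V W T" "riesz_hom W V S"
    and "\<And>x. x \<in> carrier V \<Longrightarrow> S (T x) = x" "\<And>y. y \<in> carrier W \<Longrightarrow> T (S y) = y"
  shows "riesz_isomorphic V W"
  unfolding riesz_isomorphic_def
  using assms by (intro exI[of _ T] conjI bij_betwI[where g = S]) (auto simp: riesz_hom_def)

section \<open>Gordan's alternative\<close>

text \<open>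
  The nonnegative combinations of \<open>P\<close> with at least one positive coefficient. They are generated
  inductively because facts about them are then proved by induction, without sums of coefficients.
\<close>

inductive_set pos_cone :: "('b \<Rightarrow> real) set \<Rightarrow> ('b \<Rightarrow> real) set" for P where
  base: "a \<in> P \<Longrightarrow> a \<in> pos_cone P"
| add: "\<lbrakk>y \<in> pos_cone P; z \<in> pos_cone P\<rbrakk> \<Longrightarrow> (\<lambda>b. y b + z b) \<in> pos_cone P"
| scale: "\<lbrakk>0 < t; z \<in> pos_cone P\<rbrakk> \<Longrightarrow> (\<lambda>b. t * z b) \<in> pos_cone P"

lemma pos_cone_subset:
  assumes "P' \<subseteq> pos_cone P" "z \<in> pos_cone P'"
  shows "z \<in> pos_cone P"
  using assms(2)
proof induction
  case (base a)
  then show ?case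
    using assms(1) by blast
qed (auto intro: pos_cone.intros)

text \<open>
  The step of Fourier-Motzkin elimination that finds a value for the eliminated variable.
\<close>

lemma finite_strictly_between:
  fixes L U :: "real set"
  assumes "finite L" "finite U" "\<And>l u. \<lbrakk>l \<in> L; u \<in> U\<rbrakk> \<Longrightarrow> l < u"
  shows "\<exists>t. (\<forall>l\<in>L. l < t) \<and> (\<forall>u\<in>U. t < u)"
proof (cases "L = {} \<or> U = {}")
  case True
  then show ?thesis
  proof
    assume "L = {}"
    moreover have "\<exists>t. \<forall>u\<in>U. t < u"
      using assms(2) by (cases "U = {}") (auto intro!: exI[of _ "Min U - 1"] simp: algebra_simps
          dest: Min_le[OF assms(2)])
    ultimately show ?thesis
      by auto
  next
    assume "U = {}"
    moreover have "\<exists>t. \<forall>l\<in>L. l < t"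
      using assms(1) by (cases "L = {}") (auto intro!: exI[of _ "Max L + 1"] simp: algebra_simps
          dest: Max_ge[OF assms(1)])
    ultimately show ?thesis
      by auto
  qed
next
  case False
  then have "Max L < Min U"
    using assms by simp
  then obtain t where "Max L < t" "t < Min U"
    using dense by blast
  then show ?thesis
    using assms(1,2) False by auto
qed

text \<open>
  Fourier-Motzkin elimination, by induction on the set of variables. To eliminate \<open>v\<close>, each form with
  positive \<open>v\<close>-coefficient is combined with each form with negative \<open>v\<close>-coefficient so that \<open>v\<close>
  cancels. A point where the combined forms are positive leaves a nonempty open range of values for
  \<open>v\<close>; a relation between the combined forms is one between the original forms.
\<close>

theorem Gordan_alternative:
  fixes P :: "('b \<Rightarrow> real) set"
  assumes "finite B" "finite P"
  shows "(\<exists>\<xi>. \<forall>a\<in>P. 0 < (\<Sum>b\<in>B. a b * \<xi> b)) \<or> (\<exists>z\<in>pos_cone P. \<forall>b\<in>B. z b = 0)"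
  using assms
proof (induction B arbitrary: P rule: finite_induct)
  case empty
  show ?case
  proof (cases "P = {}")
    case False
    then show ?thesis
      by (auto intro: pos_cone.base)
  qed auto
next
  case (insert v B)
  define Pos where "Pos = {a\<in>P. 0 < a v}"
  define Neg where "Neg = {a\<in>P. a v < 0}"
  define comb :: "('b \<Rightarrow> real) \<times> ('b \<Rightarrow> real) \<Rightarrow> 'b \<Rightarrow> real"
    where "comb = (\<lambda>(a, c) b. (- c v) * a b + a v * c b)"
  define P' where "P' = {a\<in>P. a v = 0} \<union> comb ` (Pos \<times> Neg)"
  have "finite P'"
    using insert.prems by (simp add: P'_def Pos_def Neg_def)
  have zero: "z v = 0" if "z \<in> pos_cone P'" for z
    using that by induction (auto simp: P'_def comb_def)
  have "comb (a, c) \<in> pos_cone P" if "a \<in> Pos" "c \<in> Neg" for a c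
    using that pos_cone.add[OF pos_cone.scale[OF _ pos_cone.base] pos_cone.scale[OF _ pos_cone.base],
        of "- c v" a P "a v" c]
    by (simp add: comb_def Pos_def Neg_def)
  then have P': "P' \<subseteq> pos_cone P"
    by (auto simp: P'_def intro: pos_cone.base)
  from insert.IH[OF \<open>finite P'\<close>] show ?case
  proof
    assume "\<exists>z\<in>pos_cone P'. \<forall>b\<in>B. z b = 0"
    then obtain z where "z \<in> pos_cone P'" "\<forall>b\<in>B. z b = 0"
      by blast
    then show ?thesis
      using pos_cone_subset[OF P'] zero by (intro disjI2 bexI[of _ z]) auto
  next
    assume "\<exists>\<xi>. \<forall>a\<in>P'. 0 < (\<Sum>b\<in>B. a b * \<xi> b)"
    then obtain \<xi> where \<xi>: "\<And>a. a \<in> P' \<Longrightarrow> 0 < (\<Sum>b\<in>B. a b * \<xi> b)"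
      by blast
    define s where "s a = (\<Sum>b\<in>B. a b * \<xi> b)" for a
    have "\<exists>t. (\<forall>l\<in>(\<lambda>a. - s a / a v) ` Pos. l < t) \<and> (\<forall>u\<in>(\<lambda>c. - s c / c v) ` Neg. t < u)"
    proof (rule finite_strictly_between)
      fix l u
      assume "l \<in> (\<lambda>a. - s a / a v) ` Pos" "u \<in> (\<lambda>c. - s c / c v) ` Neg"
      then obtain a c where ac: "a \<in> Pos" "c \<in> Neg" "l = - s a / a v" "u = - s c / c v"
        by blast
      then have "0 < (\<Sum>b\<in>B. comb (a, c) b * \<xi> b)"
        by (intro \<xi>) (auto simp: P'_def)
      also have "\<dots> = (\<Sum>b\<in>B. (- c v) * (a b * \<xi> b) + a v * (c b * \<xi> b))"
        by (rule sum.cong) (simp_all add: comb_def algebra_simps)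
      also have "\<dots> = (- c v) * s a + a v * s c"
        unfolding s_def sum.distrib sum_distrib_left ..
      finally have "0 < (- c v) * s a + a v * s c" .
      moreover have av: "0 < a v" "c v < 0"
        using ac by (auto simp: Pos_def Neg_def)
      then have "(l - u) * (a v * c v) = (- c v) * s a + a v * s c"
        by (simp add: ac field_simps)
      ultimately have "0 < (l - u) * (a v * c v)"
        by simp
      moreover have "a v * c v < 0"
        using av by (rule mult_pos_neg)
      ultimately show "l < u"
        using av by (simp add: zero_less_mult_iff)
    qed (use insert.prems in \<open>simp_all add: Pos_def Neg_def\<close>)
    then obtain t where t: "\<And>a. a \<in> Pos \<Longrightarrow> - s a / a v < t" "\<And>c. c \<in> Neg \<Longrightarrow> t < - s c / c v"
      by blast
    have "0 < (\<Sum>b\<in>insert v B. a b * (\<xi>(v := t)) b)" if "a \<in> P" for a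
    proof -
      have "(\<Sum>b\<in>insert v B. a b * (\<xi>(v := t)) b) = a v * t + s a"
        using insert.hyps by (auto simp: s_def intro!: sum.cong)
      moreover have "0 < a v * t + s a"
      proof (cases "a v" "0 :: real" rule: linorder_cases)
        case less
        then show ?thesis
          using t(2)[of a] that by (auto simp: Neg_def field_simps)
      next
        case equal
        then show ?thesis
          using \<xi>[of a] that by (auto simp: P'_def s_def)
      next
        case greater
        then show ?thesis
          using t(1)[of a] that by (auto simp: Pos_def field_simps)
      qed
      ultimately show ?thesis
        by simp
    qed
    then show ?thesis
      by blast
  qed
qed

section \<open>Lattice-linear terms\<close>

text \<open>
  Lattice expressions are kept as syntax because one and the same expression has to be evaluated in
  the reals, in the lattice of homogeneous functions and in an arbitrary vector lattice, whose
  carriers have different types.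
\<close>

datatype 'b lterm = Var 'b | Zero | Add "'b lterm" "'b lterm" | Smul real "'b lterm"
  | Join "'b lterm" "'b lterm"

primrec vars :: "'b lterm \<Rightarrow> 'b set" where
  "vars (Var b) = {b}"
| "vars Zero = {}"
| "vars (Add s t) = vars s \<union> vars t"
| "vars (Smul c t) = vars t"
| "vars (Join s t) = vars s \<union> vars t"

primrec eval :: "('v, 'm) riesz_scheme \<Rightarrow> ('b \<Rightarrow> 'v) \<Rightarrow> 'b lterm \<Rightarrow> 'v" where
  "eval V q (Var b) = q b"
| "eval V q Zero = \<zero>\<^bsub>V\<^esub>"
| "eval V q (Add s t) = eval V q s \<oplus>\<^bsub>V\<^esub> eval V q t"
| "eval V q (Smul c t) = c \<odot>\<^bsub>V\<^esub> eval V q t"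
| "eval V q (Join s t) = rjoin V (eval V q s) (eval V q t)"

primrec reval :: "('b \<Rightarrow> real) \<Rightarrow> 'b lterm \<Rightarrow> real" where
  "reval \<xi> (Var b) = \<xi> b"
| "reval \<xi> Zero = 0"
| "reval \<xi> (Add s t) = reval \<xi> s + reval \<xi> t"
| "reval \<xi> (Smul c t) = c * reval \<xi> t"
| "reval \<xi> (Join s t) = max (reval \<xi> s) (reval \<xi> t)"

text \<open>
  The reals as a vector lattice: facts about \<open>eval\<close> in a general vector lattice, taken here, become
  facts about the pointwise evaluation \<open>reval\<close>.
\<close>

definition real_riesz :: "real riesz" where
  "real_riesz = \<lparr>carrier = UNIV, mult = (*), one = 1, zero = 0, add = (+), smult = (*), rle = (\<le>)\<rparr>"

lemma real_riesz_simps [simp]: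
  "carrier real_riesz = UNIV" "\<zero>\<^bsub>real_riesz\<^esub> = 0" "x \<oplus>\<^bsub>real_riesz\<^esub> y = x + y"
  "c \<odot>\<^bsub>real_riesz\<^esub> x = c * x" "rle real_riesz x y \<longleftrightarrow> x \<le> y"
  by (simp_all add: real_riesz_def)

lemma vector_lattice_real_riesz: "vector_lattice real_riesz"
  and rjoin_real_riesz [simp]: "rjoin real_riesz x y = max x y"
proof -
  note * = vector_latticeI[of real_riesz max min]
  show "vector_lattice real_riesz"
    by (rule *(1)) (auto simp: algebra_simps mult_left_mono)
  show "rjoin real_riesz x y = max x y"
    by (rule *(2)) (auto simp: algebra_simps mult_left_mono)
qed

interpretation real_riesz: vlat real_riesz
  by unfold_locales (rule vector_lattice_real_riesz)

lemma eval_real_riesz: "eval real_riesz \<xi> t = reval \<xi> t"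
  by (induction t) simp_all

lemma reval_scale:
  assumes "0 \<le> c" 
  shows "reval (\<lambda>b. c * \<xi> b) t = c * reval \<xi> t"
  using assms by (induction t) (simp_all add: algebra_simps max_mult_distrib_left)

lemma reval_cong:
  assumes "\<And>b. b \<in> vars t \<Longrightarrow> \<xi> b = \<eta> b" 
  shows "reval \<xi> t = reval \<eta> t"
  using assms by (induction t) auto

lemma (in vlat) eval_closed: "q \<in> vars t \<rightarrow> carrier V \<Longrightarrow> eval V q t \<in> carrier V"
  by (induction t) auto

lemma riesz_hom_eval:
  assumes "vector_lattice V" "vector_lattice W" "riesz_hom V W T" "q \<in> vars t \<rightarrow> carrier V"
  shows "T (eval V q t) = eval W (T \<circ> q) t"
proof -
  interpret V: vlat V by unfold_locales fact
  interpret W: vlat W by unfold_locales fact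
  have T0: "T \<zero>\<^bsub>V\<^esub> = \<zero>\<^bsub>W\<^esub>"
    using assms(3) V.zero_smult[of "\<zero>\<^bsub>V\<^esub>"] W.zero_smult[of "T \<zero>\<^bsub>V\<^esub>"]
    unfolding riesz_hom_def by (metis PiE V.M.zero_closed)
  show ?thesis
    using assms(4)
  proof (induction t)
    case (Add s t)
    then have "eval V q s \<in> carrier V" "eval V q t \<in> carrier V"
      by (auto intro: V.eval_closed)
    with Add assms(3) show ?case
      by (auto simp: riesz_hom_def)
  next
    case (Smul c t)
    then have "eval V q t \<in> carrier V"
      by (auto intro: V.eval_closed)
    with Smul assms(3) show ?case
      by (auto simp: riesz_hom_def)
  next
    case (Join s t)
    then have "eval V q s \<in> carrier V" "eval V q t \<in> carrier V"
      by (auto intro: V.eval_closed)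
    with Join assms(3) show ?case
      by (auto simp: riesz_hom_def)
  qed (auto simp: T0)
qed

definition msum :: "('b \<Rightarrow> real) set \<Rightarrow> ('b \<Rightarrow> real) set \<Rightarrow> ('b \<Rightarrow> real) set" where
  "msum P Q = (\<lambda>(a, c) b. a b + c b) ` (P \<times> Q)"

definition mscale :: "real \<Rightarrow> ('b \<Rightarrow> real) set \<Rightarrow> ('b \<Rightarrow> real) set" where
  "mscale c P = (\<lambda>a b. c * a b) ` P"

text \<open>
  Every term is a difference of two maxima of finitely many linear forms, here given by their
  coefficients: the value of \<open>t\<close> is \<open>max (pos_forms t) - max (neg_forms t)\<close>. Differences of maxima
  are closed under the lattice operations by \<open>max P + max Q = max (P + Q)\<close> and
  \<open>(p - n) \<squnion> (p' - n') = ((p + n') \<squnion> (p' + n)) - (n + n')\<close>.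
\<close>

fun pos_forms and neg_forms :: "'b lterm \<Rightarrow> ('b \<Rightarrow> real) set" where
  "pos_forms (Var v) = {\<lambda>b. if b = v then 1 else 0}"
| "neg_forms (Var v) = {\<lambda>b. 0}"
| "pos_forms Zero = {\<lambda>b. 0}"
| "neg_forms Zero = {\<lambda>b. 0}"
| "pos_forms (Add s t) = msum (pos_forms s) (pos_forms t)"
| "neg_forms (Add s t) = msum (neg_forms s) (neg_forms t)"
| "pos_forms (Smul c t) = (if 0 \<le> c then mscale c (pos_forms t) else mscale (- c) (neg_forms t))"
| "neg_forms (Smul c t) = (if 0 \<le> c then mscale c (neg_forms t) else mscale (- c) (pos_forms t))"
| "pos_forms (Join s t) = msum (pos_forms s) (neg_forms t) \<union> msum (pos_forms t) (neg_forms s)"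
| "neg_forms (Join s t) = msum (neg_forms s) (neg_forms t)"

lemma finite_forms: "finite (pos_forms t) \<and> finite (neg_forms t)"
  by (induction t) (simp_all add: msum_def mscale_def)

lemma forms_nonempty: "pos_forms t \<noteq> {} \<and> neg_forms t \<noteq> {}"
  by (induction t) (simp_all add: msum_def mscale_def)

locale vlat_tuple = vlat V for V :: "('v, 'm) riesz_scheme" (structure) +
  fixes B :: "'b set" and q :: "'b \<Rightarrow> 'v"
  assumes finite_B: "finite B" and q_closed: "q \<in> B \<rightarrow> carrier V"
begin

definition lin :: "('b \<Rightarrow> real) \<Rightarrow> 'v" where
  "lin a = finsum V (\<lambda>b. a b \<odot> q b) B"

lemma summand_closed: "(\<lambda>b. a b \<odot> q b) \<in> B \<rightarrow> carrier V"
  using q_closed by auto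

lemma lin_closed [simp]: "lin a \<in> carrier V"
  unfolding lin_def using summand_closed by (rule M.finsum_closed)

lemma lin_cong: "(\<And>b. b \<in> B \<Longrightarrow> a b = c b) \<Longrightarrow> lin a = lin c"
  unfolding lin_def using summand_closed by (intro M.finsum_cong') auto

lemma lin_add: "lin (\<lambda>b. a b + c b) = lin a \<oplus> lin c"
proof -
  have "lin (\<lambda>b. a b + c b) = finsum V (\<lambda>b. a b \<odot> q b \<oplus> c b \<odot> q b) B"
    unfolding lin_def using q_closed by (intro M.finsum_cong') (auto simp: smult_distrib_left Pi_iff)
  also have "\<dots> = lin a \<oplus> lin c"
    unfolding lin_def using summand_closed by (intro M.finsum_addf) auto
  finally show ?thesis .
qed

lemma lin_scale: "lin (\<lambda>b. t * a b) = t \<odot> lin a"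
proof -
  have "t \<odot> lin a = finsum V (\<lambda>b. t \<odot> (a b \<odot> q b)) B"
    unfolding lin_def using finite_B q_closed by (intro finsum_smult_ldistr) auto
  also have "\<dots> = lin (\<lambda>b. t * a b)"
    unfolding lin_def using q_closed by (intro M.finsum_cong') (auto simp: smult_smult Pi_iff)
  finally show ?thesis by simp
qed

lemma lin_zero: "lin (\<lambda>b. 0) = \<zero>"
  using lin_scale[of 0 "\<lambda>_. 0"] by simp

lemma lin_unit:
  assumes "v \<in> B"
  shows "lin (\<lambda>b. if b = v then 1 else 0) = q v"
proof -
  have "lin (\<lambda>b. if b = v then 1 else 0) = finsum V (\<lambda>b. if v = b then q b else \<zero>) B"
    unfolding lin_def using q_closed by (intro M.finsum_cong') (auto simp: Pi_iff)
  also have "\<dots> = q v"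
    using assms finite_B q_closed by (intro M.finsum_singleton)
  finally show ?thesis .
qed

text \<open>
  Suprema of finite sets of linear forms are described by their universal property, which spares an
  order in which to iterate binary joins.
\<close>

definition sup_of :: "('b \<Rightarrow> real) set \<Rightarrow> 'v \<Rightarrow> bool" where
  "sup_of P y \<longleftrightarrow> y \<in> carrier V \<and> (\<forall>a\<in>P. lin a \<preceq> y) \<and>
    (\<forall>z\<in>carrier V. (\<forall>a\<in>P. lin a \<preceq> z) \<longrightarrow> y \<preceq> z)"

lemma sup_of_singleton: "sup_of {a} (lin a)"
  by (auto simp: sup_of_def le_refl)

text \<open>
  Subtracting one summand at a time turns an upper bound of the sums into upper bounds of the two sets.
\<close>

lemma sup_of_msum:
  assumes "sup_of P x" "sup_of Q y"
  shows "sup_of (msum P Q) (x \<oplus> y)"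
proof -
  have [simp]: "x \<in> carrier V" "y \<in> carrier V"
    using assms by (auto simp: sup_of_def)
  have "x \<oplus> y \<preceq> z" if z: "z \<in> carrier V" and ub: "\<And>a. a \<in> msum P Q \<Longrightarrow> lin a \<preceq> z" for z
  proof -
    have "lin a \<oplus> lin c \<preceq> z" if "a \<in> P" "c \<in> Q" for a c
      using ub[of "\<lambda>b. a b + c b"] that by (force simp: msum_def lin_add)
    then have "lin c \<preceq> z \<ominus> lin a" if "a \<in> P" "c \<in> Q" for a c
      using that z by (simp add: le_diff_iff M.a_comm)
    then have "y \<preceq> z \<ominus> lin a" if "a \<in> P" for a
      using that assms(2) z by (simp add: sup_of_def)
    then have "lin a \<preceq> z \<ominus> y" if "a \<in> P" for a
      using that z by (simp add: le_diff_iff M.a_comm)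
    then have "x \<preceq> z \<ominus> y"
      using assms(1) z by (simp add: sup_of_def)
    then show ?thesis
      using z by (simp add: le_diff_iff)
  qed
  moreover have "lin a \<preceq> x \<oplus> y" if "a \<in> msum P Q" for a
    using that assms by (auto simp: msum_def lin_add sup_of_def intro!: add_mono)
  ultimately show ?thesis
    by (simp add: sup_of_def)
qed

lemma sup_of_mscale:
  assumes "sup_of P x" "0 \<le> c" "P \<noteq> {}"
  shows "sup_of (mscale c P) (c \<odot> x)"
proof (cases "c = 0")
  case True
  have "mscale 0 P = {\<lambda>b. 0}"
    using assms(3) by (auto simp: mscale_def)
  moreover have "0 \<odot> x = lin (\<lambda>b. 0)"
    using assms(1) by (simp add: lin_zero sup_of_def)
  ultimately show ?thesis
    using True sup_of_singleton[of "\<lambda>b. 0"] by simp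
next
  case False
  with assms have c: "0 < c" and [simp]: "x \<in> carrier V"
    by (auto simp: sup_of_def)
  have "c \<odot> x \<preceq> z" if z: "z \<in> carrier V" and ub: "\<And>a. a \<in> P \<Longrightarrow> c \<odot> lin a \<preceq> z" for z
  proof -
    have zc: "c \<odot> ((1 / c) \<odot> z) = z"
      using c z by (simp add: smult_smult)
    have "lin a \<preceq> (1 / c) \<odot> z" if "a \<in> P" for a
      using ub[OF that] c z by (intro smult_le_cancel[of c "lin a"]) (simp_all add: zc)
    then have "x \<preceq> (1 / c) \<odot> z"
      using assms(1) z by (simp add: sup_of_def)
    then show ?thesis
      using smult_le[of x "(1 / c) \<odot> z" c] c z by (simp add: zc)
  qed
  then show ?thesis
    using assms(1,2) by (auto simp: sup_of_def mscale_def lin_scale intro: smult_le)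
qed

lemma sup_of_union:
  assumes "sup_of P x" "sup_of Q y"
  shows "sup_of (P \<union> Q) (rjoin V x y)"
proof -
  have xy [simp]: "x \<in> carrier V" "y \<in> carrier V"
    using assms by (auto simp: sup_of_def)
  have "lin a \<preceq> rjoin V x y" if "a \<in> P" for a
    using that assms by (intro le_trans[OF _ join_ge1]) (auto simp: sup_of_def)
  moreover have "lin a \<preceq> rjoin V x y" if "a \<in> Q" for a
    using that assms by (intro le_trans[OF _ join_ge2]) (auto simp: sup_of_def)
  ultimately show ?thesis
    using assms by (auto simp: sup_of_def intro!: join_least)
qed

lemma join_diff:
  assumes [simp]: "j \<in> carrier V" "k \<in> carrier V" "j' \<in> carrier V" "k' \<in> carrier V"
  shows "rjoin V (j \<ominus> k) (j' \<ominus> k') = rjoin V (j \<oplus> k') (j' \<oplus> k) \<ominus> (k \<oplus> k')"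
proof -
  have "j \<ominus> k \<oplus> (k \<oplus> k') = j \<oplus> k'"
    by (simp flip: M.a_assoc)
  moreover have "j' \<ominus> k' \<oplus> (k \<oplus> k') = j' \<oplus> k"
    by (simp add: M.a_comm[of k] flip: M.a_assoc)
  ultimately have "rjoin V (j \<ominus> k) (j' \<ominus> k') \<oplus> (k \<oplus> k') = rjoin V (j \<oplus> k') (j' \<oplus> k)"
    by (simp add: join_add)
  then show ?thesis
    using diff_add_cancel(2)[of "rjoin V (j \<ominus> k) (j' \<ominus> k')" "k \<oplus> k'"] by simp
qed

text \<open>
  The two sets of linear forms of a term do not depend on the lattice; through them its values in
  different lattices are linked.
\<close>

lemma eval_eq_diff_sup:
  assumes "vars t \<subseteq> B"
  shows "\<exists>j k. sup_of (pos_forms t) j \<and> sup_of (neg_forms t) k \<and> eval V q t = j \<ominus> k"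
  using assms
proof (induction t)
  case (Var v)
  then have "q v \<in> carrier V"
    using q_closed by auto
  then show ?case
    using sup_of_singleton[of "\<lambda>b. if b = v then 1 else 0"] sup_of_singleton[of "\<lambda>b. 0"] Var
    by (intro exI[of _ "q v"] exI[of _ "\<zero>"]) (simp add: lin_unit lin_zero a_minus_def)
next
  case Zero
  then show ?case
    using sup_of_singleton[of "\<lambda>b. 0"]
    by (auto simp: lin_zero a_minus_def neg_eq_smult intro!: exI[of _ "\<zero>"])
next
  case (Add s t)
  then obtain j k j' k' where *:
    "sup_of (pos_forms s) j" "sup_of (neg_forms s) k" "eval V q s = j \<ominus> k"
    "sup_of (pos_forms t) j'" "sup_of (neg_forms t) k'" "eval V q t = j' \<ominus> k'"
    by auto
  then have "j \<in> carrier V" "k \<in> carrier V" "j' \<in> carrier V" "k' \<in> carrier V"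
    by (auto simp: sup_of_def)
  then have "(j \<ominus> k) \<oplus> (j' \<ominus> k') = (j \<oplus> j') \<ominus> (k \<oplus> k')"
    by (simp add: a_minus_def M.minus_add M.a_ac)
  with * show ?case
    by (intro exI[of _ "j \<oplus> j'"] exI[of _ "k \<oplus> k'"]) (simp add: sup_of_msum)
next
  case (Smul c t)
  then obtain j k where *:
    "sup_of (pos_forms t) j" "sup_of (neg_forms t) k" "eval V q t = j \<ominus> k"
    by auto
  then have [simp]: "j \<in> carrier V" "k \<in> carrier V"
    by (auto simp: sup_of_def)
  have eq: "c \<odot> (j \<ominus> k) = c \<odot> j \<ominus> c \<odot> k"
    by (simp add: a_minus_def smult_distrib_right smult_uminus)
  show ?case
  proof (cases "0 \<le> c")
    case True
    with * show ?thesis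
      by (intro exI[of _ "c \<odot> j"] exI[of _ "c \<odot> k"]) (simp add: eq sup_of_mscale forms_nonempty)
  next
    case False
    have "c \<odot> j \<ominus> c \<odot> k = (- c) \<odot> k \<ominus> (- c) \<odot> j"
      by (simp add: uminus_smult a_minus_def M.a_comm)
    with False * show ?thesis
      by (intro exI[of _ "(- c) \<odot> k"] exI[of _ "(- c) \<odot> j"])
        (simp add: eq sup_of_mscale forms_nonempty)
  qed
next
  case (Join s t)
  then obtain j k j' k' where *:
    "sup_of (pos_forms s) j" "sup_of (neg_forms s) k" "eval V q s = j \<ominus> k"
    "sup_of (pos_forms t) j'" "sup_of (neg_forms t) k'" "eval V q t = j' \<ominus> k'"
    by auto
  then have "j \<in> carrier V" "k \<in> carrier V" "j' \<in> carrier V" "k' \<in> carrier V"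
    by (auto simp: sup_of_def)
  with * show ?case
    by (intro exI[of _ "rjoin V (j \<oplus> k') (j' \<oplus> k)"] exI[of _ "k \<oplus> k'"])
      (simp add: join_diff sup_of_msum sup_of_union)
qed

end

lemma reval_eq_diff:
  fixes \<xi> :: "'b \<Rightarrow> real"
  assumes "finite B" "vars t \<subseteq> B"
  shows "\<exists>j k. (\<forall>z. (\<forall>a\<in>pos_forms t. (\<Sum>b\<in>B. a b * \<xi> b) \<le> z) \<longrightarrow> j \<le> z) \<and>
    (\<forall>c\<in>neg_forms t. (\<Sum>b\<in>B. c b * \<xi> b) \<le> k) \<and> reval \<xi> t = j - k"
proof -
  interpret X: vlat_tuple real_riesz B \<xi>
    by unfold_locales (auto simp: assms)
  have "finsum real_riesz f B = sum f B" for f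
    using \<open>finite B\<close> by induction (simp_all add: Pi_def)
  then have lin: "X.lin a = (\<Sum>b\<in>B. a b * \<xi> b)" for a
    by (simp add: X.lin_def)
  have "\<ominus>\<^bsub>real_riesz\<^esub> x = - x" for x
    using real_riesz.neg_eq_smult[of x] by simp
  then have minus: "x \<ominus>\<^bsub>real_riesz\<^esub> y = x - y" for x y
    by (simp add: a_minus_def)
  show ?thesis
    using X.eval_eq_diff_sup[OF assms(2)]
    by (auto simp: X.sup_of_def lin eval_real_riesz minus)
qed

context vlat_tuple
begin

lemma eval_in [simp]: "vars t \<subseteq> B \<Longrightarrow> eval V q t \<in> carrier V"
  using q_closed by (intro eval_closed) auto

text \<open>
  Write the term as \<open>max P - max N\<close>. If \<open>max P \<ge> c\<close> pointwise for a form \<open>c\<close> in \<open>N\<close>, then the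
  differences \<open>c - a\<close> with \<open>a \<in> P\<close> are never simultaneously positive, so by Gordan's alternative
  some positive combination of them vanishes. In the vector lattice, where each \<open>a\<close> is below the
  supremum \<open>j\<close> of \<open>P\<close>, this combination yields \<open>s c \<le> s j\<close> for some \<open>s > 0\<close>.
\<close>

theorem eval_nonneg:
  assumes t: "vars t \<subseteq> B" and nonneg: "\<And>\<xi>. 0 \<le> reval \<xi> t"
  shows "\<zero> \<preceq> eval V q t"
proof -
  from eval_eq_diff_sup[OF t] obtain j k where
    j: "sup_of (pos_forms t) j" and k: "sup_of (neg_forms t) k" and eq: "eval V q t = j \<ominus> k"
    by blast
  have [simp]: "j \<in> carrier V" "k \<in> carrier V"
    using j k by (auto simp: sup_of_def)
  have "lin c \<preceq> j" if c: "c \<in> neg_forms t" for c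
  proof -
    define P where "P = (\<lambda>a b. c b - a b) ` pos_forms t"
    have "\<not> (\<forall>d\<in>P. 0 < (\<Sum>b\<in>B. d b * \<xi> b))" for \<xi>
    proof
      assume pos: "\<forall>d\<in>P. 0 < (\<Sum>b\<in>B. d b * \<xi> b)"
      have lt: "(\<Sum>b\<in>B. a b * \<xi> b) < (\<Sum>b\<in>B. c b * \<xi> b)" if "a \<in> pos_forms t" for a
        using bspec[OF pos, of "\<lambda>b. c b - a b"] that
        by (simp add: P_def left_diff_distrib sum_subtractf)
      have "\<exists>z. (\<forall>l\<in>(\<lambda>a. \<Sum>b\<in>B. a b * \<xi> b) ` pos_forms t. l < z) \<and>
          (\<forall>u\<in>{\<Sum>b\<in>B. c b * \<xi> b}. z < u)"
      proof (rule finite_strictly_between)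
        fix l u
        assume "l \<in> (\<lambda>a. \<Sum>b\<in>B. a b * \<xi> b) ` pos_forms t" "u \<in> {\<Sum>b\<in>B. c b * \<xi> b}"
        then show "l < u"
          using lt by blast
      qed (simp_all add: finite_forms)
      then obtain z where z: "(\<forall>l\<in>(\<lambda>a. \<Sum>b\<in>B. a b * \<xi> b) ` pos_forms t. l < z) \<and>
          (\<forall>u\<in>{\<Sum>b\<in>B. c b * \<xi> b}. z < u)"
        ..
      from reval_eq_diff[OF finite_B t, of \<xi>] obtain j' k' where
        j': "\<forall>z. (\<forall>a\<in>pos_forms t. (\<Sum>b\<in>B. a b * \<xi> b) \<le> z) \<longrightarrow> j' \<le> z"
        and k': "\<forall>c\<in>neg_forms t. (\<Sum>b\<in>B. c b * \<xi> b) \<le> k'" and jk: "reval \<xi> t = j' - k'"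
        by blast
      have "(\<Sum>b\<in>B. a b * \<xi> b) \<le> z" if "a \<in> pos_forms t" for a
        using z that by (intro less_imp_le) simp
      then have "j' \<le> z"
        by (intro j'[THEN spec, THEN mp] ballI)
      moreover have "(\<Sum>b\<in>B. c b * \<xi> b) \<le> k'"
        using k' c by blast
      moreover have "0 \<le> j' - k'"
        using nonneg[of \<xi>] jk by simp
      ultimately show False
        using z by simp
    qed
    moreover have "finite P"
      by (simp add: P_def finite_forms)
    ultimately have "\<exists>z\<in>pos_cone P. \<forall>b\<in>B. z b = 0"
      using Gordan_alternative[OF finite_B, of P] by blast
    then obtain z where z: "z \<in> pos_cone P" "\<forall>b\<in>B. z b = 0"
      ..
    from z(1) have "\<exists>s>0. s \<odot> lin c \<preceq> lin z \<oplus> s \<odot> j"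
    proof induction
      case (base d)
      then obtain a where a: "a \<in> pos_forms t" "d = (\<lambda>b. c b - a b)"
        by (auto simp: P_def)
      have "lin c = lin d \<oplus> lin a"
        unfolding a(2) lin_add[symmetric] by simp
      moreover have "lin d \<oplus> lin a \<preceq> lin d \<oplus> j"
        using a(1) j by (intro add_mono le_refl) (auto simp: sup_of_def)
      ultimately show ?case
        by (intro exI[of _ 1]) simp
    next
      case (add y z)
      then obtain s s' where s: "0 < s" "s \<odot> lin c \<preceq> lin y \<oplus> s \<odot> j"
        and s': "0 < s'" "s' \<odot> lin c \<preceq> lin z \<oplus> s' \<odot> j"
        by blast
      have "s \<odot> lin c \<oplus> s' \<odot> lin c \<preceq> (lin y \<oplus> s \<odot> j) \<oplus> (lin z \<oplus> s' \<odot> j)"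
        using s s' by (intro add_mono) simp_all
      moreover have "s \<odot> lin c \<oplus> s' \<odot> lin c = (s + s') \<odot> lin c"
        by (simp add: smult_distrib_left)
      moreover have "(lin y \<oplus> s \<odot> j) \<oplus> (lin z \<oplus> s' \<odot> j) = lin (\<lambda>b. y b + z b) \<oplus> (s + s') \<odot> j"
        by (simp add: smult_distrib_left lin_add M.a_ac)
      ultimately have "(s + s') \<odot> lin c \<preceq> lin (\<lambda>b. y b + z b) \<oplus> (s + s') \<odot> j"
        by (simp only:)
      then show ?case
        using s(1) s'(1) by (intro exI[of _ "s + s'"] conjI) simp_all
    next
      case (scale r z)
      then obtain s where s: "0 < s" "s \<odot> lin c \<preceq> lin z \<oplus> s \<odot> j"
        by blast
      have "r \<odot> (s \<odot> lin c) \<preceq> r \<odot> (lin z \<oplus> s \<odot> j)"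
        using s scale(1) by (intro smult_le) simp_all
      moreover have "r \<odot> (s \<odot> lin c) = (r * s) \<odot> lin c"
        by (simp add: smult_smult)
      moreover have "r \<odot> (lin z \<oplus> s \<odot> j) = lin (\<lambda>b. r * z b) \<oplus> (r * s) \<odot> j"
        by (simp add: smult_smult smult_distrib_right lin_scale)
      ultimately have "(r * s) \<odot> lin c \<preceq> lin (\<lambda>b. r * z b) \<oplus> (r * s) \<odot> j"
        by (simp only:)
      then show ?case
        using s(1) scale(1) by (intro exI[of _ "r * s"] conjI) simp_all
    qed
    moreover have "lin z = \<zero>"
      using lin_cong[of z "\<lambda>_. 0"] z(2) by (simp add: lin_zero)
    ultimately obtain s where "0 < s" "s \<odot> lin c \<preceq> s \<odot> j"
      by auto
    then show "lin c \<preceq> j"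
      using smult_le_cancel[of s "lin c" j] by simp
  qed
  then have "k \<preceq> j"
    using k by (simp add: sup_of_def)
  then show ?thesis
    by (simp add: eq le_diff_iff)
qed

text \<open>
  By positive homogeneity it is enough to compare the two terms on the cube.
\<close>

corollary eval_mono:
  assumes s: "vars s \<subseteq> B" and t: "vars t \<subseteq> B"
    and le: "\<And>\<xi>. \<xi> \<in> B \<rightarrow>\<^sub>E {-1..1} \<Longrightarrow> reval \<xi> s \<le> reval \<xi> t"
  shows "eval V q s \<preceq> eval V q t"
proof -
  have "reval \<xi> s \<le> reval \<xi> t" for \<xi>
  proof -
    define m where "m = 1 + (\<Sum>b\<in>B. \<bar>\<xi> b\<bar>)"
    have "0 \<le> (\<Sum>b\<in>B. \<bar>\<xi> b\<bar>)"
      by (intro sum_nonneg) simp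
    then have m: "0 < m"
      by (simp add: m_def add_pos_nonneg)
    have "- m \<le> \<xi> b \<and> \<xi> b \<le> m" if "b \<in> B" for b
    proof -
      have "\<bar>\<xi> b\<bar> \<le> (\<Sum>b\<in>B. \<bar>\<xi> b\<bar>)"
        using that finite_B by (intro member_le_sum) auto
      then show ?thesis
        unfolding m_def by linarith
    qed
    then have "restrict (\<lambda>b. 1 / m * \<xi> b) B \<in> B \<rightarrow>\<^sub>E {-1..1}"
      using m by (auto simp: field_simps)
    from le[OF this] have "reval (\<lambda>b. 1 / m * \<xi> b) s \<le> reval (\<lambda>b. 1 / m * \<xi> b) t"
      using reval_cong[of s "restrict (\<lambda>b. 1 / m * \<xi> b) B"] reval_cong[of t "restrict (\<lambda>b. 1 / m * \<xi> b) B"] s t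
      by (simp add: subset_iff)
    then have "1 / m * reval \<xi> s \<le> 1 / m * reval \<xi> t"
      using m reval_scale[of "1 / m" \<xi> s] reval_scale[of "1 / m" \<xi> t] by simp
    then show ?thesis
      using m by (simp add: divide_le_cancel)
  qed
  then have "\<zero> \<preceq> eval V q (Add t (Smul (- 1) s))"
    using s t by (intro eval_nonneg) auto
  then have "\<zero> \<preceq> eval V q t \<ominus> eval V q s"
    using s by (simp add: a_minus_def flip: neg_eq_smult)
  then show ?thesis
    using s t by (simp add: le_diff_iff)
qed

end

section \<open>Positively homogeneous continuous functions\<close>

text \<open>
  The lattice of homogeneous functions with an arbitrary value of the remaining record fields, so
  that everything proved about it applies both to the bare vector lattice and to its normed version.
\<close>

definition H_ext :: "'a set \<Rightarrow> real set \<Rightarrow> 'm \<Rightarrow> (('a \<Rightarrow> real) \<Rightarrow> real, 'm) riesz_scheme" where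
  "H_ext A I m =
     \<lparr>carrier = carrier (H_lattice A I), mult = undefined, one = undefined,
      zero = zero (H_lattice A I), add = add (H_lattice A I), smult = smult (H_lattice A I),
      rle = rle (H_lattice A I), \<dots> = m\<rparr>"

abbreviation "H_cube A m \<equiv> H_ext A {-1..1} m"

lemma H_lattice_eq_H_ext: "H_lattice A I = H_ext A I ()"
  by (simp add: H_ext_def H_lattice_def)

lemma H_ext_simps [simp]:
  "\<zero>\<^bsub>H_ext A I m\<^esub> = (\<lambda>\<xi>\<in>A \<rightarrow>\<^sub>E I. 0)"
  "g \<oplus>\<^bsub>H_ext A I m\<^esub> h = (\<lambda>\<xi>\<in>A \<rightarrow>\<^sub>E I. g \<xi> + h \<xi>)"
  "c \<odot>\<^bsub>H_ext A I m\<^esub> h = (\<lambda>\<xi>\<in>A \<rightarrow>\<^sub>E I. c * h \<xi>)"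
  "rle (H_ext A I m) g h \<longleftrightarrow> (\<forall>\<xi>\<in>A \<rightarrow>\<^sub>E I. g \<xi> \<le> h \<xi>)"
  by (simp_all add: H_ext_def H_lattice_def)

abbreviation cube_topology :: "'a set \<Rightarrow> real set \<Rightarrow> ('a \<Rightarrow> real) topology" where
  "cube_topology A I \<equiv> product_topology (\<lambda>_. top_of_set I) A"

lemma in_H_ext_iff:
  "h \<in> carrier (H_ext A I m) \<longleftrightarrow> h \<in> extensional (A \<rightarrow>\<^sub>E I) \<and>
    continuous_map (cube_topology A I) euclideanreal h \<and> pos_homogeneous_on A I h"
  by (simp add: H_ext_def H_lattice_def)

lemma restrict_in_H_ext:
  assumes "continuous_map (cube_topology A I) euclideanreal f"
    and "\<And>t \<xi>. \<lbrakk>0 \<le> t; \<xi> \<in> A \<rightarrow>\<^sub>E I; (\<lambda>a\<in>A. t * \<xi> a) \<in> A \<rightarrow>\<^sub>E I\<rbrakk> \<Longrightarrow> f (\<lambda>a\<in>A. t * \<xi> a) = t * f \<xi>"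
  shows "restrict f (A \<rightarrow>\<^sub>E I) \<in> carrier (H_ext A I m)"
  unfolding in_H_ext_iff pos_homogeneous_on_def
  using assms by (auto simp del: restrict_apply simp add: restrict_apply')

lemma H_ext_continuous:
  "h \<in> carrier (H_ext A I m) \<Longrightarrow> continuous_map (cube_topology A I) euclideanreal h"
  by (simp add: in_H_ext_iff)

lemma H_ext_homogeneous:
  "\<lbrakk>h \<in> carrier (H_ext A I m); 0 \<le> t; \<xi> \<in> A \<rightarrow>\<^sub>E I; (\<lambda>a\<in>A. t * \<xi> a) \<in> A \<rightarrow>\<^sub>E I\<rbrakk>
    \<Longrightarrow> h (\<lambda>a\<in>A. t * \<xi> a) = t * h \<xi>"
  by (simp add: in_H_ext_iff pos_homogeneous_on_def)

lemma H_ext_eqI: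
  assumes "g \<in> carrier (H_ext A I m)" "h \<in> carrier (H_ext A I m')"
    and "\<And>\<xi>. \<xi> \<in> A \<rightarrow>\<^sub>E I \<Longrightarrow> g \<xi> = h \<xi>"
  shows "g = h"
  using assms by (intro extensionalityI[of g "A \<rightarrow>\<^sub>E I" h]) (auto simp: in_H_ext_iff)

lemma vector_lattice_H_ext: "vector_lattice (H_ext A I m)"
  and rjoin_H_ext: "\<lbrakk>g \<in> carrier (H_ext A I m); h \<in> carrier (H_ext A I m)\<rbrakk> \<Longrightarrow>
    rjoin (H_ext A I m) g h = (\<lambda>\<xi>\<in>A \<rightarrow>\<^sub>E I. max (g \<xi>) (h \<xi>))"
proof -
  let ?V = "H_ext A I m"
  have cont [continuous_intros]: "continuous_map (cube_topology A I) euclideanreal h"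
    if "h \<in> carrier ?V" for h
    using that by (rule H_ext_continuous)
  have zero: "(\<lambda>\<xi>\<in>A \<rightarrow>\<^sub>E I. 0) \<in> carrier ?V"
    by (rule restrict_in_H_ext) simp_all
  have add: "(\<lambda>\<xi>\<in>A \<rightarrow>\<^sub>E I. g \<xi> + h \<xi>) \<in> carrier ?V" if "g \<in> carrier ?V" "h \<in> carrier ?V" for g h
    using that by (intro restrict_in_H_ext continuous_intros)
      (auto simp: H_ext_homogeneous algebra_simps)
  have smult: "(\<lambda>\<xi>\<in>A \<rightarrow>\<^sub>E I. c * h \<xi>) \<in> carrier ?V" if "h \<in> carrier ?V" for c h
    using that by (intro restrict_in_H_ext continuous_map_real_mult_left continuous_intros)
      (auto simp: H_ext_homogeneous)
  have max: "(\<lambda>\<xi>\<in>A \<rightarrow>\<^sub>E I. max (g \<xi>) (h \<xi>)) \<in> carrier ?V"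
    if "g \<in> carrier ?V" "h \<in> carrier ?V" for g h
    using that by (intro restrict_in_H_ext continuous_intros)
      (auto simp: H_ext_homogeneous max_mult_distrib_left)
  have min: "(\<lambda>\<xi>\<in>A \<rightarrow>\<^sub>E I. min (g \<xi>) (h \<xi>)) \<in> carrier ?V"
    if "g \<in> carrier ?V" "h \<in> carrier ?V" for g h
    using that by (intro restrict_in_H_ext continuous_intros)
      (auto simp: H_ext_homogeneous min_mult_distrib_left)
  have antisym: "g = h" if "\<forall>\<xi>\<in>A \<rightarrow>\<^sub>E I. g \<xi> \<le> h \<xi>" "\<forall>\<xi>\<in>A \<rightarrow>\<^sub>E I. h \<xi> \<le> g \<xi>"
    "g \<in> carrier ?V" "h \<in> carrier ?V" for g h
    using that by (intro H_ext_eqI[of g A I m h m]) (auto intro: antisym)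
  have right_zero: "(\<lambda>\<xi>\<in>A \<rightarrow>\<^sub>E I. h \<xi> + (if \<xi> \<in> A \<rightarrow>\<^sub>E I then 0 else undefined)) = h"
    if "h \<in> carrier ?V" for h
    using that add[OF that zero] by (intro H_ext_eqI[of _ A I m h m]) auto
  have one: "(\<lambda>\<xi>\<in>A \<rightarrow>\<^sub>E I. 1 * h \<xi>) = h" if "h \<in> carrier ?V" for h
    using that by (intro H_ext_eqI[of _ A I m h m] smult) auto
  note * = vector_latticeI[of ?V "\<lambda>g h. \<lambda>\<xi>\<in>A \<rightarrow>\<^sub>E I. max (g \<xi>) (h \<xi>)"
      "\<lambda>g h. \<lambda>\<xi>\<in>A \<rightarrow>\<^sub>E I. min (g \<xi>) (h \<xi>)", unfolded H_ext_simps]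
  show "vector_lattice ?V"
    by (rule *(1)) (auto simp: algebra_simps mult_left_mono zero add smult max min
        intro!: restrict_ext intro: antisym right_zero one[simplified]; blast intro: order_trans)+
  show "rjoin ?V g h = (\<lambda>\<xi>\<in>A \<rightarrow>\<^sub>E I. max (g \<xi>) (h \<xi>))"
    if "g \<in> carrier ?V" "h \<in> carrier ?V" for g h
    by (rule *(2)) (auto simp: that algebra_simps mult_left_mono zero add smult max min
        intro!: restrict_ext intro: antisym right_zero one[simplified]; blast intro: order_trans)+
qed

interpretation H_ext: vlat "H_ext A I m" for A I m
  by unfold_locales (rule vector_lattice_H_ext)

lemma H_ext_diff:
  assumes "g \<in> carrier (H_ext A I m)" "h \<in> carrier (H_ext A I m)"
  shows "g \<ominus>\<^bsub>H_ext A I m\<^esub> h = (\<lambda>\<xi>\<in>A \<rightarrow>\<^sub>E I. g \<xi> - h \<xi>)"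
  using assms by (auto simp: a_minus_def H_ext.neg_eq_smult intro!: restrict_ext)

lemma rabs_H_ext:
  assumes "h \<in> carrier (H_ext A I m)"
  shows "rabs (H_ext A I m) h = (\<lambda>\<xi>\<in>A \<rightarrow>\<^sub>E I. \<bar>h \<xi>\<bar>)"
proof -
  have "\<ominus>\<^bsub>H_ext A I m\<^esub> h \<in> carrier (H_ext A I m)"
    using assms by (rule H_ext.M.a_inv_closed)
  moreover have "\<ominus>\<^bsub>H_ext A I m\<^esub> h = (\<lambda>\<xi>\<in>A \<rightarrow>\<^sub>E I. - h \<xi>)"
    using assms by (simp add: H_ext.neg_eq_smult)
  ultimately show ?thesis
    using assms by (auto simp: rabs_def rjoin_H_ext intro!: restrict_ext)
qed

definition coord :: "'a set \<Rightarrow> real set \<Rightarrow> 'a \<Rightarrow> ('a \<Rightarrow> real) \<Rightarrow> real" where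
  "coord A I b = (\<lambda>\<xi>\<in>A \<rightarrow>\<^sub>E I. \<xi> b)"

abbreviation "coords A \<equiv> coord A {-1..1}"

lemma continuous_map_coordinate:
  assumes "b \<in> A"
  shows "continuous_map (cube_topology A I) euclideanreal (\<lambda>\<xi>. \<xi> b)"
  using continuous_map_product_projection[OF assms, of "\<lambda>_. top_of_set I"]
  by (rule continuous_map_into_fulltopology)

lemma coord_closed: "b \<in> A \<Longrightarrow> coord A I b \<in> carrier (H_ext A I m)"
  unfolding coord_def by (intro restrict_in_H_ext continuous_map_coordinate) auto

lemma eval_H_ext:
  assumes "vars t \<subseteq> A" "\<xi> \<in> A \<rightarrow>\<^sub>E I"
  shows "eval (H_ext A I m) (coord A I) t \<xi> = reval \<xi> t"
  using assms(1)
proof (induction t)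
  case (Join s t)
  then have "eval (H_ext A I m) (coord A I) s \<in> carrier (H_ext A I m)"
      "eval (H_ext A I m) (coord A I) t \<in> carrier (H_ext A I m)"
    by (auto intro!: H_ext.eval_closed coord_closed)
  with Join show ?case
    using assms(2) by (simp add: rjoin_H_ext)
qed (use assms(2) in \<open>auto simp: coord_def\<close>)

lemma archimedean_H_ext: "archimedean_vl (H_ext A I m)"
  unfolding archimedean_vl_def
proof (intro ballI impI)
  fix x y
  assume xy: "x \<in> carrier (H_ext A I m)" "y \<in> carrier (H_ext A I m)"
    and le: "rle (H_ext A I m) \<zero>\<^bsub>H_ext A I m\<^esub> x \<and> (\<forall>n. rle (H_ext A I m) (real n \<odot>\<^bsub>H_ext A I m\<^esub> x) y)"
  show "x = \<zero>\<^bsub>H_ext A I m\<^esub>"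
  proof (rule H_ext_eqI)
    fix \<xi> assume \<xi>: "\<xi> \<in> A \<rightarrow>\<^sub>E I"
    have "x \<xi> \<le> 0"
    proof (rule ccontr)
      assume "\<not> x \<xi> \<le> 0"
      then obtain n where "y \<xi> < real n * x \<xi>"
        using reals_Archimedean3[of "x \<xi>"] by auto
      with le \<xi> show False
        by (auto simp: not_le[symmetric])
    qed
    with le \<xi> show "x \<xi> = \<zero>\<^bsub>H_ext A I m\<^esub> \<xi>"
      by (auto intro: antisym)
  qed (use xy in \<open>auto simp del: H_ext_simps\<close>)
qed

abbreviation cube :: "'a set \<Rightarrow> ('a \<Rightarrow> real) set" where
  "cube A \<equiv> A \<rightarrow>\<^sub>E {-1..1}"

lemma compact_space_cube: "compact_space (cube_topology A {-1..1})"
  by (simp add: compact_space_product_topology compact_space_subtopology)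

lemma bounded_on_cube:
  assumes "continuous_map (cube_topology A {-1..1}) euclideanreal h"
  obtains M where "0 < M" "\<And>\<xi>. \<xi> \<in> cube A \<Longrightarrow> \<bar>h \<xi>\<bar> \<le> M"
proof -
  have "compactin euclideanreal (h ` topspace (cube_topology A {-1..1}))"
    using compact_space_cube[of A] assms unfolding compact_space_def by (rule image_compactin)
  then have "bounded (h ` cube A)"
    by (simp add: compact_imp_bounded)
  then obtain M where "0 < M" "\<forall>x\<in>h ` cube A. norm x \<le> M"
    unfolding bounded_pos by blast
  then show thesis
    by (intro that[of M]) auto
qed

text \<open>
  By Tychonoff's theorem the cube is compact, hence the regulator is bounded on it and a relatively
  uniform Cauchy sequence is uniformly Cauchy. The limit is reached with the same regulator.
\<close>

lemma H_Delta_uniformly_complete: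
  fixes A :: "'a set" and m :: 'm and s :: "nat \<Rightarrow> ('a \<Rightarrow> real) \<Rightarrow> real"
  defines "V \<equiv> H_cube A m"
  assumes u: "u \<in> carrier V" and s: "range s \<subseteq> carrier V" and cauchy: "r_cauchy V u s"
  obtains x where "x \<in> carrier V" "r_converges V s x u"
proof -
  have s_in: "s n \<in> carrier V" for n
    using s by auto
  have *: "rle V (rabs V (g \<ominus>\<^bsub>V\<^esub> h)) ((1 / real k) \<odot>\<^bsub>V\<^esub> rabs V u) \<longleftrightarrow>
    (\<forall>\<xi>\<in>cube A. \<bar>g \<xi> - h \<xi>\<bar> \<le> 1 / real k * \<bar>u \<xi>\<bar>)" if "g \<in> carrier V" "h \<in> carrier V" for g h k
  proof -
    have "g \<ominus>\<^bsub>V\<^esub> h \<in> carrier V"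
      using that unfolding V_def by (rule H_ext.M.minus_closed)
    then show ?thesis
      using that u unfolding V_def by (simp add: rabs_H_ext) (simp add: H_ext_diff)
  qed
  have cauchy': "\<exists>m. \<forall>n\<ge>m. \<forall>n'\<ge>m. \<forall>\<xi>\<in>cube A. \<bar>s n \<xi> - s n' \<xi>\<bar> \<le> 1 / real k * \<bar>u \<xi>\<bar>" if "k \<ge> 1" for k
    using cauchy that unfolding r_cauchy_def by (simp add: * s_in)
  obtain M where M: "0 < M" "\<And>\<xi>. \<xi> \<in> cube A \<Longrightarrow> \<bar>u \<xi>\<bar> \<le> M"
    by (rule bounded_on_cube[OF H_ext_continuous[OF u[unfolded V_def]]]) (rule that)
  have unif: "\<exists>m. \<forall>n\<ge>m. \<forall>n'\<ge>m. \<forall>\<xi>\<in>cube A. \<bar>s n \<xi> - s n' \<xi>\<bar> < \<epsilon>" if "0 < \<epsilon>" for \<epsilon>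
  proof -
    obtain k :: nat where k: "M / \<epsilon> < real k"
      using reals_Archimedean2 by blast
    then have "0 < real k"
      using M(1) that by (meson divide_pos_pos less_trans)
    then have "k \<ge> 1"
      by simp
    from cauchy'[OF this] obtain m where
      m: "\<forall>n\<ge>m. \<forall>n'\<ge>m. \<forall>\<xi>\<in>cube A. \<bar>s n \<xi> - s n' \<xi>\<bar> \<le> 1 / real k * \<bar>u \<xi>\<bar>"
      by blast
    have "1 / real k * \<bar>u \<xi>\<bar> < \<epsilon>" if "\<xi> \<in> cube A" for \<xi>
    proof -
      have "1 / real k * \<bar>u \<xi>\<bar> \<le> 1 / real k * M"
        using M(2)[OF that] by (intro mult_left_mono) auto
      also have "\<dots> < \<epsilon>"
        using k \<open>0 < \<epsilon>\<close> \<open>0 < real k\<close> by (simp add: field_simps)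
      finally show ?thesis .
    qed
    with m show ?thesis
      by (intro exI[of _ m]) (meson le_less_trans)
  qed
  obtain x where contx: "continuous_map (cube_topology A {-1..1}) euclideanreal x"
    and x: "\<And>\<epsilon>. 0 < \<epsilon> \<Longrightarrow> \<forall>\<^sub>F n in sequentially. \<forall>\<xi>\<in>cube A. dist (s n \<xi>) (x \<xi>) < \<epsilon>"
  proof (rule Met_TC.continuous_map_uniformly_Cauchy_limit)
    show "\<forall>\<^sub>F n in sequentially. continuous_map (cube_topology A {-1..1}) (Met_TC.mtopology) (s n)"
      using H_ext_continuous[OF s_in[unfolded V_def]] by simp
    show "\<exists>N. \<forall>m n \<xi>. N \<le> m \<longrightarrow> N \<le> n \<longrightarrow> \<xi> \<in> topspace (cube_topology A {-1..1}) \<longrightarrow> dist (s m \<xi>) (s n \<xi>) < \<epsilon>"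
      if "\<epsilon> > 0" for \<epsilon>
      using unif[OF that] by (simp add: dist_real_def) meson
  qed (auto simp: complete_UNIV)
  have lim: "(\<lambda>n. s n \<xi>) \<longlonglongrightarrow> x \<xi>" if "\<xi> \<in> cube A" for \<xi>
    unfolding tendsto_iff
  proof (intro allI impI)
    fix e :: real assume "0 < e"
    from x[OF this] show "\<forall>\<^sub>F n in sequentially. dist (s n \<xi>) (x \<xi>) < e"
      by (rule eventually_mono) (use that in blast)
  qed
  have xV: "restrict x (cube A) \<in> carrier V"
    unfolding V_def
  proof (rule restrict_in_H_ext[OF contx])
    fix t \<xi> assume t: "0 \<le> t" "\<xi> \<in> cube A" "(\<lambda>a\<in>A. t * \<xi> a) \<in> cube A"
    then have "s n (\<lambda>a\<in>A. t * \<xi> a) = t * s n \<xi>" for n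
      using s_in unfolding V_def by (intro H_ext_homogeneous)
    then have "(\<lambda>n. t * s n \<xi>) \<longlonglongrightarrow> x (\<lambda>a\<in>A. t * \<xi> a)"
      using lim[OF t(3)] by simp
    moreover have "(\<lambda>n. t * s n \<xi>) \<longlonglongrightarrow> t * x \<xi>"
      using lim[OF t(2)] by (intro tendsto_intros)
    ultimately show "x (\<lambda>a\<in>A. t * \<xi> a) = t * x \<xi>"
      by (rule LIMSEQ_unique)
  qed
  moreover have "r_converges V s (restrict x (cube A)) u"
    unfolding r_converges_def
  proof (intro allI impI)
    fix k :: nat assume "k \<ge> 1"
    from cauchy'[OF this] obtain m where
      m: "\<forall>n\<ge>m. \<forall>n'\<ge>m. \<forall>\<xi>\<in>cube A. \<bar>s n \<xi> - s n' \<xi>\<bar> \<le> 1 / real k * \<bar>u \<xi>\<bar>"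
      by blast
    have "\<bar>s n \<xi> - x \<xi>\<bar> \<le> 1 / real k * \<bar>u \<xi>\<bar>" if "n \<ge> m" "\<xi> \<in> cube A" for n \<xi>
    proof (rule LIMSEQ_le_const2)
      show "(\<lambda>n'. \<bar>s n \<xi> - s n' \<xi>\<bar>) \<longlonglongrightarrow> \<bar>s n \<xi> - x \<xi>\<bar>"
        using lim[OF that(2)] by (intro tendsto_intros)
      show "\<exists>N. \<forall>n'\<ge>N. \<bar>s n \<xi> - s n' \<xi>\<bar> \<le> 1 / real k * \<bar>u \<xi>\<bar>"
        using m that by blast
    qed
    then show "\<exists>m. \<forall>n\<ge>m. rle V (rabs V (s n \<ominus>\<^bsub>V\<^esub> restrict x (cube A))) ((1 / real k) \<odot>\<^bsub>V\<^esub> rabs V u)"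
      by (intro exI[of _ m]) (simp add: * s_in xV)
  qed
  ultimately show thesis
    by (rule that)
qed

lemma ucvl_H_Delta: "ucvl (H_cube A m)"
  unfolding ucvl_def using vector_lattice_H_ext archimedean_H_ext H_Delta_uniformly_complete by meson

section \<open>Density of the lattice-linear functions\<close>

definition Abs :: "'b lterm \<Rightarrow> 'b lterm" where
  "Abs t = Join t (Smul (- 1) t)"

definition Meet :: "'b lterm \<Rightarrow> 'b lterm \<Rightarrow> 'b lterm" where
  "Meet s t = Smul (- 1) (Join (Smul (- 1) s) (Smul (- 1) t))"

definition Sum :: "('b \<Rightarrow> 'c lterm) \<Rightarrow> 'b list \<Rightarrow> 'c lterm" where
  "Sum f bs = foldr (\<lambda>b. Add (f b)) bs Zero"

lemma vars_Abs [simp]: "vars (Abs t) = vars t"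
  by (simp add: Abs_def)

lemma reval_Abs [simp]: "reval \<xi> (Abs t) = \<bar>reval \<xi> t\<bar>"
  by (simp add: Abs_def abs_if max_def)

lemma vars_Meet [simp]: "vars (Meet s t) = vars s \<union> vars t"
  by (simp add: Meet_def)

lemma reval_Meet [simp]: "reval \<xi> (Meet s t) = min (reval \<xi> s) (reval \<xi> t)"
  by (simp add: Meet_def max_def min_def)

lemma Sum_simps [simp]: "Sum f [] = Zero" "Sum f (b # bs) = Add (f b) (Sum f bs)"
  by (simp_all add: Sum_def)

lemma vars_Sum: "vars (Sum f bs) = (\<Union>b\<in>set bs. vars (f b))"
  by (induction bs) simp_all

lemma reval_Sum: "distinct bs \<Longrightarrow> reval \<xi> (Sum f bs) = (\<Sum>b\<in>set bs. reval \<xi> (f b))"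
  by (induction bs) simp_all

definition l1 :: "'b set \<Rightarrow> ('b \<Rightarrow> real) \<Rightarrow> real" where
  "l1 B \<xi> = (\<Sum>b\<in>B. \<bar>\<xi> b\<bar>)"

definition listing :: "'b set \<Rightarrow> 'b list" where
  "listing B = (SOME bs. set bs = B \<and> distinct bs)"

lemma listing:
  assumes "finite B"
  shows "set (listing B) = B" "distinct (listing B)"
  using someI_ex[OF finite_distinct_list[OF assms]] by (simp_all add: listing_def)

definition L1 :: "'b set \<Rightarrow> 'b lterm" where
  "L1 B = Sum (\<lambda>b. Abs (Var b)) (listing B)"

lemma vars_L1: "finite B \<Longrightarrow> vars (L1 B) = B"
  by (simp add: L1_def vars_Sum listing)

lemma reval_L1: "finite B \<Longrightarrow> reval \<xi> (L1 B) = l1 B \<xi>"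
  by (simp add: L1_def l1_def reval_Sum listing)

lemma l1_nonneg: "0 \<le> l1 B \<xi>"
  by (simp add: l1_def sum_nonneg)

lemma abs_le_l1: "\<lbrakk>finite B; b \<in> B\<rbrakk> \<Longrightarrow> \<bar>\<xi> b\<bar> \<le> l1 B \<xi>"
  unfolding l1_def by (intro member_le_sum) auto

lemma continuous_reval:
  assumes "vars t \<subseteq> B"
  shows "continuous_map (cube_topology B I) euclideanreal (\<lambda>\<xi>. reval \<xi> t)"
  using assms
  by (induction t) (auto intro!: continuous_intros continuous_map_real_mult_left continuous_map_coordinate)

lemma compactin_cube_closed:
  assumes "continuous_map (cube_topology B {-1..1}) euclideanreal f" "closed C"
  shows "compactin (cube_topology B {-1..1}) {\<xi> \<in> cube B. f \<xi> \<in> C}"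
proof -
  have "closedin (cube_topology B {-1..1}) {\<xi> \<in> topspace (cube_topology B {-1..1}). f \<xi> \<in> C}"
    using assms by (intro closedin_continuous_map_preimage) auto
  then show ?thesis
    using closedin_compact_space[OF compact_space_cube] by simp
qed

lemma cube_normalise:
  assumes B: "finite B" and \<xi>: "\<xi> \<in> cube B"
  obtains \<sigma> where "\<sigma> \<in> cube B" "\<And>b. b \<in> B \<Longrightarrow> \<xi> b = l1 B \<xi> * \<sigma> b" "l1 B \<xi> \<noteq> 0 \<Longrightarrow> l1 B \<sigma> = 1"
proof (cases "l1 B \<xi> = 0")
  case True
  then have "\<xi> b = 0" if "b \<in> B" for b
    using abs_le_l1[OF B that, of \<xi>] by simp
  with True \<xi> show ?thesis
    by (intro that[of \<xi>]) auto
next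
  case False
  define \<sigma> where "\<sigma> = (\<lambda>b\<in>B. \<xi> b / l1 B \<xi>)"
  have l: "0 < l1 B \<xi>"
    using False l1_nonneg[of B \<xi>] by simp
  have "\<sigma> \<in> cube B"
    using abs_le_l1[OF B, of _ \<xi>] l by (auto simp: \<sigma>_def field_simps abs_le_iff)
      (metis minus_le_iff)
  moreover have "l1 B \<sigma> = (\<Sum>b\<in>B. \<bar>\<xi> b\<bar> / l1 B \<xi>)"
    using l unfolding l1_def[of B \<sigma>] by (intro sum.cong) (simp_all add: \<sigma>_def)
  then have "l1 B \<sigma> = 1"
    using l by (simp add: l1_def flip: sum_divide_distrib)
  ultimately show ?thesis
    using l by (intro that[of \<sigma>]) (simp_all add: \<sigma>_def)
qed

lemma H_ext_scaled:
  assumes h: "h \<in> carrier (H_ext B I m)" and "0 \<le> c" "\<sigma> \<in> B \<rightarrow>\<^sub>E I" "\<xi> \<in> B \<rightarrow>\<^sub>E I"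
    and "\<And>b. b \<in> B \<Longrightarrow> \<xi> b = c * \<sigma> b"
  shows "h \<xi> = c * h \<sigma>"
proof -
  have "\<xi> = (\<lambda>b\<in>B. c * \<sigma> b)"
    using assms(4,5) by (auto simp: PiE_def extensional_def fun_eq_iff)
  then show ?thesis
    using H_ext_homogeneous[OF h assms(2,3)] assms(4) by simp
qed

text \<open>
  The lattice form of the Stone-Weierstrass theorem for homogeneous functions, with McShane's
  choice of approximants. On the unit sphere \<open>S\<close> of the \<open>l1\<close>-norm consider, for \<open>\<eta> \<in> S\<close>, the
  function \<open>h \<eta> * l1 \<xi> + C * (\<Sum>b. \<bar>\<xi> b - \<eta> b * l1 \<xi>\<bar>)\<close>. It agrees with \<open>h\<close> at \<open>\<eta>\<close>, it is homogeneous
  and given by a term, and for large \<open>C\<close> it lies above \<open>h - \<epsilon>\<close> on \<open>S\<close>. By compactness the minimum of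
  finitely many such functions is below \<open>h + \<epsilon>\<close> on \<open>S\<close>. Homogeneity carries the estimate from the
  sphere to the cube, with error \<open>\<epsilon> * l1 \<xi>\<close>.
\<close>

lemma lterm_approximation:
  assumes B: "finite B" and h: "h \<in> carrier (H_cube B m)" and \<epsilon>: "0 < \<epsilon>"
  shows "\<exists>t. vars t \<subseteq> B \<and> (\<forall>\<xi>\<in>cube B. \<bar>h \<xi> - reval \<xi> t\<bar> \<le> \<epsilon> * l1 B \<xi>)"
proof -
  let ?X = "cube_topology B {-1..1}"
  define S where "S = {\<xi> \<in> cube B. l1 B \<xi> = 1}"
  note conth = H_ext_continuous[OF h]
  have cont_reval: "continuous_map ?X euclideanreal (\<lambda>\<xi>. reval \<xi> t)" if "vars t \<subseteq> B" for t
    using that by (rule continuous_reval)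
  have contl1: "continuous_map ?X euclideanreal (l1 B)"
    using cont_reval[of "L1 B"] by (simp add: vars_L1 reval_L1 B)
  have S: "compactin ?X S"
    using compactin_cube_closed[OF contl1, of "{1}"] by (simp add: S_def)
  obtain M where M: "0 < M" "\<And>\<xi>. \<xi> \<in> cube B \<Longrightarrow> \<bar>h \<xi>\<bar> \<le> M"
    by (rule bounded_on_cube[OF conth]) (rule that)
  have "\<exists>t. vars t \<subseteq> B \<and> reval \<eta> t = h \<eta> \<and> (\<forall>\<xi>\<in>S. h \<xi> \<le> reval \<xi> t + \<epsilon>)" if \<eta>: "\<eta> \<in> S" for \<eta>
  proof -
    define D where "D = Sum (\<lambda>b. Abs (Add (Var b) (Smul (- \<eta> b) (L1 B)))) (listing B)"
    have D: "vars D \<subseteq> B" "\<And>\<xi>. reval \<xi> D = (\<Sum>b\<in>B. \<bar>\<xi> b - \<eta> b * l1 B \<xi>\<bar>)"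
      using B by (auto simp: D_def vars_Sum vars_L1 listing reval_Sum reval_L1)
    \<comment> \<open>The part of the sphere where the constant \<open>h \<eta>\<close> is not yet large enough; there \<open>D\<close>, the distance to \<open>\<eta>\<close>,
      has a positive lower bound, which determines the slope.\<close>
    define K where "K = {\<xi> \<in> cube B. l1 B \<xi> \<in> {1}} \<inter> {\<xi> \<in> cube B. h \<xi> \<in> {h \<eta> + \<epsilon>..}}"
    have "compactin ?X {\<xi> \<in> cube B. l1 B \<xi> \<in> {1}}"
      by (rule compactin_cube_closed[OF contl1]) simp
    moreover have "closedin ?X {\<xi> \<in> topspace ?X. h \<xi> \<in> {h \<eta> + \<epsilon>..}}"
      using conth by (rule closedin_continuous_map_preimage) simp
    ultimately have "compactin ?X K"
      unfolding K_def by (intro compact_Int_closedin) simp_all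
    then have K: "compact ((\<lambda>\<xi>. reval \<xi> D) ` K)"
      using image_compactin[OF _ cont_reval[OF D(1)]] by simp
    have D_pos: "0 < reval \<xi> D" if "\<xi> \<in> K" for \<xi>
    proof -
      have "0 \<le> reval \<xi> D"
        by (simp add: D sum_nonneg)
      moreover have "reval \<xi> D \<noteq> 0"
      proof
        assume "reval \<xi> D = 0"
        then have "\<forall>b\<in>B. \<xi> b = \<eta> b"
          using B that by (simp add: D K_def sum_nonneg_eq_0_iff)
        then have "\<xi> = \<eta>"
          using that \<eta> by (intro PiE_ext[of \<xi> B "\<lambda>_. {-1..1}" \<eta>]) (auto simp: K_def S_def)
        then show False
          using that \<epsilon> by (simp add: K_def)
      qed
      ultimately show ?thesis
        by simp
    qed
    have "\<exists>\<delta>>0. \<forall>\<xi>\<in>K. \<delta> \<le> reval \<xi> D"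
    proof (cases "K = {}")
      case False
      then obtain \<zeta> where "\<zeta> \<in> K" "\<forall>\<xi>\<in>K. reval \<zeta> D \<le> reval \<xi> D"
        using compact_attains_inf[OF K] by auto
      then show ?thesis
        using D_pos by (intro exI[of _ "reval \<zeta> D"]) auto
    qed (auto intro: exI[of _ 1])
    then obtain \<delta> where \<delta>: "0 < \<delta>" "\<And>\<xi>. \<xi> \<in> K \<Longrightarrow> \<delta> \<le> reval \<xi> D"
      by blast
    \<comment> \<open>The oscillation of \<open>h\<close> is at most \<open>2 * M\<close>, so this slope bridges it at distance \<open>\<delta>\<close>.\<close>
    define t where "t = Add (Smul (h \<eta>) (L1 B)) (Smul (2 * M / \<delta>) D)"
    have t: "reval \<xi> t = h \<eta> + 2 * M / \<delta> * reval \<xi> D" if "\<xi> \<in> S" for \<xi>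
      using that B by (simp add: t_def reval_L1 S_def)
    have "h \<xi> \<le> reval \<xi> t + \<epsilon>" if \<xi>: "\<xi> \<in> S" for \<xi>
    proof (cases "\<xi> \<in> K")
      case True
      have "\<bar>h \<xi>\<bar> \<le> M" "\<bar>h \<eta>\<bar> \<le> M"
        using \<xi> \<eta> M(2) by (auto simp: S_def)
      then have "h \<xi> \<le> h \<eta> + 2 * M / \<delta> * \<delta>"
        using \<delta>(1) by simp
      also have "2 * M / \<delta> * \<delta> \<le> 2 * M / \<delta> * reval \<xi> D"
        using M(1) \<delta>(1) \<delta>(2)[OF True] by (intro mult_left_mono) auto
      finally show ?thesis
        using t[OF \<xi>] \<epsilon> by simp
    next
      case False
      then have "h \<xi> < h \<eta> + \<epsilon>"
        using \<xi> by (auto simp: K_def S_def)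
      moreover have "0 \<le> 2 * M / \<delta> * reval \<xi> D"
        using M(1) \<delta>(1) by (simp add: D sum_nonneg)
      ultimately show ?thesis
        using t[OF \<xi>] by simp
    qed
    moreover have "reval \<eta> D = 0"
      using \<eta> by (simp add: D S_def)
    ultimately show ?thesis
      using t[OF \<eta>] D(1) B by (intro exI[of _ t]) (auto simp: t_def vars_L1)
  qed
  then obtain maj where maj: "\<And>\<eta>. \<eta> \<in> S \<Longrightarrow> vars (maj \<eta>) \<subseteq> B" "\<And>\<eta>. \<eta> \<in> S \<Longrightarrow> reval \<eta> (maj \<eta>) = h \<eta>"
    "\<And>\<eta> \<xi>. \<lbrakk>\<eta> \<in> S; \<xi> \<in> S\<rbrakk> \<Longrightarrow> h \<xi> \<le> reval \<xi> (maj \<eta>) + \<epsilon>"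
    by metis
  define U where "U \<eta> = {\<xi> \<in> topspace ?X. reval \<xi> (maj \<eta>) - h \<xi> \<in> {..<\<epsilon>}}" for \<eta>
  have openU: "openin ?X (U \<eta>)" if "\<eta> \<in> S" for \<eta>
    unfolding U_def using maj(1)[OF that] conth
    by (intro openin_continuous_map_preimage[where Y = euclideanreal] continuous_map_diff cont_reval) auto
  have cover: "S \<subseteq> \<Union> (U ` S)"
    using maj(2) \<epsilon> by (auto simp: U_def S_def)
  have "\<exists>\<F>. finite \<F> \<and> \<F> \<subseteq> U ` S \<and> S \<subseteq> \<Union> \<F>"
    by (rule compactinD[OF S _ cover]) (use openU in auto)
  then obtain \<F> where \<F>: "finite \<F>" "\<F> \<subseteq> U ` S" "S \<subseteq> \<Union> \<F>"
    by blast
  then obtain F where F: "F \<subseteq> S" "finite F" "S \<subseteq> (\<Union>\<eta>\<in>F. U \<eta>)"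
    using finite_subset_image[OF \<F>(1,2)] by blast
  have "\<exists>t. vars t \<subseteq> B \<and> (\<forall>\<xi>\<in>S. h \<xi> \<le> reval \<xi> t + \<epsilon>) \<and> (\<forall>\<eta>\<in>F. \<forall>\<xi>\<in>U \<eta>. reval \<xi> t \<le> h \<xi> + \<epsilon>)"
    using F(2,1)
  proof (induction F rule: finite_induct)
    case empty
    have "h \<xi> \<le> reval \<xi> (Smul M (L1 B)) + \<epsilon>" if "\<xi> \<in> S" for \<xi>
      using M(2)[of \<xi>] \<epsilon> that B by (auto simp: S_def reval_L1)
    then show ?case
      using B by (intro exI[of _ "Smul M (L1 B)"]) (simp add: vars_L1)
  next
    case (insert \<eta> F)
    then obtain t where t: "vars t \<subseteq> B" "\<forall>\<xi>\<in>S. h \<xi> \<le> reval \<xi> t + \<epsilon>"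
      "\<forall>\<eta>\<in>F. \<forall>\<xi>\<in>U \<eta>. reval \<xi> t \<le> h \<xi> + \<epsilon>"
      by auto
    have "\<eta> \<in> S"
      using insert.prems by simp
    have "h \<xi> \<le> reval \<xi> (Meet (maj \<eta>) t) + \<epsilon>" if "\<xi> \<in> S" for \<xi>
      using that t(2) maj(3)[OF \<open>\<eta> \<in> S\<close>] by (simp add: min_def)
    moreover have "reval \<xi> (Meet (maj \<eta>) t) \<le> h \<xi> + \<epsilon>" if "\<zeta> \<in> insert \<eta> F" "\<xi> \<in> U \<zeta>" for \<zeta> \<xi>
    proof (cases "\<zeta> = \<eta>")
      case True
      then show ?thesis
        using that by (simp add: U_def min_le_iff_disj)
    next
      case False
      then have "reval \<xi> t \<le> h \<xi> + \<epsilon>"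
        using that t(3) by blast
      then show ?thesis
        by (simp add: min_le_iff_disj)
    qed
    ultimately show ?case
      using t(1) maj(1)[OF \<open>\<eta> \<in> S\<close>] by (intro exI[of _ "Meet (maj \<eta>) t"]) auto
  qed
  then obtain t where t: "vars t \<subseteq> B" "\<And>\<xi>. \<xi> \<in> S \<Longrightarrow> h \<xi> \<le> reval \<xi> t + \<epsilon>"
    "\<And>\<eta> \<xi>. \<lbrakk>\<eta> \<in> F; \<xi> \<in> U \<eta>\<rbrakk> \<Longrightarrow> reval \<xi> t \<le> h \<xi> + \<epsilon>"
    by blast
  have on_S: "\<bar>h \<xi> - reval \<xi> t\<bar> \<le> \<epsilon>" if \<xi>: "\<xi> \<in> S" for \<xi>
  proof -
    obtain \<eta> where "\<eta> \<in> F" "\<xi> \<in> U \<eta>"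
      using F(3) \<xi> by blast
    then show ?thesis
      using t(2)[OF \<xi>] t(3)[of \<eta> \<xi>] by (simp add: abs_le_iff)
  qed
  have "\<bar>h \<xi> - reval \<xi> t\<bar> \<le> \<epsilon> * l1 B \<xi>" if \<xi>: "\<xi> \<in> cube B" for \<xi>
  proof -
    obtain \<sigma> where \<sigma>: "\<sigma> \<in> cube B" "\<And>b. b \<in> B \<Longrightarrow> \<xi> b = l1 B \<xi> * \<sigma> b"
      "l1 B \<xi> \<noteq> 0 \<Longrightarrow> l1 B \<sigma> = 1"
      by (rule cube_normalise[OF B \<xi>]) (rule that)
    have "h \<xi> = l1 B \<xi> * h \<sigma>"
      by (rule H_ext_scaled[OF h l1_nonneg \<sigma>(1) \<xi> \<sigma>(2)])
    moreover have "reval \<xi> t = l1 B \<xi> * reval \<sigma> t"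
      using reval_cong[of t \<xi> "\<lambda>b. l1 B \<xi> * \<sigma> b"] reval_scale[OF l1_nonneg, of B \<xi> \<sigma> t] \<sigma>(2) t(1)
      by (metis subsetD)
    ultimately have "\<bar>h \<xi> - reval \<xi> t\<bar> = l1 B \<xi> * \<bar>h \<sigma> - reval \<sigma> t\<bar>"
      by (metis abs_mult abs_of_nonneg l1_nonneg right_diff_distrib)
    also have "\<dots> \<le> l1 B \<xi> * \<epsilon>"
      using on_S[of \<sigma>] \<sigma>(1,3) l1_nonneg[of B \<xi>]
      by (cases "l1 B \<xi> = 0") (auto simp: S_def intro: mult_left_mono)
    finally show ?thesis
      by (simp add: mult.commute)
  qed
  with t(1) show ?thesis
    by blast
qed

section \<open>Functional calculus\<close>

context vlat
begin

lemma le_add_nonneg: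
  assumes "x \<preceq> y" "\<zero> \<preceq> z" "x \<in> carrier V" "y \<in> carrier V" "z \<in> carrier V"
  shows "x \<preceq> y \<oplus> z"
  using add_mono[OF assms(1,2)] assms by simp

lemma zero_le_smult: "\<lbrakk>0 \<le> c; \<zero> \<preceq> x; x \<in> carrier V\<rbrakk> \<Longrightarrow> \<zero> \<preceq> c \<odot> x"
  using smult_le[of \<zero> x c] by simp

lemma smult_mono_left:
  assumes "c \<le> d" "\<zero> \<preceq> x" "x \<in> carrier V"
  shows "c \<odot> x \<preceq> d \<odot> x"
proof -
  have "c \<odot> x \<preceq> c \<odot> x \<oplus> (d - c) \<odot> x"
    using assms by (intro le_add_nonneg zero_le_smult le_refl) simp_all
  then show ?thesis
    using assms smult_distrib_left[of x c "d - c"] by simp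
qed

text \<open>
  The Archimedean axiom speaks about positive elements; it is applied to the positive part of \<open>x - y\<close>.
\<close>

lemma archimedean_le:
  assumes arch: "archimedean_vl V"
    and [simp]: "x \<in> carrier V" "y \<in> carrier V" "w \<in> carrier V"
    and le: "\<And>\<epsilon>. 0 < \<epsilon> \<Longrightarrow> x \<preceq> y \<oplus> \<epsilon> \<odot> w"
  shows "x \<preceq> y"
proof -
  define p where "p = rjoin V (x \<ominus> y) \<zero>"
  define z where "z = rjoin V w \<zero>"
  have [simp]: "p \<in> carrier V" "z \<in> carrier V"
    by (simp_all add: p_def z_def)
  have z: "w \<preceq> z" "\<zero> \<preceq> z"
    by (simp_all add: z_def join_ge1 join_ge2)
  have "real n \<odot> p \<preceq> z" for n
  proof (cases "n = 0")
    case True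
    then show ?thesis
      using z by simp
  next
    case False
    then have n: "0 < 1 / real n"
      by simp
    have "x \<preceq> y \<oplus> (1 / real n) \<odot> w"
      using n by (rule le)
    then have "x \<ominus> y \<preceq> (1 / real n) \<odot> w"
      by (simp add: diff_le_iff M.a_comm)
    moreover have "(1 / real n) \<odot> w \<preceq> (1 / real n) \<odot> z"
      using n z by (intro smult_le) simp_all
    ultimately have "x \<ominus> y \<preceq> (1 / real n) \<odot> z"
      by (rule le_trans) simp_all
    moreover have "\<zero> \<preceq> (1 / real n) \<odot> z"
      using n z by (intro zero_le_smult) simp_all
    ultimately have "p \<preceq> (1 / real n) \<odot> z"
      unfolding p_def by (intro join_least) simp_all
    then have "real n \<odot> p \<preceq> real n \<odot> ((1 / real n) \<odot> z)"
      by (intro smult_le) simp_all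
    then show ?thesis
      using False by (simp add: smult_smult)
  qed
  moreover have "\<zero> \<preceq> p"
    by (simp add: p_def join_ge2)
  ultimately have "p = \<zero>"
    using arch[unfolded archimedean_vl_def, rule_format, of p z] by simp
  then have "x \<ominus> y \<preceq> \<zero>"
    using join_ge1[of "x \<ominus> y" \<zero>] by (simp add: p_def)
  then show ?thesis
    by (simp add: diff_le_iff)
qed

lemma rabs_closed [simp]: "x \<in> carrier V \<Longrightarrow> rabs V x \<in> carrier V"
  by (simp add: rabs_def)

lemma rabs_diff_leD:
  assumes "rabs V (x \<ominus> y) \<preceq> v" "x \<in> carrier V" "y \<in> carrier V" "v \<in> carrier V"
  shows "x \<preceq> y \<oplus> v" "y \<preceq> x \<oplus> v"
proof -
  have "x \<ominus> y \<preceq> v" "\<ominus> (x \<ominus> y) \<preceq> v"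
    using assms by (auto intro!: le_trans[OF _ assms(1)] simp: rabs_def join_ge1 join_ge2)
  moreover have "\<ominus> (x \<ominus> y) = y \<ominus> x"
    using assms by (simp add: a_minus_def M.minus_add M.a_comm)
  ultimately show "x \<preceq> y \<oplus> v" "y \<preceq> x \<oplus> v"
    using assms by (simp_all add: diff_le_iff M.a_comm)
qed

lemma eval_Abs: "q \<in> vars t \<rightarrow> carrier V \<Longrightarrow> eval V q (Abs t) = rabs V (eval V q t)"
  by (simp add: Abs_def rabs_def eval_closed uminus_smult)

end

lemma eval_cong: "(\<And>b. b \<in> vars t \<Longrightarrow> q b = q' b) \<Longrightarrow> eval V q t = eval V q' t"
  by (induction t) auto

context vlat_tuple
begin

text \<open>
  The element \<open>\<Sum>b\<in>B. \<bar>q b\<bar>\<close>, which serves as regulator of all approximations; it corresponds to the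
  function \<open>l1\<close>.
\<close>

definition u :: 'v where
  "u = eval V q (L1 B)"

lemma u_closed [simp]: "u \<in> carrier V"
  by (simp add: u_def vars_L1 finite_B)

lemma u_nonneg: "\<zero> \<preceq> u"
  using eval_mono[of Zero "L1 B"] by (simp add: u_def vars_L1 reval_L1 finite_B l1_nonneg)

lemma eval_le_add_u:
  assumes "vars s \<subseteq> B" "vars t \<subseteq> B"
    and "\<And>\<xi>. \<xi> \<in> cube B \<Longrightarrow> reval \<xi> s \<le> reval \<xi> t + c * l1 B \<xi>"
  shows "eval V q s \<preceq> eval V q t \<oplus> c \<odot> u"
  using eval_mono[of s "Add t (Smul c (L1 B))"] assms
  by (simp add: u_def vars_L1 reval_L1 finite_B)

abbreviation near :: "real \<Rightarrow> (('b \<Rightarrow> real) \<Rightarrow> real) \<Rightarrow> 'v \<Rightarrow> 'b lterm \<Rightarrow> bool" where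
  "near \<epsilon> h y t \<equiv> vars t \<subseteq> B \<and> (\<forall>\<xi>\<in>cube B. \<bar>h \<xi> - reval \<xi> t\<bar> \<le> \<epsilon> * l1 B \<xi>) \<and>
    eval V q t \<preceq> y \<oplus> \<epsilon> \<odot> u \<and> y \<preceq> eval V q t \<oplus> \<epsilon> \<odot> u"

text \<open>
  The closure of the set of all pairs of the form (function given by \<open>t\<close>, value of \<open>t\<close> at \<open>q\<close>),
  relatively uniformly with respect to \<open>l1\<close> and \<open>u\<close>. It turns out to be the graph of the Riesz
  homomorphism that sends the coordinate functions to \<open>q\<close>: it is single-valued because terms can be
  compared pointwise (\<open>eval_mono\<close>), and total by density and uniform completeness.
\<close>

definition calc :: "(('b \<Rightarrow> real) \<Rightarrow> real) \<Rightarrow> 'v \<Rightarrow> bool" where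
  "calc h y \<longleftrightarrow> y \<in> carrier V \<and> (\<forall>\<epsilon>>0. \<exists>t. near \<epsilon> h y t)"

lemma calcE:
  assumes "calc h y" "0 < \<epsilon>"
  obtains t where "vars t \<subseteq> B" "\<And>\<xi>. \<xi> \<in> cube B \<Longrightarrow> \<bar>h \<xi> - reval \<xi> t\<bar> \<le> \<epsilon> * l1 B \<xi>"
    "eval V q t \<preceq> y \<oplus> \<epsilon> \<odot> u" "y \<preceq> eval V q t \<oplus> \<epsilon> \<odot> u"
  using assms unfolding calc_def by meson

lemma calc_closed: "calc h y \<Longrightarrow> y \<in> carrier V"
  by (simp add: calc_def)

lemma calc_mono:
  assumes arch: "archimedean_vl V" and g: "calc g x" and h: "calc h y"
    and le: "\<And>\<xi>. \<xi> \<in> cube B \<Longrightarrow> g \<xi> \<le> h \<xi>"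
  shows "x \<preceq> y"
proof (rule archimedean_le[OF arch, where w = u])
  show [simp]: "x \<in> carrier V" "y \<in> carrier V" "u \<in> carrier V"
    using g h by (simp_all add: calc_closed)
  fix \<epsilon> :: real
  assume "0 < \<epsilon>"
  define \<delta> where "\<delta> = \<epsilon> / 4"
  have \<delta>: "0 < \<delta>"
    using \<open>0 < \<epsilon>\<close> by (simp add: \<delta>_def)
  obtain s where s: "vars s \<subseteq> B" "\<And>\<xi>. \<xi> \<in> cube B \<Longrightarrow> \<bar>g \<xi> - reval \<xi> s\<bar> \<le> \<delta> * l1 B \<xi>"
    "x \<preceq> eval V q s \<oplus> \<delta> \<odot> u"
    using calcE[OF g \<delta>] by metis
  obtain t where t: "vars t \<subseteq> B" "\<And>\<xi>. \<xi> \<in> cube B \<Longrightarrow> \<bar>h \<xi> - reval \<xi> t\<bar> \<le> \<delta> * l1 B \<xi>"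
    "eval V q t \<preceq> y \<oplus> \<delta> \<odot> u"
    using calcE[OF h \<delta>] by metis
  have [simp]: "eval V q s \<in> carrier V" "eval V q t \<in> carrier V"
    using s(1) t(1) by simp_all
  have "eval V q s \<preceq> eval V q t \<oplus> (2 * \<delta>) \<odot> u"
  proof (rule eval_le_add_u[OF s(1) t(1)])
    show "reval \<xi> s \<le> reval \<xi> t + 2 * \<delta> * l1 B \<xi>" if "\<xi> \<in> cube B" for \<xi>
      using s(2)[OF that] t(2)[OF that] le[OF that] by (simp add: abs_le_iff)
  qed
  then have "eval V q s \<oplus> \<delta> \<odot> u \<preceq> (eval V q t \<oplus> (2 * \<delta>) \<odot> u) \<oplus> \<delta> \<odot> u"
    by (intro add_mono le_refl) simp_all
  with s(3) have 1: "x \<preceq> (eval V q t \<oplus> (2 * \<delta>) \<odot> u) \<oplus> \<delta> \<odot> u"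
    by (rule le_trans) simp_all
  have "(eval V q t \<oplus> (2 * \<delta>) \<odot> u) \<oplus> \<delta> \<odot> u \<preceq> ((y \<oplus> \<delta> \<odot> u) \<oplus> (2 * \<delta>) \<odot> u) \<oplus> \<delta> \<odot> u"
    using t(3) by (intro add_mono le_refl) simp_all
  with 1 have "x \<preceq> ((y \<oplus> \<delta> \<odot> u) \<oplus> (2 * \<delta>) \<odot> u) \<oplus> \<delta> \<odot> u"
    by (rule le_trans) simp_all
  also have "((y \<oplus> \<delta> \<odot> u) \<oplus> (2 * \<delta>) \<odot> u) \<oplus> \<delta> \<odot> u = y \<oplus> \<epsilon> \<odot> u"
    by (simp add: M.a_assoc \<delta>_def flip: smult_distrib_left)
  finally show "x \<preceq> y \<oplus> \<epsilon> \<odot> u" .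
qed

lemma calc_unique:
  assumes "archimedean_vl V" "calc h x" "calc h y"
  shows "x = y"
  using assms by (intro le_antisym calc_mono[of h _ h]) (auto intro: calc_closed)

lemma calc_cong:
  assumes "\<And>\<xi>. \<xi> \<in> cube B \<Longrightarrow> g \<xi> = h \<xi>"
  shows "calc g y \<longleftrightarrow> calc h y"
  using assms by (simp add: calc_def)

lemma calc_eval:
  assumes "vars t \<subseteq> B"
  shows "calc (\<lambda>\<xi>. reval \<xi> t) (eval V q t)"
  unfolding calc_def using assms
  by (auto intro!: exI[of _ t] le_add_nonneg zero_le_smult mult_nonneg_nonneg l1_nonneg u_nonneg le_refl)

lemma calc_add:
  assumes g: "calc g x" and h: "calc h y"
  shows "calc (\<lambda>\<xi>. g \<xi> + h \<xi>) (x \<oplus> y)"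
  unfolding calc_def
proof (intro conjI allI impI)
  have [simp]: "x \<in> carrier V" "y \<in> carrier V"
    using g h by (simp_all add: calc_closed)
  show "x \<oplus> y \<in> carrier V"
    by simp
  fix \<epsilon> :: real
  assume "0 < \<epsilon>"
  then have \<delta>: "0 < \<epsilon> / 2"
    by simp
  obtain s where s: "vars s \<subseteq> B" "\<And>\<xi>. \<xi> \<in> cube B \<Longrightarrow> \<bar>g \<xi> - reval \<xi> s\<bar> \<le> \<epsilon> / 2 * l1 B \<xi>"
    "eval V q s \<preceq> x \<oplus> (\<epsilon> / 2) \<odot> u" "x \<preceq> eval V q s \<oplus> (\<epsilon> / 2) \<odot> u"
    by (rule calcE[OF g \<delta>]) (rule that)
  obtain t where t: "vars t \<subseteq> B" "\<And>\<xi>. \<xi> \<in> cube B \<Longrightarrow> \<bar>h \<xi> - reval \<xi> t\<bar> \<le> \<epsilon> / 2 * l1 B \<xi>"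
    "eval V q t \<preceq> y \<oplus> (\<epsilon> / 2) \<odot> u" "y \<preceq> eval V q t \<oplus> (\<epsilon> / 2) \<odot> u"
    by (rule calcE[OF h \<delta>]) (rule that)
  have eq: "(a \<oplus> (\<epsilon> / 2) \<odot> u) \<oplus> (b \<oplus> (\<epsilon> / 2) \<odot> u) = (a \<oplus> b) \<oplus> \<epsilon> \<odot> u"
    if "a \<in> carrier V" "b \<in> carrier V" for a b
  proof -
    have "\<epsilon> \<odot> u = (\<epsilon> / 2) \<odot> u \<oplus> (\<epsilon> / 2) \<odot> u"
      by (simp flip: smult_distrib_left)
    then show ?thesis
      using that by (simp add: M.a_ac)
  qed
  have "\<bar>g \<xi> + h \<xi> - reval \<xi> (Add s t)\<bar> \<le> \<epsilon> * l1 B \<xi>" if "\<xi> \<in> cube B" for \<xi>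
    using s(2)[OF that] t(2)[OF that] unfolding reval.simps times_divide_eq_left by linarith
  moreover have "eval V q (Add s t) \<preceq> (x \<oplus> y) \<oplus> \<epsilon> \<odot> u"
    using add_mono[OF s(3) t(3)] s(1) t(1) by (simp add: eq)
  moreover have "x \<oplus> y \<preceq> eval V q (Add s t) \<oplus> \<epsilon> \<odot> u"
    using add_mono[OF s(4) t(4)] s(1) t(1) by (simp add: eq)
  ultimately show "\<exists>t. near \<epsilon> (\<lambda>\<xi>. g \<xi> + h \<xi>) (x \<oplus> y) t"
    using s(1) t(1) by (intro exI[of _ "Add s t"]) simp
qed

lemma calc_join:
  assumes g: "calc g x" and h: "calc h y"
  shows "calc (\<lambda>\<xi>. max (g \<xi>) (h \<xi>)) (rjoin V x y)"
  unfolding calc_def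
proof (intro conjI allI impI)
  have [simp]: "x \<in> carrier V" "y \<in> carrier V"
    using g h by (simp_all add: calc_closed)
  show "rjoin V x y \<in> carrier V"
    by simp
  fix \<epsilon> :: real
  assume \<epsilon>: "0 < \<epsilon>"
  obtain s where s: "vars s \<subseteq> B" "\<And>\<xi>. \<xi> \<in> cube B \<Longrightarrow> \<bar>g \<xi> - reval \<xi> s\<bar> \<le> \<epsilon> * l1 B \<xi>"
    "eval V q s \<preceq> x \<oplus> \<epsilon> \<odot> u" "x \<preceq> eval V q s \<oplus> \<epsilon> \<odot> u"
    by (rule calcE[OF g \<epsilon>]) (rule that)
  obtain t where t: "vars t \<subseteq> B" "\<And>\<xi>. \<xi> \<in> cube B \<Longrightarrow> \<bar>h \<xi> - reval \<xi> t\<bar> \<le> \<epsilon> * l1 B \<xi>"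
    "eval V q t \<preceq> y \<oplus> \<epsilon> \<odot> u" "y \<preceq> eval V q t \<oplus> \<epsilon> \<odot> u"
    by (rule calcE[OF h \<epsilon>]) (rule that)
  have mono: "rjoin V a b \<preceq> rjoin V a' b' \<oplus> \<epsilon> \<odot> u"
    if "a \<preceq> a' \<oplus> \<epsilon> \<odot> u" "b \<preceq> b' \<oplus> \<epsilon> \<odot> u"
      "a \<in> carrier V" "b \<in> carrier V" "a' \<in> carrier V" "b' \<in> carrier V" for a b a' b'
  proof (rule join_least)
    have "a' \<oplus> \<epsilon> \<odot> u \<preceq> rjoin V a' b' \<oplus> \<epsilon> \<odot> u" "b' \<oplus> \<epsilon> \<odot> u \<preceq> rjoin V a' b' \<oplus> \<epsilon> \<odot> u"
      using that by (simp_all add: add_le_cancel_right join_ge1 join_ge2)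
    with that show "a \<preceq> rjoin V a' b' \<oplus> \<epsilon> \<odot> u" "b \<preceq> rjoin V a' b' \<oplus> \<epsilon> \<odot> u"
      by (auto intro: le_trans)
  qed (use that in simp_all)
  have "\<bar>max (g \<xi>) (h \<xi>) - reval \<xi> (Join s t)\<bar> \<le> \<epsilon> * l1 B \<xi>" if "\<xi> \<in> cube B" for \<xi>
    using s(2)[OF that] t(2)[OF that] by (simp add: abs_le_iff max_def)
  moreover have "eval V q (Join s t) \<preceq> rjoin V x y \<oplus> \<epsilon> \<odot> u"
    using mono[OF s(3) t(3)] s(1) t(1) by simp
  moreover have "rjoin V x y \<preceq> eval V q (Join s t) \<oplus> \<epsilon> \<odot> u"
    using mono[OF s(4) t(4)] s(1) t(1) by simp
  ultimately show "\<exists>t. near \<epsilon> (\<lambda>\<xi>. max (g \<xi>) (h \<xi>)) (rjoin V x y) t"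
    using s(1) t(1) by (intro exI[of _ "Join s t"]) simp
qed

lemma calc_smult:
  assumes h: "calc h y"
  shows "calc (\<lambda>\<xi>. c * h \<xi>) (c \<odot> y)"
  unfolding calc_def
proof (intro conjI allI impI)
  have [simp]: "y \<in> carrier V"
    using h by (simp add: calc_closed)
  show "c \<odot> y \<in> carrier V"
    by simp
  fix \<epsilon> :: real
  assume \<epsilon>: "0 < \<epsilon>"
  define \<delta> where "\<delta> = \<epsilon> / (\<bar>c\<bar> + 1)"
  have \<delta>: "0 < \<delta>" "\<bar>c\<bar> * \<delta> \<le> \<epsilon>"
    using \<epsilon> by (simp_all add: \<delta>_def field_simps)
  obtain t where t: "vars t \<subseteq> B" "\<And>\<xi>. \<xi> \<in> cube B \<Longrightarrow> \<bar>h \<xi> - reval \<xi> t\<bar> \<le> \<delta> * l1 B \<xi>"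
    "eval V q t \<preceq> y \<oplus> \<delta> \<odot> u" "y \<preceq> eval V q t \<oplus> \<delta> \<odot> u"
    by (rule calcE[OF h \<delta>(1)]) (rule that)
  have scale: "c \<odot> a \<preceq> c \<odot> b \<oplus> \<epsilon> \<odot> u"
    if ab: "a \<preceq> b \<oplus> \<delta> \<odot> u" "b \<preceq> a \<oplus> \<delta> \<odot> u" and [simp]: "a \<in> carrier V" "b \<in> carrier V" for a b
  proof -
    have "c \<odot> a \<preceq> c \<odot> b \<oplus> (\<bar>c\<bar> * \<delta>) \<odot> u"
    proof (cases "0 \<le> c")
      case True
      then show ?thesis
        using smult_le[OF ab(1), of c] by (simp add: smult_distrib_right smult_smult)
    next
      case False
      then have "(- c) \<odot> b \<preceq> (- c) \<odot> a \<oplus> (\<bar>c\<bar> * \<delta>) \<odot> u"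
        using smult_le[OF ab(2), of "- c"] by (simp add: smult_distrib_right smult_smult)
      then have "(- c) \<odot> b \<oplus> (c \<odot> a \<oplus> c \<odot> b) \<preceq> ((- c) \<odot> a \<oplus> (\<bar>c\<bar> * \<delta>) \<odot> u) \<oplus> (c \<odot> a \<oplus> c \<odot> b)"
        by (intro add_le_cancel_right) simp_all
      moreover have "(- c) \<odot> b \<oplus> (c \<odot> a \<oplus> c \<odot> b) = c \<odot> a"
        by (simp add: uminus_smult M.a_comm[of "c \<odot> a"] M.r_neg1)
      moreover have "((- c) \<odot> a \<oplus> (\<bar>c\<bar> * \<delta>) \<odot> u) \<oplus> (c \<odot> a \<oplus> c \<odot> b) =
          (\<ominus> (c \<odot> a) \<oplus> c \<odot> a) \<oplus> (c \<odot> b \<oplus> (\<bar>c\<bar> * \<delta>) \<odot> u)"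
        by (simp add: uminus_smult M.a_ac)
      ultimately show ?thesis
        by (simp add: M.l_neg)
    qed
    moreover have "c \<odot> b \<oplus> (\<bar>c\<bar> * \<delta>) \<odot> u \<preceq> c \<odot> b \<oplus> \<epsilon> \<odot> u"
      using \<delta>(2) by (intro add_mono le_refl smult_mono_left u_nonneg) simp_all
    ultimately show ?thesis
      by (rule le_trans) simp_all
  qed
  have "\<bar>c * h \<xi> - reval \<xi> (Smul c t)\<bar> \<le> \<epsilon> * l1 B \<xi>" if "\<xi> \<in> cube B" for \<xi>
  proof -
    have "\<bar>c * h \<xi> - reval \<xi> (Smul c t)\<bar> = \<bar>c\<bar> * \<bar>h \<xi> - reval \<xi> t\<bar>"
      by (simp add: abs_mult flip: right_diff_distrib)
    also have "\<dots> \<le> \<bar>c\<bar> * (\<delta> * l1 B \<xi>)"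
      using t(2)[OF that] by (intro mult_left_mono) simp_all
    also have "\<dots> \<le> \<epsilon> * l1 B \<xi>"
      using \<delta>(2) l1_nonneg[of B \<xi>] by (simp add: mult_right_mono flip: mult.assoc)
    finally show ?thesis .
  qed
  with scale[OF t(3,4)] scale[OF t(4,3)] t(1) show "\<exists>t. near \<epsilon> (\<lambda>\<xi>. c * h \<xi>) (c \<odot> y) t"
    by (intro exI[of _ "Smul c t"]) simp
qed

text \<open>
  The values at \<open>q\<close> of terms approximating \<open>h\<close> form a Cauchy sequence with regulator \<open>u\<close>. Its limit is
  only given with some other regulator \<open>w\<close>, but the Cauchy estimates with respect to \<open>u\<close> persist in
  the limit, since multiples of \<open>w\<close> by arbitrarily small numbers can be dropped in an Archimedean
  lattice.
\<close>

lemma calc_total: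
  assumes "ucvl V" and h: "h \<in> carrier (H_cube B m)"
  shows "\<exists>y. calc h y"
proof -
  have arch: "archimedean_vl V"
    using assms(1) by (simp add: ucvl_def)
  define \<epsilon> where "\<epsilon> n = 1 / (real n + 1)" for n
  have "\<exists>t. vars t \<subseteq> B \<and> (\<forall>\<xi>\<in>cube B. \<bar>h \<xi> - reval \<xi> t\<bar> \<le> \<epsilon> n * l1 B \<xi>)" for n
    by (rule lterm_approximation[OF finite_B h]) (simp add: \<epsilon>_def)
  then obtain t where t: "\<And>n. vars (t n) \<subseteq> B"
    "\<And>n \<xi>. \<xi> \<in> cube B \<Longrightarrow> \<bar>h \<xi> - reval \<xi> (t n)\<bar> \<le> \<epsilon> n * l1 B \<xi>"
    by metis
  define z where "z n = eval V q (t n)" for n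
  have z [simp]: "z n \<in> carrier V" for n
    by (simp add: z_def t)
  have approx: "\<bar>reval \<xi> (t n) - reval \<xi> (t n')\<bar> \<le> (\<epsilon> n + \<epsilon> n') * l1 B \<xi>" if "\<xi> \<in> cube B" for \<xi> n n'
    using t(2)[OF that, of n] t(2)[OF that, of n'] by (simp add: abs_le_iff algebra_simps)
  have \<epsilon>_mono: "\<epsilon> n \<le> \<epsilon> m" if "m \<le> n" for m n
    using that by (simp add: \<epsilon>_def frac_le)
  have "r_cauchy V u z"
    unfolding r_cauchy_def
  proof (intro allI impI exI)
    fix k n n' :: nat
    assume k: "1 \<le> k" and n: "2 * k \<le> n" "2 * k \<le> n'"
    have "\<epsilon> n + \<epsilon> n' \<le> 2 * \<epsilon> (2 * k)"
      using \<epsilon>_mono[OF n(1)] \<epsilon>_mono[OF n(2)] by simp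
    also have "\<dots> \<le> 1 / real k"
      using k by (simp add: \<epsilon>_def field_simps)
    finally have "(\<epsilon> n + \<epsilon> n') * l1 B \<xi> \<le> 1 / real k * l1 B \<xi>" for \<xi>
      by (intro mult_right_mono l1_nonneg)
    then have "\<bar>reval \<xi> (t n) - reval \<xi> (t n')\<bar> \<le> 1 / real k * \<bar>l1 B \<xi>\<bar>" if "\<xi> \<in> cube B" for \<xi>
      using approx[OF that, of n n'] order_trans l1_nonneg[of B \<xi>] by fastforce
    then have "eval V q (Abs (Add (t n) (Smul (- 1) (t n')))) \<preceq> eval V q (Smul (1 / real k) (Abs (L1 B)))"
      by (intro eval_mono) (auto simp: t(1) vars_L1 reval_L1 finite_B subsetD[OF t(1)])
    moreover have "eval V q (Abs (Add (t n) (Smul (- 1) (t n')))) = rabs V (z n \<ominus> z n')"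
      using q_closed t(1)[of n] t(1)[of n']
      by (subst eval_Abs) (auto simp: a_minus_def uminus_smult z_def)
    moreover have "eval V q (Smul (1 / real k) (Abs (L1 B))) = (1 / real k) \<odot> rabs V u"
      using q_closed by (simp add: eval_Abs vars_L1 finite_B u_def)
    ultimately show "rabs V (z n \<ominus> z n') \<preceq> (1 / real k) \<odot> rabs V u"
      by simp
  qed
  moreover have "range z \<subseteq> carrier V"
    by auto
  ultimately obtain y w where y [simp]: "y \<in> carrier V" and w [simp]: "w \<in> carrier V"
    and conv: "r_converges V z y w"
    using assms(1) u_closed unfolding ucvl_def by meson
  have "calc h y"
    unfolding calc_def
  proof (intro conjI allI impI y)
    fix e :: real
    assume e: "0 < e"
    then obtain k :: nat where k: "1 / e < real k"
      using reals_Archimedean2 by blast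
    have "2 * \<epsilon> (2 * k) \<le> e"
    proof -
      have "0 < real k"
        using k e by (meson less_trans zero_less_divide_1_iff)
      then have "2 * \<epsilon> (2 * k) \<le> 1 / real k"
        by (simp add: \<epsilon>_def field_simps)
      also have "\<dots> \<le> e"
        using k e \<open>0 < real k\<close> by (simp add: field_simps)
      finally show ?thesis .
    qed
    define m where "m = 2 * k"
    have m: "\<epsilon> m + \<epsilon> n \<le> e" if "m \<le> n" for n
      using \<epsilon>_mono[OF that] \<open>2 * \<epsilon> (2 * k) \<le> e\<close> by (simp add: m_def)
    have "0 < \<epsilon> m"
      by (simp add: \<epsilon>_def)
    then have "\<epsilon> m \<le> e"
      using m[of m] by simp
    have diff: "reval \<xi> (t n) \<le> reval \<xi> (t n') + e * l1 B \<xi>"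
      if "\<xi> \<in> cube B" "\<epsilon> n + \<epsilon> n' \<le> e" for \<xi> n n'
      using approx[OF that(1), of n n'] mult_right_mono[OF that(2) l1_nonneg[of B \<xi>]]
      by (simp add: abs_le_iff)
    have near: "z m \<preceq> z n \<oplus> e \<odot> u" "z n \<preceq> z m \<oplus> e \<odot> u" if "m \<le> n" for n
      using m[OF that] unfolding z_def
      by (auto intro!: eval_le_add_u t(1) diff simp: add.commute)
    have lim: "\<exists>n\<ge>m. z n \<preceq> y \<oplus> \<delta> \<odot> rabs V w \<and> y \<preceq> z n \<oplus> \<delta> \<odot> rabs V w" if \<delta>: "0 < \<delta>" for \<delta>
    proof -
      obtain j :: nat where j: "1 / \<delta> < real j"
        using reals_Archimedean2 by blast
      then have "0 < real j"
        using \<delta> by (meson less_trans zero_less_divide_1_iff)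
      then have "1 \<le> j"
        by simp
      then obtain N where N: "\<And>n. N \<le> n \<Longrightarrow> rabs V (z n \<ominus> y) \<preceq> (1 / real j) \<odot> rabs V w"
        using conv unfolding r_converges_def by blast
      have "1 / real j \<le> \<delta>"
        using j \<delta> \<open>0 < real j\<close> by (simp add: field_simps)
      moreover have "\<zero> \<preceq> rabs V w"
      proof -
        interpret W: vlat_tuple V "{()}" "\<lambda>_. w"
          by unfold_locales simp_all
        show ?thesis
          using W.eval_mono[of Zero "Abs (Var ())"] by (simp add: eval_Abs)
      qed
      ultimately have "(1 / real j) \<odot> rabs V w \<preceq> \<delta> \<odot> rabs V w"
        by (intro smult_mono_left) simp_all
      then have "rabs V (z (max m N) \<ominus> y) \<preceq> \<delta> \<odot> rabs V w"
        using N[of "max m N"] by (auto intro: le_trans)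
      then show ?thesis
        by (intro exI[of _ "max m N"] conjI rabs_diff_leD) simp_all
    qed
    have swap: "(a \<oplus> b) \<oplus> c = (a \<oplus> c) \<oplus> b" if "a \<in> carrier V" "b \<in> carrier V" "c \<in> carrier V" for a b c
      using that by (simp add: M.a_ac)
    have "z m \<preceq> y \<oplus> e \<odot> u"
    proof (rule archimedean_le[OF arch, where w = "rabs V w"])
      fix \<delta> :: real
      assume "0 < \<delta>"
      then obtain n where n: "m \<le> n" "z n \<preceq> y \<oplus> \<delta> \<odot> rabs V w"
        using lim by blast
      have "z n \<oplus> e \<odot> u \<preceq> (y \<oplus> \<delta> \<odot> rabs V w) \<oplus> e \<odot> u"
        using n(2) by (intro add_le_cancel_right) simp_all
      with near(1)[OF n(1)] have "z m \<preceq> (y \<oplus> \<delta> \<odot> rabs V w) \<oplus> e \<odot> u"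
        by (rule le_trans) simp_all
      then show "z m \<preceq> y \<oplus> e \<odot> u \<oplus> \<delta> \<odot> rabs V w"
        by (simp add: swap)
    qed simp_all
    moreover have "y \<preceq> z m \<oplus> e \<odot> u"
    proof (rule archimedean_le[OF arch, where w = "rabs V w"])
      fix \<delta> :: real
      assume "0 < \<delta>"
      then obtain n where n: "m \<le> n" "y \<preceq> z n \<oplus> \<delta> \<odot> rabs V w"
        using lim by blast
      have "z n \<oplus> \<delta> \<odot> rabs V w \<preceq> (z m \<oplus> e \<odot> u) \<oplus> \<delta> \<odot> rabs V w"
        using near(2)[OF n(1)] by (intro add_le_cancel_right) simp_all
      with n(2) show "y \<preceq> z m \<oplus> e \<odot> u \<oplus> \<delta> \<odot> rabs V w"
        by (rule le_trans) simp_all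
    qed simp_all
    moreover have "\<bar>h \<xi> - reval \<xi> (t m)\<bar> \<le> e * l1 B \<xi>" if "\<xi> \<in> cube B" for \<xi>
      using t(2)[OF that, of m] mult_right_mono[OF \<open>\<epsilon> m \<le> e\<close> l1_nonneg[of B \<xi>]] by simp
    ultimately show "\<exists>t. near e h y t"
      using t(1) by (intro exI[of _ "t m"]) (simp add: z_def)
  qed
  then show ?thesis ..
qed

text \<open>
  A Riesz homomorphism is monotone and determined on terms by its values at the coordinates, so its
  graph lies in the closure relation. Hence it is determined by those values.
\<close>

lemma calc_riesz_hom:
  assumes T: "riesz_hom (H_cube B m) V T" and q: "\<And>b. b \<in> B \<Longrightarrow> T (coords B b) = q b"
    and h: "h \<in> carrier (H_cube B m)"
  shows "calc h (T h)"
  unfolding calc_def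
proof (intro conjI allI impI)
  let ?H = "H_cube B m"
  let ?x = "coords B"
  show "T h \<in> carrier V"
    using T h by (rule riesz_hom_closed)
  have x_closed: "?x \<in> vars t \<rightarrow> carrier ?H" if "vars t \<subseteq> B" for t
    using that by (auto intro!: coord_closed)
  have T_eval: "T (eval ?H ?x t) = eval V q t" if "vars t \<subseteq> B" for t
    using riesz_hom_eval[OF vector_lattice_H_ext vector_lattice T x_closed[OF that]]
      eval_cong[of t "T \<circ> ?x" q V] that by (auto simp: q subset_iff)
  have mono: "T g \<preceq> T k" if "g \<in> carrier ?H" "k \<in> carrier ?H" "\<And>\<xi>. \<xi> \<in> cube B \<Longrightarrow> g \<xi> \<le> k \<xi>" for g k
    using riesz_hom_mono[OF vector_lattice_H_ext vector_lattice T] that by simp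
  fix \<epsilon> :: real
  assume "0 < \<epsilon>"
  from lterm_approximation[OF finite_B h this] obtain t where
    t: "vars t \<subseteq> B" "\<And>\<xi>. \<xi> \<in> cube B \<Longrightarrow> \<bar>h \<xi> - reval \<xi> t\<bar> \<le> \<epsilon> * l1 B \<xi>"
    by blast
  define g where "g = eval ?H ?x t"
  define k where "k = \<epsilon> \<odot>\<^bsub>?H\<^esub> eval ?H ?x (L1 B)"
  have gk [simp]: "g \<in> carrier ?H" "k \<in> carrier ?H"
    unfolding g_def k_def
    by (intro H_ext.smult_in H_ext.eval_closed x_closed; simp add: t vars_L1 finite_B)+
  have vals: "g \<xi> = reval \<xi> t" "k \<xi> = \<epsilon> * l1 B \<xi>" if "\<xi> \<in> cube B" for \<xi>
    using that by (simp_all add: g_def k_def eval_H_ext t vars_L1 finite_B reval_L1)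
  have hom_add: "T (a \<oplus>\<^bsub>?H\<^esub> k) = T a \<oplus> \<epsilon> \<odot> u" if "a \<in> carrier ?H" for a
  proof -
    have "eval ?H ?x (L1 B) \<in> carrier ?H"
      by (intro H_ext.eval_closed x_closed) (simp add: vars_L1 finite_B)
    then have "T k = \<epsilon> \<odot> u"
      using T by (simp add: k_def riesz_hom_def T_eval vars_L1 finite_B u_def del: H_ext_simps)
    moreover have "T (a \<oplus>\<^bsub>?H\<^esub> k) = T a \<oplus> T k"
      using T that by (simp add: riesz_hom_def del: H_ext_simps)
    ultimately show ?thesis
      by simp
  qed
  have "T g \<preceq> T (h \<oplus>\<^bsub>?H\<^esub> k)"
  proof (rule mono)
    show "h \<oplus>\<^bsub>?H\<^esub> k \<in> carrier ?H"
      using h gk by (intro H_ext.M.add.m_closed)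
    show "g \<xi> \<le> (h \<oplus>\<^bsub>?H\<^esub> k) \<xi>" if "\<xi> \<in> cube B" for \<xi>
      using t(2)[OF that] that by (simp add: vals abs_le_iff)
  qed simp
  moreover have "T h \<preceq> T (g \<oplus>\<^bsub>?H\<^esub> k)"
  proof (rule mono)
    show "g \<oplus>\<^bsub>?H\<^esub> k \<in> carrier ?H"
      using gk by (intro H_ext.M.add.m_closed)
    show "h \<xi> \<le> (g \<oplus>\<^bsub>?H\<^esub> k) \<xi>" if "\<xi> \<in> cube B" for \<xi>
      using t(2)[OF that] that by (simp add: vals abs_le_iff)
  qed (rule h)
  ultimately have "eval V q t \<preceq> T h \<oplus> \<epsilon> \<odot> u" "T h \<preceq> eval V q t \<oplus> \<epsilon> \<odot> u"
    using h gk(1) by (simp_all add: hom_add del: H_ext_simps) (simp_all add: g_def T_eval t)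
  with t show "\<exists>t. near \<epsilon> h (T h) t"
    by blast
qed

lemma riesz_hom_unique:
  assumes "archimedean_vl V"
    and "riesz_hom (H_cube B m) V S" "\<And>b. b \<in> B \<Longrightarrow> S (coords B b) = q b"
    and "riesz_hom (H_cube B m) V T" "\<And>b. b \<in> B \<Longrightarrow> T (coords B b) = q b"
    and "h \<in> carrier (H_cube B m)"
  shows "S h = T h"
  by (rule calc_unique[OF assms(1) calc_riesz_hom[OF assms(2,3,6)] calc_riesz_hom[OF assms(4,5,6)]])

theorem ex1_riesz_hom:
  assumes V: "ucvl V"
  shows "\<exists>!T. T \<in> extensional (carrier (H_cube B m)) \<and> riesz_hom (H_cube B m) V T \<and>
    (\<forall>b\<in>B. q b = T (coords B b))"
proof -
  let ?H = "H_cube B m"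
  have arch: "archimedean_vl V"
    using V by (simp add: ucvl_def)
  define T where "T = (\<lambda>h\<in>carrier ?H. THE y. calc h y)"
  have T_eq: "T h = y" if "h \<in> carrier ?H" "calc h y" for h y
    using that calc_unique[OF arch] by (auto simp: T_def intro: the_equality)
  have calc_T: "calc h (T h)" if "h \<in> carrier ?H" for h
    using calc_total[OF V that] T_eq[OF that] by auto
  have "riesz_hom ?H V T"
  proof (rule riesz_homI[OF vector_lattice_H_ext vector_lattice])
    show "T \<in> carrier ?H \<rightarrow> carrier V"
      using calc_T calc_closed by blast
    fix g h c
    assume gh: "g \<in> carrier ?H" "h \<in> carrier ?H"
    note calc = calc_T[OF gh(1)] calc_T[OF gh(2)]
    show "T (g \<oplus>\<^bsub>?H\<^esub> h) = T g \<oplus> T h"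
    proof (rule T_eq)
      show "calc (g \<oplus>\<^bsub>?H\<^esub> h) (T g \<oplus> T h)"
        using calc_add[OF calc] calc_cong[of "g \<oplus>\<^bsub>?H\<^esub> h" "\<lambda>\<xi>. g \<xi> + h \<xi>"] by simp
    qed (use gh in \<open>rule H_ext.M.add.m_closed\<close>)
    show "T (rjoin ?H g h) = rjoin V (T g) (T h)"
    proof (rule T_eq)
      show "calc (rjoin ?H g h) (rjoin V (T g) (T h))"
        using calc_join[OF calc] calc_cong[of "rjoin ?H g h" "\<lambda>\<xi>. max (g \<xi>) (h \<xi>)"] gh
        by (simp add: rjoin_H_ext)
    qed (use gh in \<open>rule H_ext.join_closed\<close>)
    show "T (c \<odot>\<^bsub>?H\<^esub> g) = c \<odot> T g"
    proof (rule T_eq)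
      show "calc (c \<odot>\<^bsub>?H\<^esub> g) (c \<odot> T g)"
        using calc_smult[OF calc(1)] calc_cong[of "c \<odot>\<^bsub>?H\<^esub> g" "\<lambda>\<xi>. c * g \<xi>"] by simp
    qed (rule H_ext.smult_in[OF gh(1)])
  qed
  moreover have T_q: "T (coords B b) = q b" if "b \<in> B" for b
  proof (rule T_eq)
    show "calc (coords B b) (q b)"
      using calc_eval[of "Var b"] calc_cong[of "coords B b" "\<lambda>\<xi>. \<xi> b"] that
      by (simp add: coord_def)
  qed (rule coord_closed[OF that])
  moreover have "S = T"
    if "S \<in> extensional (carrier ?H)" "riesz_hom ?H V S" "\<And>b. b \<in> B \<Longrightarrow> S (coords B b) = q b" for S
    using that(1) riesz_hom_unique[OF arch that(2,3) \<open>riesz_hom ?H V T\<close> T_q]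
    by (intro extensionalityI[of S "carrier ?H" T]) (auto simp: T_def)
  ultimately show ?thesis
    by (intro ex1I[of _ T]) (auto simp: T_def)
qed

end

section \<open>Banach lattices\<close>

context vlat
begin

lemma rabs_nonneg: "x \<in> carrier V \<Longrightarrow> \<zero> \<preceq> rabs V x"
proof -
  assume [simp]: "x \<in> carrier V"
  interpret X: vlat_tuple V "{()}" "\<lambda>_. x"
    by unfold_locales simp_all
  show ?thesis
    using X.eval_mono[of Zero "Abs (Var ())"] by (simp add: eval_Abs)
qed

lemma rabs_le: "\<lbrakk>x \<preceq> y; \<ominus> x \<preceq> y; x \<in> carrier V; y \<in> carrier V\<rbrakk> \<Longrightarrow> rabs V x \<preceq> y"
  by (simp add: rabs_def join_least)

lemma rabs_of_nonneg:
  assumes "\<zero> \<preceq> x" "x \<in> carrier V"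
  shows "rabs V x = x"
proof -
  have "\<ominus> x \<preceq> \<zero>"
    using uminus_le[OF assms(1)] assms(2) by (simp add: neg_eq_smult)
  then have "\<ominus> x \<preceq> x"
    using assms by (auto intro: le_trans)
  then show ?thesis
    using assms unfolding rabs_def by (intro join_eqI) (simp_all add: le_refl)
qed

lemma rabs_triangle:
  assumes [simp]: "x \<in> carrier V" "y \<in> carrier V"
  shows "rabs V (x \<oplus> y) \<preceq> rabs V x \<oplus> rabs V y"
proof (rule rabs_le)
  show "x \<oplus> y \<preceq> rabs V x \<oplus> rabs V y"
    by (intro add_mono) (simp_all add: rabs_def join_ge1)
  show "\<ominus> (x \<oplus> y) \<preceq> rabs V x \<oplus> rabs V y"
    unfolding M.minus_add[OF assms] by (intro add_mono) (simp_all add: rabs_def join_ge2)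
qed simp_all

end

lemma riesz_hom_rabs:
  assumes "vector_lattice V" "vector_lattice W" "riesz_hom V W T" "x \<in> carrier V"
  shows "T (rabs V x) = rabs W (T x)"
proof -
  interpret V: vlat V by unfold_locales fact
  interpret W: vlat W by unfold_locales fact
  show ?thesis
    using assms(3,4) riesz_hom_closed[OF assms(3,4)]
    by (simp add: rabs_def riesz_hom_def V.neg_eq_smult W.neg_eq_smult)
qed

locale blat = vlat X for X :: "('v, 'm) normed_riesz_scheme" (structure) +
  assumes banach: "banach_lattice X"
begin

notation le (infix "\<preceq>" 50)

lemma norm_nonneg: "x \<in> carrier X \<Longrightarrow> 0 \<le> rnorm X x"
  and norm_eq_0: "x \<in> carrier X \<Longrightarrow> rnorm X x = 0 \<longleftrightarrow> x = \<zero>"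
  and norm_smult: "x \<in> carrier X \<Longrightarrow> rnorm X (c \<odot> x) = \<bar>c\<bar> * rnorm X x"
  and norm_triangle: "\<lbrakk>x \<in> carrier X; y \<in> carrier X\<rbrakk> \<Longrightarrow> rnorm X (x \<oplus> y) \<le> rnorm X x + rnorm X y"
  and norm_mono: "\<lbrakk>rabs X x \<preceq> rabs X y; x \<in> carrier X; y \<in> carrier X\<rbrakk> \<Longrightarrow> rnorm X x \<le> rnorm X y"
  using banach by (simp_all add: banach_lattice_def)

lemma norm_complete:
  assumes "range s \<subseteq> carrier X"
    and "\<And>e. 0 < e \<Longrightarrow> \<exists>m. \<forall>n\<ge>m. \<forall>n'\<ge>m. rnorm X (s n \<ominus> s n') < e"
  obtains x where "x \<in> carrier X" "(\<lambda>n. rnorm X (s n \<ominus> x)) \<longlonglongrightarrow> 0"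
proof -
  have "\<exists>x\<in>carrier X. (\<lambda>n. rnorm X (s n \<ominus> x)) \<longlonglongrightarrow> 0"
    using banach assms unfolding banach_lattice_def by blast
  then show thesis
    using that by blast
qed

lemma norm_le_of_rabs_le:
  assumes "rabs X x \<preceq> y" "x \<in> carrier X" "y \<in> carrier X"
  shows "rnorm X x \<le> rnorm X y"
proof (rule norm_mono)
  have "\<zero> \<preceq> y"
    using rabs_nonneg[OF assms(2)] assms by (auto intro: le_trans)
  then show "rabs X x \<preceq> rabs X y"
    using assms by (simp add: rabs_of_nonneg)
qed (use assms in simp_all)

lemma norm_rabs:
  assumes [simp]: "x \<in> carrier X"
  shows "rnorm X (rabs X x) = rnorm X x"
  by (intro antisym norm_mono) (simp_all add: rabs_of_nonneg rabs_nonneg le_refl)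

lemma archimedean: "archimedean_vl X"
  unfolding archimedean_vl_def
proof (intro ballI impI)
  fix x y
  assume [simp]: "x \<in> carrier X" "y \<in> carrier X"
    and *: "\<zero> \<preceq> x \<and> (\<forall>n. real n \<odot> x \<preceq> y)"
  have bound: "real n * rnorm X x \<le> rnorm X y" for n
  proof -
    have "\<zero> \<preceq> real n \<odot> x"
      using smult_le[of \<zero> x "real n"] * by simp
    then have "rnorm X (real n \<odot> x) \<le> rnorm X y"
      using * by (intro norm_le_of_rabs_le) (simp_all add: rabs_of_nonneg)
    then show ?thesis
      by (simp add: norm_smult)
  qed
  have "rnorm X x = 0"
  proof (rule ccontr)
    assume "rnorm X x \<noteq> 0"
    then have "0 < rnorm X x"
      using norm_nonneg[of x] by simp
    then obtain n where "rnorm X y < real n * rnorm X x"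
      using reals_Archimedean3 by blast
    with bound[of n] show False
      by simp
  qed
  then show "x = \<zero>"
    by (simp add: norm_eq_0)
qed

text \<open>
  A relatively uniform Cauchy sequence is Cauchy in norm. The order estimates with the same regulator
  pass to the norm limit \<open>x\<close>: the excess \<open>p\<close> of \<open>\<bar>s n - x\<bar>\<close> over the bound \<open>v\<close> is dominated by \<open>\<bar>s n' - x\<bar>\<close>
  for all large \<open>n'\<close>, so its norm is zero.
\<close>

lemma ucvl: "ucvl X"
  unfolding ucvl_def
proof (intro conjI vector_lattice archimedean ballI allI impI)
  fix u s
  assume u [simp]: "u \<in> carrier X" and "range s \<subseteq> carrier X \<and> r_cauchy X u s"
  then have range: "range s \<subseteq> carrier X" and cauchy: "r_cauchy X u s"
    by simp_all
  have s [simp]: "s n \<in> carrier X" for n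
    using range by auto
  have "\<exists>m. \<forall>n\<ge>m. \<forall>n'\<ge>m. rnorm X (s n \<ominus> s n') < e" if "0 < e" for e
  proof -
    obtain k :: nat where k: "rnorm X u / e < real k"
      using reals_Archimedean2 by blast
    have "0 \<le> rnorm X u / e"
      using norm_nonneg[OF u] that by simp
    with k have "0 < real k"
      by linarith
    then have "1 \<le> k"
      by simp
    with cauchy obtain m where
      m: "\<forall>n\<ge>m. \<forall>n'\<ge>m. rabs X (s n \<ominus> s n') \<preceq> (1 / real k) \<odot> rabs X u"
      unfolding r_cauchy_def by blast
    have "rnorm X (s n \<ominus> s n') < e" if "m \<le> n" "m \<le> n'" for n n'
    proof -
      have "rnorm X (s n \<ominus> s n') \<le> rnorm X ((1 / real k) \<odot> rabs X u)"
        using m that by (intro norm_le_of_rabs_le) simp_all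
      also have "\<dots> = rnorm X u / real k"
        by (simp add: norm_smult norm_rabs)
      also have "\<dots> < e"
        using k \<open>0 < e\<close> \<open>0 < real k\<close> by (simp add: field_simps)
      finally show ?thesis .
    qed
    then show ?thesis
      by blast
  qed
  then obtain x where x [simp]: "x \<in> carrier X" and lim: "(\<lambda>n. rnorm X (s n \<ominus> x)) \<longlonglongrightarrow> 0"
    using norm_complete[OF range] by blast
  have "r_converges X s x u"
    unfolding r_converges_def
  proof (intro allI impI)
    fix k :: nat
    assume "1 \<le> k"
    define v where "v = (1 / real k) \<odot> rabs X u"
    have v [simp]: "v \<in> carrier X"
      by (simp add: v_def)
    obtain m where m: "\<And>n n'. \<lbrakk>m \<le> n; m \<le> n'\<rbrakk> \<Longrightarrow> rabs X (s n \<ominus> s n') \<preceq> v"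
      using cauchy \<open>1 \<le> k\<close> unfolding r_cauchy_def v_def by meson
    have "rabs X (s n \<ominus> x) \<preceq> v" if n: "m \<le> n" for n
    proof -
      define p where "p = rjoin X (rabs X (s n \<ominus> x) \<ominus> v) \<zero>"
      have p [simp]: "p \<in> carrier X"
        by (simp add: p_def)
      have "rnorm X p \<le> rnorm X (s n' \<ominus> x)" if n': "m \<le> n'" for n'
      proof -
        have "s n \<ominus> x = (s n \<ominus> s n') \<oplus> (s n' \<ominus> x)"
          by (simp add: a_minus_def M.a_assoc M.r_neg1)
        then have "rabs X (s n \<ominus> x) \<preceq> rabs X (s n \<ominus> s n') \<oplus> rabs X (s n' \<ominus> x)"
          using rabs_triangle[of "s n \<ominus> s n'" "s n' \<ominus> x"] by simp
        moreover have "rabs X (s n \<ominus> s n') \<oplus> rabs X (s n' \<ominus> x) \<preceq> v \<oplus> rabs X (s n' \<ominus> x)"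
          using m[OF n n'] by (intro add_le_cancel_right) simp_all
        ultimately have "rabs X (s n \<ominus> x) \<preceq> v \<oplus> rabs X (s n' \<ominus> x)"
          by (rule le_trans) simp_all
        then have "rabs X (s n \<ominus> x) \<ominus> v \<preceq> rabs X (s n' \<ominus> x)"
          by (simp add: diff_le_iff M.a_comm)
        then have "p \<preceq> rabs X (s n' \<ominus> x)"
          unfolding p_def by (intro join_least) (simp_all add: rabs_nonneg)
        moreover have "\<zero> \<preceq> p"
          by (simp add: p_def join_ge2)
        ultimately show ?thesis
          by (intro norm_mono) (simp_all add: rabs_of_nonneg)
      qed
      then have "rnorm X p \<le> 0"
        by (intro LIMSEQ_le_const[OF lim]) blast
      then have "p = \<zero>"
        using norm_nonneg[OF p] norm_eq_0[OF p] by simp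
      then have "rabs X (s n \<ominus> x) \<ominus> v \<preceq> \<zero>"
        using join_ge1[of "rabs X (s n \<ominus> x) \<ominus> v" \<zero>] by (simp add: p_def)
      then show ?thesis
        by (simp add: diff_le_iff)
    qed
    then show "\<exists>m. \<forall>n\<ge>m. rabs X (s n \<ominus> x) \<preceq> (1 / real k) \<odot> rabs X u"
      unfolding v_def by blast
  qed
  then show "\<exists>x\<in>carrier X. \<exists>w\<in>carrier X. r_converges X s x w"
    using x u by blast
qed

end

lemma blatI: "banach_lattice X \<Longrightarrow> blat X"
  by unfold_locales (simp_all add: banach_lattice_def)

section \<open>The free Banach lattice norm\<close>

definition majorants :: "'b set \<Rightarrow> (('b \<Rightarrow> real) \<Rightarrow> real) \<Rightarrow> ('b \<Rightarrow> real) set" where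
  "majorants B h = {c. (\<forall>b\<in>B. 0 \<le> c b) \<and> (\<forall>\<xi>\<in>cube B. \<bar>h \<xi>\<bar> \<le> (\<Sum>b\<in>B. c b * \<bar>\<xi> b\<bar>))}"

text \<open>
  The gauge of the convex solid hull of the coordinate functions. It is the largest lattice norm for
  which these have norm at most \<open>1\<close>, and therefore makes every Riesz homomorphism into a Banach
  lattice as contractive as its values at the coordinates permit.
\<close>

definition fbl_norm :: "'b set \<Rightarrow> (('b \<Rightarrow> real) \<Rightarrow> real) \<Rightarrow> real" where
  "fbl_norm B h = (INF c\<in>majorants B h. sum c B)"

lemma const_in_majorants:
  assumes "0 \<le> K" "\<And>\<xi>. \<xi> \<in> cube B \<Longrightarrow> \<bar>h \<xi>\<bar> \<le> K * l1 B \<xi>"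
  shows "(\<lambda>_. K) \<in> majorants B h"
  using assms by (simp add: majorants_def l1_def sum_distrib_left)

lemma majorants_nonempty:
  assumes B: "finite B" and h: "h \<in> carrier (H_cube B m)"
  shows "majorants B h \<noteq> {}"
proof -
  obtain M where M: "0 < M" "\<And>\<xi>. \<xi> \<in> cube B \<Longrightarrow> \<bar>h \<xi>\<bar> \<le> M"
    by (rule bounded_on_cube[OF H_ext_continuous[OF h]]) (rule that)
  have "(\<lambda>_. M) \<in> majorants B h"
  proof (rule const_in_majorants)
    fix \<xi>
    assume \<xi>: "\<xi> \<in> cube B"
    obtain \<sigma> where \<sigma>: "\<sigma> \<in> cube B" "\<And>b. b \<in> B \<Longrightarrow> \<xi> b = l1 B \<xi> * \<sigma> b"
      by (rule cube_normalise[OF B \<xi>]) (rule that)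
    have "h \<xi> = l1 B \<xi> * h \<sigma>"
      by (rule H_ext_scaled[OF h l1_nonneg \<sigma>(1) \<xi> \<sigma>(2)])
    then have "\<bar>h \<xi>\<bar> = l1 B \<xi> * \<bar>h \<sigma>\<bar>"
      by (simp only: abs_mult abs_of_nonneg[OF l1_nonneg])
    then show "\<bar>h \<xi>\<bar> \<le> M * l1 B \<xi>"
      using mult_left_mono[OF M(2)[OF \<sigma>(1)] l1_nonneg[of B \<xi>]] by (simp add: mult.commute)
  qed (use M in simp)
  then show ?thesis
    by blast
qed

lemma fbl_norm_le:
  assumes "c \<in> majorants B h"
  shows "fbl_norm B h \<le> sum c B"
  unfolding fbl_norm_def
proof (rule cINF_lower[OF _ assms])
  show "bdd_below ((\<lambda>c. sum c B) ` majorants B h)"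
    by (rule bdd_belowI[of _ 0]) (auto simp: majorants_def sum_nonneg)
qed

lemma fbl_norm_greatest:
  assumes "finite B" "h \<in> carrier (H_cube B m)" "\<And>c. c \<in> majorants B h \<Longrightarrow> z \<le> sum c B"
  shows "z \<le> fbl_norm B h"
  unfolding fbl_norm_def using majorants_nonempty[OF assms(1,2)] assms(3) by (rule cINF_greatest)

lemma fbl_norm_nonneg:
  assumes "finite B" "h \<in> carrier (H_cube B m)"
  shows "0 \<le> fbl_norm B h"
  using assms by (rule fbl_norm_greatest) (auto simp: majorants_def sum_nonneg)

lemma abs_le_fbl_norm:
  assumes "finite B" "h \<in> carrier (H_cube B m)" "\<xi> \<in> cube B"
  shows "\<bar>h \<xi>\<bar> \<le> fbl_norm B h"
proof (rule fbl_norm_greatest[OF assms(1,2)])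
  fix c
  assume c: "c \<in> majorants B h"
  then have "\<bar>h \<xi>\<bar> \<le> (\<Sum>b\<in>B. c b * \<bar>\<xi> b\<bar>)"
    using assms(3) by (simp add: majorants_def)
  also have "\<dots> \<le> (\<Sum>b\<in>B. c b * 1)"
    using c assms(3) by (intro sum_mono mult_left_mono) (auto simp: majorants_def abs_le_iff PiE_iff
        minus_le_iff)
  finally show "\<bar>h \<xi>\<bar> \<le> sum c B"
    by simp
qed

text \<open>
  Together with \<open>const_in_majorants\<close> this shows that the norm is equivalent to the supremum norm
  relative to \<open>l1\<close>, so that norm completeness is a case of uniform completeness.
\<close>

lemma abs_le_fbl_norm_l1:
  assumes "finite B" "h \<in> carrier (H_cube B m)" "\<xi> \<in> cube B"
  shows "\<bar>h \<xi>\<bar> \<le> fbl_norm B h * l1 B \<xi>"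
proof -
  have le: "\<bar>h \<xi>\<bar> \<le> sum c B * l1 B \<xi>" if c: "c \<in> majorants B h" for c
  proof -
    have "\<bar>h \<xi>\<bar> \<le> (\<Sum>b\<in>B. c b * \<bar>\<xi> b\<bar>)"
      using assms(3) c by (simp add: majorants_def)
    also have "\<dots> \<le> (\<Sum>b\<in>B. sum c B * \<bar>\<xi> b\<bar>)"
      using c assms(1) by (intro sum_mono mult_right_mono member_le_sum) (auto simp: majorants_def)
    finally show ?thesis
      by (simp add: l1_def sum_distrib_left)
  qed
  show ?thesis
  proof (cases "l1 B \<xi> = 0")
    case True
    then show ?thesis
      using le majorants_nonempty[OF assms(1,2)] by force
  next
    case False
    then have l: "0 < l1 B \<xi>"
      using l1_nonneg[of B \<xi>] by simp
    have "\<bar>h \<xi>\<bar> / l1 B \<xi> \<le> fbl_norm B h"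
      using le l by (intro fbl_norm_greatest[OF assms(1,2)]) (simp add: divide_le_eq)
    then show ?thesis
      using l by (simp add: divide_le_eq)
  qed
qed

definition FBL_Delta :: "'b set \<Rightarrow> (('b \<Rightarrow> real) \<Rightarrow> real) normed_riesz" where
  "FBL_Delta B = H_cube B (normed_riesz.fields (fbl_norm B))"

lemma rnorm_FBL_Delta [simp]: "rnorm (FBL_Delta B) = fbl_norm B"
  by (simp add: FBL_Delta_def H_ext_def normed_riesz.defs)

lemma fbl_norm_smult_le:
  assumes B: "finite B" and h: "h \<in> carrier (H_cube B m)"
  shows "fbl_norm B (\<lambda>\<xi>\<in>cube B. a * h \<xi>) \<le> \<bar>a\<bar> * fbl_norm B h"
proof (cases "a = 0")
  case True
  have "(\<lambda>_. 0) \<in> majorants B (\<lambda>\<xi>\<in>cube B. a * h \<xi>)"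
    using True by (simp add: majorants_def)
  from fbl_norm_le[OF this] True show ?thesis
    by simp
next
  case False
  have "fbl_norm B (\<lambda>\<xi>\<in>cube B. a * h \<xi>) / \<bar>a\<bar> \<le> fbl_norm B h"
  proof (rule fbl_norm_greatest[OF B h])
    fix c
    assume c: "c \<in> majorants B h"
    have "\<bar>a * h \<xi>\<bar> \<le> (\<Sum>b\<in>B. \<bar>a\<bar> * c b * \<bar>\<xi> b\<bar>)" if "\<xi> \<in> cube B" for \<xi>
    proof -
      have "\<bar>a\<bar> * \<bar>h \<xi>\<bar> \<le> \<bar>a\<bar> * (\<Sum>b\<in>B. c b * \<bar>\<xi> b\<bar>)"
        using c that by (intro mult_left_mono) (simp_all add: majorants_def)
      then show ?thesis
        by (simp add: abs_mult sum_distrib_left mult.assoc)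
    qed
    then have "(\<lambda>b. \<bar>a\<bar> * c b) \<in> majorants B (\<lambda>\<xi>\<in>cube B. a * h \<xi>)"
      using c by (auto simp: majorants_def)
    from fbl_norm_le[OF this] show "fbl_norm B (\<lambda>\<xi>\<in>cube B. a * h \<xi>) / \<bar>a\<bar> \<le> sum c B"
      using False by (simp add: divide_le_eq mult.commute flip: sum_distrib_left)
  qed
  then show ?thesis
    using False by (simp add: divide_le_eq mult.commute)
qed

lemma fbl_norm_smult:
  assumes B: "finite B" and h: "h \<in> carrier (H_cube B m)"
  shows "fbl_norm B (\<lambda>\<xi>\<in>cube B. a * h \<xi>) = \<bar>a\<bar> * fbl_norm B h"
proof (rule antisym[OF fbl_norm_smult_le[OF B h]])
  let ?g = "\<lambda>\<xi>\<in>cube B. a * h \<xi>"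
  have g: "?g \<in> carrier (H_cube B m)"
    using H_ext.smult_in[OF h, of a] by simp
  show "\<bar>a\<bar> * fbl_norm B h \<le> fbl_norm B ?g"
  proof (cases "a = 0")
    case True
    then show ?thesis
      using fbl_norm_nonneg[OF B g] by simp
  next
    case False
    have "(\<lambda>\<xi>\<in>cube B. (1 / a) * ?g \<xi>) = h"
      using False g h H_ext.smult_in[OF g, of "1 / a"]
      by (intro H_ext_eqI[of _ B "{-1..1}" m h m]) simp_all
    then have "fbl_norm B h \<le> \<bar>1 / a\<bar> * fbl_norm B ?g"
      using fbl_norm_smult_le[OF B g, of "1 / a"] by simp
    then show ?thesis
      using False by (simp add: field_simps)
  qed
qed

lemma fbl_norm_add:
  assumes B: "finite B" and g: "g \<in> carrier (H_cube B m)" and h: "h \<in> carrier (H_cube B m)"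
  shows "fbl_norm B (\<lambda>\<xi>\<in>cube B. g \<xi> + h \<xi>) \<le> fbl_norm B g + fbl_norm B h"
proof -
  let ?s = "fbl_norm B (\<lambda>\<xi>\<in>cube B. g \<xi> + h \<xi>)"
  have le: "?s \<le> sum c B + sum d B" if c: "c \<in> majorants B g" and d: "d \<in> majorants B h" for c d
  proof -
    have "(\<lambda>b. c b + d b) \<in> majorants B (\<lambda>\<xi>\<in>cube B. g \<xi> + h \<xi>)"
      unfolding majorants_def
    proof (intro CollectI conjI ballI)
      fix \<xi>
      assume \<xi>: "\<xi> \<in> cube B"
      then have "\<bar>g \<xi>\<bar> \<le> (\<Sum>b\<in>B. c b * \<bar>\<xi> b\<bar>)" "\<bar>h \<xi>\<bar> \<le> (\<Sum>b\<in>B. d b * \<bar>\<xi> b\<bar>)"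
        using c d by (simp_all add: majorants_def)
      then have "\<bar>g \<xi> + h \<xi>\<bar> \<le> (\<Sum>b\<in>B. c b * \<bar>\<xi> b\<bar>) + (\<Sum>b\<in>B. d b * \<bar>\<xi> b\<bar>)"
        by linarith
      then show "\<bar>(\<lambda>\<xi>\<in>cube B. g \<xi> + h \<xi>) \<xi>\<bar> \<le> (\<Sum>b\<in>B. (c b + d b) * \<bar>\<xi> b\<bar>)"
        using \<xi> by (simp add: distrib_right sum.distrib)
    qed (use c d in \<open>auto simp: majorants_def\<close>)
    from fbl_norm_le[OF this] show ?thesis
      by (simp add: sum.distrib)
  qed
  have "?s - sum c B \<le> fbl_norm B h" if c: "c \<in> majorants B g" for c
  proof (rule fbl_norm_greatest[OF B h])
    show "?s - sum c B \<le> sum d B" if "d \<in> majorants B h" for d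
      using le[OF c that] by simp
  qed
  then have "?s - fbl_norm B h \<le> fbl_norm B g"
    by (intro fbl_norm_greatest[OF B g]) (simp add: algebra_simps)
  then show ?thesis
    by simp
qed

lemma banach_lattice_FBL_Delta:
  assumes B: "finite B"
  shows "banach_lattice (FBL_Delta B)"
proof -
  define m where "m = normed_riesz.fields (fbl_norm B)"
  let ?H = "H_cube B m"
  have eq: "FBL_Delta B = ?H"
    by (simp add: FBL_Delta_def m_def)
  have norm [simp]: "rnorm ?H = fbl_norm B"
    using rnorm_FBL_Delta[of B] by (simp add: eq)
  have diff_closed: "g \<ominus>\<^bsub>?H\<^esub> h \<in> carrier ?H" if "g \<in> carrier ?H" "h \<in> carrier ?H" for g h
    using that by (rule H_ext.M.minus_closed)
  have definite: "fbl_norm B h = 0 \<longleftrightarrow> h = \<zero>\<^bsub>?H\<^esub>" if h: "h \<in> carrier ?H" for h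
  proof
    assume "fbl_norm B h = 0"
    then show "h = \<zero>\<^bsub>?H\<^esub>"
      using abs_le_fbl_norm[OF B h] h H_ext.M.zero_closed
      by (intro H_ext_eqI[of h B "{-1..1}" m _ m]) auto
  next
    assume "h = \<zero>\<^bsub>?H\<^esub>"
    then have "(\<lambda>_. 0) \<in> majorants B h"
      by (simp add: majorants_def)
    then show "fbl_norm B h = 0"
      using fbl_norm_le[of "\<lambda>_. 0" B h] fbl_norm_nonneg[OF B h] by simp
  qed
  have mono: "fbl_norm B g \<le> fbl_norm B h"
    if g: "g \<in> carrier ?H" and h: "h \<in> carrier ?H" and le: "rle ?H (rabs ?H g) (rabs ?H h)" for g h
  proof (rule fbl_norm_greatest[OF B h])
    have "\<bar>g \<xi>\<bar> \<le> \<bar>h \<xi>\<bar>" if "\<xi> \<in> cube B" for \<xi>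
      using le that by (simp add: rabs_H_ext g h)
    then have "c \<in> majorants B g" if "c \<in> majorants B h" for c
      using that by (simp add: majorants_def) (blast intro: order_trans)
    then show "fbl_norm B g \<le> sum c B" if "c \<in> majorants B h" for c
      using that by (intro fbl_norm_le)
  qed
  have complete: "\<exists>x\<in>carrier ?H. (\<lambda>n. fbl_norm B (s n \<ominus>\<^bsub>?H\<^esub> x)) \<longlonglongrightarrow> 0"
    if s: "range s \<subseteq> carrier ?H"
      and cauchy: "\<forall>e>0. \<exists>m. \<forall>n\<ge>m. \<forall>n'\<ge>m. fbl_norm B (s n \<ominus>\<^bsub>?H\<^esub> s n') < e" for s
  proof -
    have s_in: "s n \<in> carrier ?H" for n
      using s by auto
    define u where "u = eval ?H (coords B) (L1 B)"
    have u: "u \<in> carrier ?H"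
      unfolding u_def by (intro H_ext.eval_closed) (auto simp: vars_L1 B coord_closed)
    have u_val: "u \<xi> = l1 B \<xi>" if "\<xi> \<in> cube B" for \<xi>
      using that by (simp add: u_def eval_H_ext vars_L1 B reval_L1)
    have rle_iff: "rle ?H (rabs ?H g) ((1 / real k) \<odot>\<^bsub>?H\<^esub> rabs ?H u) \<longleftrightarrow>
      (\<forall>\<xi>\<in>cube B. \<bar>g \<xi>\<bar> \<le> 1 / real k * l1 B \<xi>)" if "g \<in> carrier ?H" for g k
      using that u by (simp add: rabs_H_ext u_val l1_nonneg)
    have "r_cauchy ?H u s"
      unfolding r_cauchy_def
    proof (intro allI impI)
      fix k :: nat
      assume k: "1 \<le> k"
      then have "0 < 1 / real k"
        by simp
      with cauchy obtain N where
        "\<forall>n\<ge>N. \<forall>n'\<ge>N. fbl_norm B (s n \<ominus>\<^bsub>?H\<^esub> s n') < 1 / real k"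
        by blast
      then have N: "fbl_norm B (s n \<ominus>\<^bsub>?H\<^esub> s n') < 1 / real k" if "N \<le> n" "N \<le> n'" for n n'
        using that by blast
      have "\<bar>(s n \<ominus>\<^bsub>?H\<^esub> s n') \<xi>\<bar> \<le> 1 / real k * l1 B \<xi>" if "N \<le> n" "N \<le> n'" "\<xi> \<in> cube B" for n n' \<xi>
        using abs_le_fbl_norm_l1[OF B diff_closed[OF s_in s_in] that(3), of n n']
          mult_right_mono[OF less_imp_le[OF N[OF that(1,2)]] l1_nonneg[of B \<xi>]] by linarith
      then show "\<exists>N. \<forall>n\<ge>N. \<forall>n'\<ge>N. rle ?H (rabs ?H (s n \<ominus>\<^bsub>?H\<^esub> s n')) ((1 / real k) \<odot>\<^bsub>?H\<^esub> rabs ?H u)"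
        by (intro exI[of _ N]) (simp add: rle_iff diff_closed s_in del: H_ext_simps)
    qed
    then obtain x where x: "x \<in> carrier ?H" and conv: "r_converges ?H s x u"
      using H_Delta_uniformly_complete[OF u s] by blast
    have "(\<lambda>n. fbl_norm B (s n \<ominus>\<^bsub>?H\<^esub> x)) \<longlonglongrightarrow> 0"
    proof (rule LIMSEQ_I)
      fix e :: real
      assume e: "0 < e"
      obtain k :: nat where k: "real (card B) / e < real k"
        using reals_Archimedean2 by blast
      have "0 \<le> real (card B) / e"
        using e by simp
      with k have "0 < real k"
        by linarith
      then have "1 \<le> k"
        by simp
      then obtain N where N: "\<And>n. N \<le> n \<Longrightarrow> rle ?H (rabs ?H (s n \<ominus>\<^bsub>?H\<^esub> x)) ((1 / real k) \<odot>\<^bsub>?H\<^esub> rabs ?H u)"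
        using conv unfolding r_converges_def by blast
      have "fbl_norm B (s n \<ominus>\<^bsub>?H\<^esub> x) < e" if "N \<le> n" for n
      proof -
        have "(\<lambda>_. 1 / real k) \<in> majorants B (s n \<ominus>\<^bsub>?H\<^esub> x)"
          using N[OF that] by (intro const_in_majorants) (simp_all add: rle_iff diff_closed s_in x del: H_ext_simps)
        from fbl_norm_le[OF this] have "fbl_norm B (s n \<ominus>\<^bsub>?H\<^esub> x) \<le> real (card B) / real k"
          by simp
        also have "\<dots> < e"
          using k e \<open>0 < real k\<close> by (simp add: field_simps)
        finally show ?thesis .
      qed
      then show "\<exists>N. \<forall>n\<ge>N. norm (fbl_norm B (s n \<ominus>\<^bsub>?H\<^esub> x) - 0) < e"
        using fbl_norm_nonneg[OF B diff_closed[OF s_in x]] by (intro exI[of _ N]) simp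
    qed
    with x show ?thesis
      by blast
  qed
  show ?thesis
    unfolding banach_lattice_def eq norm
  proof (intro conjI ballI allI impI)
    show "vector_lattice ?H"
      by (rule vector_lattice_H_ext)
    show "0 \<le> fbl_norm B x" if "x \<in> carrier ?H" for x
      using B that by (rule fbl_norm_nonneg)
    show "fbl_norm B (c \<odot>\<^bsub>?H\<^esub> x) = \<bar>c\<bar> * fbl_norm B x" if "x \<in> carrier ?H" for c x
      using fbl_norm_smult[OF B that] by simp
    show "fbl_norm B (x \<oplus>\<^bsub>?H\<^esub> y) \<le> fbl_norm B x + fbl_norm B y"
      if "x \<in> carrier ?H" "y \<in> carrier ?H" for x y
      using fbl_norm_add[OF B that] by simp
  qed (use definite mono complete in blast)+
qed

lemma fbl_norm_coord:
  assumes B: "finite B" and b: "b \<in> B"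
  shows "fbl_norm B (coords B b) = 1"
proof (rule antisym)
  have "(\<lambda>a. if a = b then 1 else 0) \<in> majorants B (coords B b)"
    using assms by (simp add: majorants_def coord_def if_distrib[of "\<lambda>x. x * _"] cong: if_cong)
  from fbl_norm_le[OF this] show "fbl_norm B (coords B b) \<le> 1"
    using assms by simp
  have "\<bar>coords B b (\<lambda>a\<in>B. 1)\<bar> \<le> fbl_norm B (coords B b)"
    using B coord_closed[OF b] by (rule abs_le_fbl_norm) simp
  then show "1 \<le> fbl_norm B (coords B b)"
    using b by (simp add: coord_def PiE_def)
qed

section \<open>Freeness\<close>

lemma (in blat) norm_triangle_eval_Sum:
  assumes "set bs \<subseteq> A" "q \<in> A \<rightarrow> carrier X"
  shows "rnorm X (eval X q (Sum (\<lambda>b. Smul (c b) (Abs (Var b))) bs)) \<le>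
    (\<Sum>b\<leftarrow>bs. \<bar>c b\<bar> * rnorm X (q b))"
  using assms(1)
proof (induction bs)
  case Nil
  then show ?case
    using norm_eq_0[of "\<zero>\<^bsub>X\<^esub>"] by simp
next
  case (Cons b bs)
  have b: "q b \<in> carrier X"
    using Cons.prems assms(2) by auto
  have rest: "eval X q (Sum (\<lambda>b. Smul (c b) (Abs (Var b))) bs) \<in> carrier X"
    using Cons.prems assms(2) by (intro eval_closed) (auto simp: vars_Sum)
  have "rnorm X (c b \<odot> rabs X (q b)) = \<bar>c b\<bar> * rnorm X (q b)"
    using b by (simp add: norm_smult norm_rabs)
  with norm_triangle[OF _ rest, of "c b \<odot> rabs X (q b)"] Cons b show ?case
    by (simp add: eval_Abs)
qed

text \<open>
  If \<open>\<bar>h\<bar> \<le> (\<Sum>b. c b * \<bar>x b\<bar>)\<close> for the coordinate functions \<open>x b\<close> and \<open>c \<ge> 0\<close>, then \<open>\<bar>T h\<bar> \<le> (\<Sum>b. c b * \<bar>q b\<bar>)\<close>, whence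
  \<open>\<parallel>T h\<parallel> \<le> M * (\<Sum>b. c b)\<close>.
\<close>

lemma riesz_hom_norm_le:
  assumes B: "finite B" and Y: "banach_lattice Y" and q: "q \<in> B \<rightarrow> carrier Y"
    and T: "riesz_hom (H_cube B m) Y T" "\<And>b. b \<in> B \<Longrightarrow> T (coords B b) = q b"
    and M: "0 \<le> M" "\<And>b. b \<in> B \<Longrightarrow> rnorm Y (q b) \<le> M" and h: "h \<in> carrier (H_cube B m)"
  shows "rnorm Y (T h) \<le> M * fbl_norm B h"
proof -
  interpret Y: blat Y
    using Y by (rule blatI)
  let ?H = "H_cube B m"
  let ?x = "coords B"
  have le: "rnorm Y (T h) \<le> M * sum c B" if c: "c \<in> majorants B h" for c
  proof -
    define W where "W = Sum (\<lambda>b. Smul (c b) (Abs (Var b))) (listing B)"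
    have vars_W: "vars W \<subseteq> B"
      using B by (auto simp: W_def vars_Sum listing)
    have reval_W: "reval \<xi> W = (\<Sum>b\<in>B. c b * \<bar>\<xi> b\<bar>)" for \<xi>
      using B by (simp add: W_def reval_Sum listing)
    have x_closed: "?x \<in> vars W \<rightarrow> carrier ?H"
      using vars_W by (auto intro!: coord_closed)
    define g where "g = eval ?H ?x W"
    have g: "g \<in> carrier ?H"
      unfolding g_def using x_closed by (rule H_ext.eval_closed)
    have Tg: "T g = eval Y q W"
      unfolding g_def riesz_hom_eval[OF vector_lattice_H_ext Y.vector_lattice T(1) x_closed]
      using vars_W by (intro eval_cong) (auto simp: T(2))
    have "rle ?H (rabs ?H h) g"
      using c by (simp add: rabs_H_ext h g_def eval_H_ext vars_W reval_W majorants_def)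
    then have "rle Y (T (rabs ?H h)) (T g)"
      using h g by (intro riesz_hom_mono[OF vector_lattice_H_ext Y.vector_lattice T(1)] H_ext.rabs_closed)
    then have "rle Y (rabs Y (T h)) (T g)"
      by (simp only: riesz_hom_rabs[OF vector_lattice_H_ext Y.vector_lattice T(1) h])
    moreover have "T h \<in> carrier Y" "T g \<in> carrier Y"
      by (rule riesz_hom_closed[OF T(1) h], rule riesz_hom_closed[OF T(1) g])
    ultimately have "rnorm Y (T h) \<le> rnorm Y (T g)"
      by (intro Y.norm_le_of_rabs_le)
    also have "\<dots> \<le> (\<Sum>b\<leftarrow>listing B. \<bar>c b\<bar> * rnorm Y (q b))"
      unfolding Tg W_def using listing[OF B] q by (intro Y.norm_triangle_eval_Sum[of _ B]) simp_all
    also have "\<dots> = (\<Sum>b\<in>B. \<bar>c b\<bar> * rnorm Y (q b))"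
      using listing[OF B] by (simp add: sum_list_distinct_conv_sum_set)
    also have "\<dots> \<le> (\<Sum>b\<in>B. c b * M)"
      using c M q by (intro sum_mono mult_mono) (auto simp: majorants_def intro!: Y.norm_nonneg)
    finally show ?thesis
      by (simp add: sum_distrib_left mult.commute)
  qed
  show ?thesis
  proof (cases "M = 0")
    case True
    then show ?thesis
      using le majorants_nonempty[OF B h] by fastforce
  next
    case False
    with M(1) have "0 < M"
      by simp
    then have "rnorm Y (T h) / M \<le> fbl_norm B h"
      using le by (intro fbl_norm_greatest[OF B h]) (simp add: divide_le_eq mult.commute)
    then show ?thesis
      using \<open>0 < M\<close> by (simp add: divide_le_eq mult.commute)
  qed
qed

lemma inj_on_coord: "inj_on (coords B) B"
proof (rule inj_onI)
  fix a b
  assume "a \<in> B" "b \<in> B" "coords B a = coords B b"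
  then have "coords B a (\<lambda>c\<in>B. if c = a then 1 else 0) = coords B b (\<lambda>c\<in>B. if c = a then 1 else 0)"
    by simp
  moreover have "(\<lambda>c\<in>B. if c = a then 1 else 0 :: real) \<in> cube B"
    by auto
  ultimately show "a = b"
    using \<open>a \<in> B\<close> \<open>b \<in> B\<close> by (simp add: coord_def split: if_splits)
qed

lemma H_Delta_eq: "H_Delta B = H_cube B ()"
  by (simp add: H_Delta_def H_lattice_eq_H_ext)

lemma vlat_tupleI:
  assumes "vector_lattice V" "finite B" "q \<in> B \<rightarrow> carrier V"
  shows "vlat_tuple V B q"
  using assms by unfold_locales

theorem is_FUCVL_H_Delta:
  assumes B: "finite B"
  shows "is_FUCVL TYPE('e) B (H_Delta B) (coords B)"
  unfolding is_FUCVL_def H_Delta_eq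
proof (intro conjI allI impI)
  show "ucvl (H_cube B ())"
    by (rule ucvl_H_Delta)
  show "coords B \<in> B \<rightarrow> carrier (H_cube B ())"
    by (auto intro: coord_closed)
  show "inj_on (coords B) B"
    by (rule inj_on_coord)
  fix E :: "'e riesz" and q
  assume *: "ucvl E \<and> q \<in> B \<rightarrow> carrier E \<and> inj_on q B"
  then interpret E: vlat_tuple E B q
    using B by (intro vlat_tupleI) (auto simp: ucvl_def)
  show "\<exists>!T. T \<in> extensional (carrier (H_cube B ())) \<and> riesz_hom (H_cube B ()) E T \<and>
      (\<forall>a\<in>B. q a = T (coords B a))"
    using * by (intro E.ex1_riesz_hom) simp
qed

lemma ex1_eq: "\<lbrakk>\<exists>!x. P x; P x; P y\<rbrakk> \<Longrightarrow> x = y"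
  by blast

text \<open>
  The operator norm is at most the supremum of the norms of the \<open>k b\<close> by \<open>riesz_hom_norm_le\<close>, and
  at least that supremum because the coordinate functions have norm one.
\<close>

theorem is_FBL_FBL_Delta:
  assumes B: "finite B" "B \<noteq> {}"
  shows "is_FBL TYPE('e) B (FBL_Delta B) (coords B)"
  unfolding is_FBL_def
proof (intro conjI allI impI)
  define m where "m = normed_riesz.fields (fbl_norm B)"
  let ?H = "H_cube B m"
  let ?x = "coords B"
  have eq: "FBL_Delta B = ?H"
    by (simp add: FBL_Delta_def m_def)
  have norm: "rnorm ?H = fbl_norm B"
    using rnorm_FBL_Delta[of B] by (simp add: eq)
  show "banach_lattice (FBL_Delta B)"
    using B(1) by (rule banach_lattice_FBL_Delta)
  show "bounded_map_into B (FBL_Delta B) ?x"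
    unfolding bounded_map_into_def
    using B by (auto simp: eq norm fbl_norm_coord intro!: coord_closed exI[of _ 1])
  fix Y :: "'e normed_riesz" and k
  assume *: "banach_lattice Y \<and> bounded_map_into B Y k"
  then have k: "k \<in> B \<rightarrow> carrier Y"
    by (simp add: bounded_map_into_def)
  interpret Y: blat Y
    using * by (intro blatI) simp
  interpret Y: vlat_tuple Y B k
    using B(1) k Y.vector_lattice by (intro vlat_tupleI)
  note ex1 = Y.ex1_riesz_hom[OF Y.ucvl, of m]
  obtain T where T: "T \<in> extensional (carrier ?H)" "riesz_hom ?H Y T" "\<forall>b\<in>B. k b = T (?x b)"
    using ex1_implies_ex[OF ex1] by (elim exE conjE) (rule that)
  define M where "M = Max ((\<lambda>b. rnorm Y (k b)) ` B)"
  have M: "rnorm Y (k b) \<le> M" if "b \<in> B" for b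
    using B that by (simp add: M_def)
  have "M \<in> (\<lambda>b. rnorm Y (k b)) ` B"
    unfolding M_def using B by (intro Max_in) auto
  then obtain b where b: "b \<in> B" "M = rnorm Y (k b)"
    by blast
  then have "0 \<le> M"
    using k by (auto intro: Y.norm_nonneg)
  have "op_norm ?H Y T = (SUP b\<in>B. ereal (rnorm Y (k b)))"
    unfolding op_norm_def norm
  proof (rule antisym; rule SUP_least)
    fix h
    assume "h \<in> {h \<in> carrier ?H. fbl_norm B h \<le> 1}"
    then have h: "h \<in> carrier ?H" "fbl_norm B h \<le> 1"
      by simp_all
    have "rnorm Y (T h) \<le> M * fbl_norm B h"
      by (rule riesz_hom_norm_le[OF B(1) Y.banach k T(2) T(3)[rule_format, symmetric] \<open>0 \<le> M\<close> M h(1)])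
    also have "\<dots> \<le> M"
      using h(2) \<open>0 \<le> M\<close> by (simp add: mult_left_le)
    finally have "ereal (rnorm Y (T h)) \<le> ereal (rnorm Y (k b))"
      by (simp add: b(2))
    also have "\<dots> \<le> (SUP b\<in>B. ereal (rnorm Y (k b)))"
      using b(1) by (rule SUP_upper)
    finally show "ereal (rnorm Y (T h)) \<le> (SUP b\<in>B. ereal (rnorm Y (k b)))" .
  next
    fix b
    assume b: "b \<in> B"
    then have "?x b \<in> {h \<in> carrier ?H. fbl_norm B h \<le> 1}"
      using B by (simp add: coord_closed fbl_norm_coord)
    then have "ereal (rnorm Y (T (?x b))) \<le> (SUP h\<in>{h \<in> carrier ?H. fbl_norm B h \<le> 1}. ereal (rnorm Y (T h)))"
      by (rule SUP_upper)
    then show "ereal (rnorm Y (k b)) \<le> (SUP h\<in>{h \<in> carrier ?H. fbl_norm B h \<le> 1}. ereal (rnorm Y (T h)))"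
      using T(3) b by simp
  qed
  with T ex1 show "\<exists>!T. T \<in> extensional (carrier (FBL_Delta B)) \<and> riesz_hom (FBL_Delta B) Y T \<and>
      (\<forall>a\<in>B. k a = T (?x a)) \<and> op_norm (FBL_Delta B) Y T = (SUP a\<in>B. ereal (rnorm Y (k a)))"
    unfolding eq by (intro ex1I[of _ T]) (simp, rule ex1_eq[OF ex1], simp_all)
qed

section \<open>Uniqueness of the free objects\<close>

lemma riesz_hom_restrict_iff:
  assumes "vector_lattice V"
  shows "riesz_hom V W (restrict T (carrier V)) \<longleftrightarrow> riesz_hom V W T"
  using riesz_hom_cong[OF assms, of W T "restrict T (carrier V)"]
    riesz_hom_cong[OF assms, of W "restrict T (carrier V)" T] by auto

lemma riesz_hom_id: "riesz_hom V V (\<lambda>x. x)"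
  by (simp add: riesz_hom_def)

text \<open>
  The usual argument for universal objects: the two induced homomorphisms are mutually inverse. The
  two hypotheses are the instances of freeness with test objects \<open>H_Delta B\<close> and \<open>F\<close> itself.
\<close>

lemma riesz_isomorphic_H_Delta_of_FUCVL:
  fixes F :: "'f riesz" and f :: "'b \<Rightarrow> 'f"
  assumes B: "finite B"
    and F: "is_FUCVL TYPE('f) B F f" "is_FUCVL TYPE(('b \<Rightarrow> real) \<Rightarrow> real) B F f"
  shows "riesz_isomorphic F (H_Delta B)"
proof -
  let ?H = "H_Delta B"
  let ?x = "coords B"
  have ucvl: "ucvl F" "ucvl ?H" and f: "f \<in> B \<rightarrow> carrier F" "inj_on f B"
    using F(1) ucvl_H_Delta by (simp_all add: is_FUCVL_def H_Delta_eq)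
  have x: "?x \<in> B \<rightarrow> carrier ?H"
    by (auto simp: H_Delta_eq intro: coord_closed)
  have vl: "vector_lattice F" "vector_lattice ?H" and arch: "archimedean_vl ?H"
    using ucvl by (simp_all add: ucvl_def)
  have "\<exists>!T. T \<in> extensional (carrier F) \<and> riesz_hom F ?H T \<and> (\<forall>b\<in>B. ?x b = T (f b))"
    using F(2) ucvl x inj_on_coord unfolding is_FUCVL_def by blast
  then obtain T where T: "riesz_hom F ?H T" "\<And>b. b \<in> B \<Longrightarrow> T (f b) = ?x b"
    by metis
  have "\<exists>!S. S \<in> extensional (carrier ?H) \<and> riesz_hom ?H F S \<and> (\<forall>b\<in>B. f b = S (?x b))"
    using is_FUCVL_H_Delta[OF B, where 'e = 'f] ucvl f unfolding is_FUCVL_def by blast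
  then obtain S where S: "riesz_hom ?H F S" "\<And>b. b \<in> B \<Longrightarrow> S (?x b) = f b"
    by metis
  have "\<exists>!R. R \<in> extensional (carrier F) \<and> riesz_hom F F R \<and> (\<forall>b\<in>B. f b = R (f b))"
    using F(1) ucvl f unfolding is_FUCVL_def by blast
  moreover have "riesz_hom F F (restrict (S \<circ> T) (carrier F))"
    using riesz_hom_comp[OF T(1) S(1)] by (simp add: riesz_hom_restrict_iff[OF vl(1)] del: o_apply)
  moreover have "riesz_hom F F (restrict (\<lambda>x. x) (carrier F))"
    using riesz_hom_id by (simp only: riesz_hom_restrict_iff[OF vl(1)])
  moreover have "f b = restrict (S \<circ> T) (carrier F) (f b)" "f b = restrict (\<lambda>x. x) (carrier F) (f b)"
    if "b \<in> B" for b
    using that f(1) T(2) S(2) by (simp_all add: Pi_iff)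
  ultimately have "restrict (S \<circ> T) (carrier F) = restrict (\<lambda>x. x) (carrier F)"
    by (intro ex1_eq[of "\<lambda>R. R \<in> extensional (carrier F) \<and> riesz_hom F F R \<and> (\<forall>b\<in>B. f b = R (f b))"]
        conjI ballI restrict_extensional)
  then have ST: "S (T x) = x" if "x \<in> carrier F" for x
    using that by (auto dest: fun_cong[of _ _ x])
  interpret H: vlat_tuple ?H B ?x
    using B vl(2) x by (intro vlat_tupleI)
  have TS: "T (S h) = h" if "h \<in> carrier ?H" for h
    using H.riesz_hom_unique[OF arch, of "()" "T \<circ> S" "\<lambda>x. x" h] riesz_hom_comp[OF S(1) T(1)] riesz_hom_id[of ?H] that
    by (simp add: S(2) T(2) flip: H_Delta_eq)
  show ?thesis
    by (rule riesz_isomorphicI[where T = T and S = S]) (rule T(1), rule S(1), erule ST, erule TS)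
qed

lemma rnorm_update_simps [simp]:
  fixes X :: "'v normed_riesz"
  shows "rjoin (X\<lparr>rnorm := r\<rparr>) = rjoin X" "rmeet (X\<lparr>rnorm := r\<rparr>) = rmeet X"
    "a_inv (X\<lparr>rnorm := r\<rparr>) = a_inv X" "a_minus (X\<lparr>rnorm := r\<rparr>) = a_minus X"
    "rabs (X\<lparr>rnorm := r\<rparr>) = rabs X"
    "riesz_hom V (X\<lparr>rnorm := r\<rparr>) T \<longleftrightarrow> riesz_hom V X T"
    "vector_lattice (X\<lparr>rnorm := r\<rparr>) \<longleftrightarrow> vector_lattice X"
proof -
  show join: "rjoin (X\<lparr>rnorm := r\<rparr>) = rjoin X" and meet: "rmeet (X\<lparr>rnorm := r\<rparr>) = rmeet X"
    by (simp_all add: rjoin_def rmeet_def riesz_order_def fun_eq_iff)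
  show inv: "a_inv (X\<lparr>rnorm := r\<rparr>) = a_inv X"
    by (simp add: a_inv_def)
  then show "a_minus (X\<lparr>rnorm := r\<rparr>) = a_minus X"
    by (simp add: a_minus_def fun_eq_iff)
  show "rabs (X\<lparr>rnorm := r\<rparr>) = rabs X"
    by (simp add: rabs_def join inv fun_eq_iff)
  show "riesz_hom V (X\<lparr>rnorm := r\<rparr>) T \<longleftrightarrow> riesz_hom V X T"
    by (simp add: riesz_hom_def join meet)
  show "vector_lattice (X\<lparr>rnorm := r\<rparr>) \<longleftrightarrow> vector_lattice X"
    by (simp add: vector_lattice_def riesz_order_def Module.module_def module_axioms_def
        abelian_group_def abelian_monoid_def abelian_group_axioms_def)
qed

text \<open>
  The axioms of a Banach lattice for the norm \<open>max \<parallel>x\<parallel> (C * \<parallel>T x\<parallel>)\<close>. They are listed separately so that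
  they fit the record in which only the norm of \<open>X\<close> is replaced.
\<close>

lemma (in blat) banach_lattice_sup_norm:
  fixes W :: "('w, 'n) normed_riesz_scheme"
  assumes W: "banach_lattice W" and T: "riesz_hom X W T"
    and contr: "\<And>x. x \<in> carrier X \<Longrightarrow> rnorm W (T x) \<le> rnorm X x" and C: "0 \<le> C"
  defines "N \<equiv> \<lambda>x. max (rnorm X x) (C * rnorm W (T x))"
  shows "vector_lattice X"
    and "\<And>x. x \<in> carrier X \<Longrightarrow> 0 \<le> N x \<and> (N x = 0 \<longleftrightarrow> x = \<zero>)"
    and "\<And>c x. x \<in> carrier X \<Longrightarrow> N (c \<odot> x) = \<bar>c\<bar> * N x"
    and "\<And>x y. \<lbrakk>x \<in> carrier X; y \<in> carrier X\<rbrakk> \<Longrightarrow> N (x \<oplus> y) \<le> N x + N y"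
    and "\<And>x y. \<lbrakk>x \<in> carrier X; y \<in> carrier X; rabs X x \<preceq> rabs X y\<rbrakk> \<Longrightarrow> N x \<le> N y"
    and "\<And>s. \<lbrakk>range s \<subseteq> carrier X; \<forall>e>0. \<exists>m. \<forall>n\<ge>m. \<forall>n'\<ge>m. N (s n \<ominus> s n') < e\<rbrakk> \<Longrightarrow>
      \<exists>x\<in>carrier X. (\<lambda>n. N (s n \<ominus> x)) \<longlonglongrightarrow> 0"
proof -
  interpret W: blat W
    using W by (rule blatI)
  have T_in: "T x \<in> carrier W" if "x \<in> carrier X" for x
    using T that by (rule riesz_hom_closed)
  show "vector_lattice X"
    by (rule vector_lattice)
  show pos: "0 \<le> N x \<and> (N x = 0 \<longleftrightarrow> x = \<zero>)" if x: "x \<in> carrier X" for x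
  proof -
    have "N x = 0 \<longleftrightarrow> rnorm X x = 0"
      using norm_nonneg[OF x] W.norm_nonneg[OF T_in[OF x]] contr[OF x] C
      by (auto simp: N_def max_def mult_le_0_iff split: if_splits)
    then show ?thesis
      using norm_nonneg[OF x] norm_eq_0[OF x] by (simp add: N_def le_max_iff_disj)
  qed
  show "N (c \<odot> x) = \<bar>c\<bar> * N x" if "x \<in> carrier X" for c x
  proof -
    have "T (c \<odot> x) = c \<odot>\<^bsub>W\<^esub> T x"
      using T that by (simp add: riesz_hom_def)
    then show ?thesis
      using that T_in[OF that]
      by (simp add: N_def norm_smult W.norm_smult max_mult_distrib_left mult.left_commute)
  qed
  show "N (x \<oplus> y) \<le> N x + N y" if xy: "x \<in> carrier X" "y \<in> carrier X" for x y
  proof -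
    have "T (x \<oplus> y) = T x \<oplus>\<^bsub>W\<^esub> T y"
      using T xy by (simp add: riesz_hom_def)
    then have "C * rnorm W (T (x \<oplus> y)) \<le> C * (rnorm W (T x) + rnorm W (T y))"
      using W.norm_triangle[OF T_in[OF xy(1)] T_in[OF xy(2)]] C by (intro mult_left_mono) simp_all
    then show ?thesis
      using norm_triangle[OF xy] by (auto simp: N_def distrib_left max_def)
  qed
  show "N x \<le> N y" if xy: "x \<in> carrier X" "y \<in> carrier X" "rabs X x \<preceq> rabs X y" for x y
  proof -
    have "rle W (T (rabs X x)) (T (rabs X y))"
      using xy by (intro riesz_hom_mono[OF vector_lattice W.vector_lattice T]) simp_all
    then have "rnorm W (T x) \<le> rnorm W (T y)"
      using xy T_in by (intro W.norm_mono) (simp_all add: riesz_hom_rabs[OF vector_lattice W.vector_lattice T])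
    then have "C * rnorm W (T x) \<le> C * rnorm W (T y)"
      using C by (rule mult_left_mono)
    then show ?thesis
      using norm_mono[OF xy(3,1,2)] by (auto simp: N_def max_def)
  qed
  show "\<exists>x\<in>carrier X. (\<lambda>n. N (s n \<ominus> x)) \<longlonglongrightarrow> 0"
    if s: "range s \<subseteq> carrier X" and cauchy: "\<forall>e>0. \<exists>m. \<forall>n\<ge>m. \<forall>n'\<ge>m. N (s n \<ominus> s n') < e" for s
  proof -
    have s_in: "s n \<in> carrier X" for n
      using s by auto
    have "\<exists>m. \<forall>n\<ge>m. \<forall>n'\<ge>m. rnorm X (s n \<ominus> s n') < e" if "0 < e" for e
      using cauchy that by (simp add: N_def) blast
    then obtain x where x: "x \<in> carrier X" "(\<lambda>n. rnorm X (s n \<ominus> x)) \<longlonglongrightarrow> 0"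
      using norm_complete[OF s] by blast
    have bound: "N (s n \<ominus> x) \<le> (1 + C) * rnorm X (s n \<ominus> x)" for n
    proof -
      have y: "s n \<ominus> x \<in> carrier X"
        using s_in x by simp
      have "C * rnorm W (T (s n \<ominus> x)) \<le> C * rnorm X (s n \<ominus> x)"
        using contr[OF y] C by (rule mult_left_mono)
      then show ?thesis
        using norm_nonneg[OF y] mult_nonneg_nonneg[OF C norm_nonneg[OF y]]
        by (simp add: N_def distrib_right)
    qed
    have "(\<lambda>n. (1 + C) * rnorm X (s n \<ominus> x)) \<longlonglongrightarrow> (1 + C) * 0"
      using x(2) by (intro tendsto_intros)
    then have upper: "(\<lambda>n. (1 + C) * rnorm X (s n \<ominus> x)) \<longlonglongrightarrow> 0"
      by simp
    have "(\<lambda>n. N (s n \<ominus> x)) \<longlonglongrightarrow> 0"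
    proof (rule tendsto_sandwich[OF _ _ tendsto_const upper])
      show "\<forall>\<^sub>F n in sequentially. 0 \<le> N (s n \<ominus> x)"
        using pos s_in x(1) by simp
      show "\<forall>\<^sub>F n in sequentially. N (s n \<ominus> x) \<le> (1 + C) * rnorm X (s n \<ominus> x)"
        using bound by simp
    qed
    with x(1) show ?thesis
      by blast
  qed
qed

text \<open>
  Let \<open>T\<close> and \<open>S\<close> be the homomorphisms between \<open>X\<close> and the concrete free Banach lattice that
  exchange the generators. \<open>T \<circ> S\<close> is the identity because homomorphisms out of the concrete lattice
  are determined by their values at the generators. For \<open>S \<circ> T\<close> the uniqueness part of
  the universal property of \<open>X\<close> only compares homomorphisms of one prescribed norm, which for the test
  map \<open>i\<close> into \<open>X\<close> is the supremum \<open>s\<close> of the \<open>\<parallel>i b\<parallel>\<close>, while the identity has norm one and \<open>s = 1\<close> is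
  not known. The remedy is to test \<open>i\<close> against \<open>X\<close> renormed by \<open>max \<parallel>x\<parallel> (C * \<parallel>T x\<parallel>)\<close> with
  \<open>C \<ge> max 1 s\<close>. Then \<open>i\<close> has supremum \<open>C\<close>, and since \<open>T\<close> has norm one, the identity and \<open>S \<circ> T\<close> both
  have operator norm exactly \<open>C\<close>, so they coincide.
\<close>

lemma riesz_isomorphic_of_FBL:
  fixes X :: "'x normed_riesz" and i :: "'b \<Rightarrow> 'x"
  assumes B: "finite B" "B \<noteq> {}"
    and X: "is_FBL TYPE('x) B X i" "is_FBL TYPE(('b \<Rightarrow> real) \<Rightarrow> real) B X i"
  shows "riesz_isomorphic (FBL_Delta B) X"
proof -
  define m where "m = normed_riesz.fields (fbl_norm B)"
  let ?H = "H_cube B m"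
  let ?x = "coords B"
  have eq: "FBL_Delta B = ?H"
    by (simp add: FBL_Delta_def m_def)
  have norm: "rnorm ?H = fbl_norm B"
    using rnorm_FBL_Delta[of B] by (simp add: eq)
  have H: "banach_lattice ?H" "bounded_map_into B ?H ?x"
    using is_FBL_FBL_Delta[OF B, where 'e = 'x] by (simp_all add: is_FBL_def eq)
  have i: "i \<in> B \<rightarrow> carrier X"
    using X(1) by (simp add: is_FBL_def bounded_map_into_def)
  interpret X: blat X
    using X(1) by (intro blatI) (simp add: is_FBL_def)
  interpret H: blat ?H
    using H(1) by (rule blatI)
  interpret X: vlat_tuple X B i
    using B(1) i X.vector_lattice by (intro vlat_tupleI)
  interpret H: vlat_tuple ?H B ?x
    using B(1) vector_lattice_H_ext by (intro vlat_tupleI) (auto intro: coord_closed)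
  have "\<exists>!T. T \<in> extensional (carrier X) \<and> riesz_hom X ?H T \<and> (\<forall>b\<in>B. ?x b = T (i b)) \<and>
      op_norm X ?H T = (SUP b\<in>B. ereal (rnorm ?H (?x b)))"
    using X(2) H unfolding is_FBL_def by blast
  then obtain T where T: "riesz_hom X ?H T" "\<And>b. b \<in> B \<Longrightarrow> T (i b) = ?x b"
    and "op_norm X ?H T = (SUP b\<in>B. ereal (rnorm ?H (?x b)))"
    by metis
  then have op_T: "op_norm X ?H T = 1"
    using B by (simp add: norm fbl_norm_coord one_ereal_def)
  have T_in: "T x \<in> carrier ?H" if "x \<in> carrier X" for x
    using T(1) that by (rule riesz_hom_closed)
  \<comment> \<open>The operator norm only looks at the unit ball, so other vectors are rescaled into it.\<close>
  have contr: "fbl_norm B (T x) \<le> rnorm X x" if x: "x \<in> carrier X" for x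
  proof (cases "rnorm X x = 0")
    case True
    then have "x = 0 \<odot>\<^bsub>X\<^esub> x"
      using x by (simp add: X.norm_eq_0)
    then have "T x = 0 \<odot>\<^bsub>?H\<^esub> T x"
      using T(1) x unfolding riesz_hom_def by metis
    then have "T x = \<zero>\<^bsub>?H\<^esub>"
      using T_in[OF x] by (simp only: H_ext.zero_smult)
    then show ?thesis
      using True T_in[OF x] H.norm_eq_0[of "T x"] by (simp add: norm)
  next
    case False
    define r where "r = rnorm X x"
    have r: "0 < r"
      using False X.norm_nonneg[OF x] by (simp add: r_def)
    then have "(1 / r) \<odot>\<^bsub>X\<^esub> x \<in> {x \<in> carrier X. rnorm X x \<le> 1}"
      using x by (simp add: X.norm_smult flip: r_def)
    then have "ereal (fbl_norm B (T ((1 / r) \<odot>\<^bsub>X\<^esub> x))) \<le> op_norm X ?H T"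
      unfolding op_norm_def norm by (rule SUP_upper)
    moreover have "T ((1 / r) \<odot>\<^bsub>X\<^esub> x) = (1 / r) \<odot>\<^bsub>?H\<^esub> T x"
      using T(1) x unfolding riesz_hom_def by blast
    ultimately have "(1 / r) * fbl_norm B (T x) \<le> 1"
      using H.norm_smult[OF T_in[OF x], of "1 / r"] r by (simp add: op_T norm one_ereal_def del: H_ext_simps)
    then show ?thesis
      using r by (simp add: divide_le_eq flip: r_def)
  qed
  obtain S where S: "riesz_hom ?H X S" "\<forall>b\<in>B. i b = S (?x b)"
    using ex1_implies_ex[OF X.ex1_riesz_hom[OF X.ucvl, of m]] by (elim exE conjE) (rule that)
  have TS: "T (S h) = h" if "h \<in> carrier ?H" for h
    using H.riesz_hom_unique[OF H.archimedean, of m "T \<circ> S" "\<lambda>x. x" h]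
      riesz_hom_comp[OF S(1) T(1)] riesz_hom_id[of ?H] that S(2) T(2) by simp
  define C where "C = Max (insert 1 ((\<lambda>b. rnorm X (i b)) ` B))"
  have C1: "1 \<le> C"
    using B by (simp add: C_def)
  have Ci: "rnorm X (i b) \<le> C" if "b \<in> B" for b
    unfolding C_def using B that by (intro Max_ge) auto
  have S_bound: "rnorm X (S h) \<le> C * fbl_norm B h" if "h \<in> carrier ?H" for h
    by (rule riesz_hom_norm_le[OF B(1) X.banach i S(1) _ _ Ci that]) (use S(2) C1 in simp_all)
  define Y where "Y = X\<lparr>rnorm := \<lambda>x. max (rnorm X x) (C * fbl_norm B (T x))\<rparr>"
  have Y_simps: "carrier Y = carrier X" "rnorm Y = (\<lambda>x. max (rnorm X x) (C * fbl_norm B (T x)))"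
    by (simp_all add: Y_def)
  have Y: "banach_lattice Y"
    using X.banach_lattice_sup_norm[OF H(1) T(1), of C] contr C1
    unfolding banach_lattice_def Y_def norm by simp
  have hom_Y: "riesz_hom X Y R \<longleftrightarrow> riesz_hom X X R" for R
    by (simp add: Y_def)
  have op_R: "op_norm X Y R = ereal C"
    if R: "\<And>x. x \<in> carrier X \<Longrightarrow> C * fbl_norm B (T x) \<le> rnorm Y (R x) \<and> rnorm Y (R x) \<le> C * rnorm X x" for R
  proof (rule antisym)
    show "op_norm X Y R \<le> ereal C"
      unfolding op_norm_def
    proof (rule SUP_least)
      fix x
      assume "x \<in> {x \<in> carrier X. rnorm X x \<le> 1}"
      then have "rnorm Y (R x) \<le> C * rnorm X x" "C * rnorm X x \<le> C * 1"
        using R C1 by (auto intro!: mult_left_mono)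
      then show "ereal (rnorm Y (R x)) \<le> ereal C"
        by simp
    qed
    show "ereal C \<le> op_norm X Y R"
    proof (rule ereal_le_epsilon2)
      fix e :: real
      assume e: "0 < e"
      have "1 - e / C < 1"
        using e C1 by simp
      then have "ereal (1 - e / C) < op_norm X ?H T"
        by (simp add: op_T one_ereal_def)
      then obtain x where x: "x \<in> carrier X" "rnorm X x \<le> 1" "1 - e / C < fbl_norm B (T x)"
        unfolding op_norm_def norm less_SUP_iff by auto
      have "C * (1 - e / C) \<le> C * fbl_norm B (T x)"
        using x(3) C1 by (intro mult_left_mono) simp_all
      then have "C \<le> rnorm Y (R x) + e"
        using R[OF x(1)] C1 by (simp add: right_diff_distrib)
      then have "ereal C \<le> ereal (rnorm Y (R x)) + ereal e"
        by simp
      also have "ereal (rnorm Y (R x)) \<le> op_norm X Y R"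
        unfolding op_norm_def using x by (intro SUP_upper) simp
      finally show "ereal C \<le> op_norm X Y R + ereal e"
        by (simp add: add_right_mono)
    qed
  qed
  have Y_i: "rnorm Y (i b) = C" if "b \<in> B" for b
    using Ci[OF that] that B by (simp add: Y_simps T(2) fbl_norm_coord)
  then have norm_i: "(SUP b\<in>B. ereal (rnorm Y (i b))) = ereal C"
    using B by simp
  have "\<exists>!R. R \<in> extensional (carrier X) \<and> riesz_hom X Y R \<and> (\<forall>b\<in>B. i b = R (i b)) \<and>
      op_norm X Y R = (SUP b\<in>B. ereal (rnorm Y (i b)))"
  proof -
    have "bounded_map_into B Y i"
      using i Y_i by (auto simp: bounded_map_into_def Y_simps(1) intro!: exI[of _ C])
    with Y X(1) show ?thesis
      unfolding is_FBL_def by blast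
  qed
  moreover have "riesz_hom X Y (restrict (S \<circ> T) (carrier X))"
    using riesz_hom_comp[OF T(1) S(1)] by (simp add: hom_Y riesz_hom_restrict_iff[OF X.vector_lattice] del: o_apply)
  moreover have "riesz_hom X Y (restrict (\<lambda>x. x) (carrier X))"
    using riesz_hom_id by (simp only: hom_Y riesz_hom_restrict_iff[OF X.vector_lattice])
  moreover have "op_norm X Y (restrict (S \<circ> T) (carrier X)) = ereal C"
  proof (rule op_R)
    fix x
    assume x: "x \<in> carrier X"
    have "rnorm X (S (T x)) \<le> C * fbl_norm B (T x)"
      by (rule S_bound[OF T_in[OF x]])
    moreover have "C * fbl_norm B (T x) \<le> C * rnorm X x"
      using contr[OF x] C1 by (intro mult_left_mono) simp_all
    ultimately show "C * fbl_norm B (T x) \<le> rnorm Y (restrict (S \<circ> T) (carrier X) x) \<and>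
        rnorm Y (restrict (S \<circ> T) (carrier X) x) \<le> C * rnorm X x"
      using x TS[OF T_in[OF x]] by (simp add: Y_simps)
  qed
  moreover have "op_norm X Y (restrict (\<lambda>x. x) (carrier X)) = ereal C"
  proof (rule op_R)
    fix x
    assume x: "x \<in> carrier X"
    have "C * fbl_norm B (T x) \<le> C * rnorm X x"
      using contr[OF x] C1 by (intro mult_left_mono) simp_all
    moreover have "1 * rnorm X x \<le> C * rnorm X x"
      using X.norm_nonneg[OF x] C1 by (intro mult_right_mono)
    ultimately show "C * fbl_norm B (T x) \<le> rnorm Y (restrict (\<lambda>x. x) (carrier X) x) \<and>
        rnorm Y (restrict (\<lambda>x. x) (carrier X) x) \<le> C * rnorm X x"
      using x by (simp add: Y_simps)
  qed
  moreover have "i b = restrict (S \<circ> T) (carrier X) (i b)" "i b = restrict (\<lambda>x. x) (carrier X) (i b)"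
    if "b \<in> B" for b
    using that i T(2) S(2) by (simp_all add: Pi_iff)
  ultimately have "restrict (S \<circ> T) (carrier X) = restrict (\<lambda>x. x) (carrier X)"
    by (intro ex1_eq[of "\<lambda>R. R \<in> extensional (carrier X) \<and> riesz_hom X Y R \<and> (\<forall>b\<in>B. i b = R (i b)) \<and>
        op_norm X Y R = (SUP b\<in>B. ereal (rnorm Y (i b)))"] conjI ballI restrict_extensional)
      (simp_all only: norm_i)
  then have ST: "S (T x) = x" if "x \<in> carrier X" for x
    using that by (auto dest: fun_cong[of _ _ x])
  show ?thesis
    unfolding eq by (rule riesz_isomorphicI[where T = S and S = T]) (rule S(1), rule T(1), erule TS, erule ST)
qed

lemma riesz_isomorphic_H_ext: "riesz_isomorphic (H_ext A I m) (H_ext A I m')"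
proof -
  have carrier: "carrier (H_ext A I m) = carrier (H_ext A I m')"
    by (simp add: in_H_ext_iff set_eq_iff)
  have "riesz_hom (H_ext A I m) (H_ext A I m') (\<lambda>h. h)"
    by (rule riesz_homI[OF vector_lattice_H_ext vector_lattice_H_ext])
      (simp_all add: rjoin_H_ext carrier)
  then show ?thesis
    unfolding riesz_isomorphic_def carrier[symmetric]
    by (intro exI[of _ "\<lambda>h. h"]) (simp add: bij_betw_def carrier)
qed

section \<open>Extension from the cube to the whole space\<close>

text \<open>
  A homogeneous function prescribes the value \<open>c * h (\<xi> / c)\<close> at an arbitrary point \<open>\<xi>\<close>,
  whatever the factor \<open>c\<close> that brings \<open>\<xi>\<close> into the domain.
\<close>

lemma homogeneous_rescale:
  assumes h: "h \<in> carrier (H_ext B I m)" and c: "0 < c" "(\<lambda>b\<in>B. \<xi> b / c) \<in> B \<rightarrow>\<^sub>E I"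
    and d: "0 < d" "(\<lambda>b\<in>B. \<xi> b / d) \<in> B \<rightarrow>\<^sub>E I"
  shows "c * h (\<lambda>b\<in>B. \<xi> b / c) = d * h (\<lambda>b\<in>B. \<xi> b / d)"
proof -
  have "(\<lambda>b\<in>B. \<xi> b / d) = (\<lambda>b\<in>B. c / d * (\<lambda>b\<in>B. \<xi> b / c) b)"
    using c(1) by (auto intro: restrict_ext)
  moreover have "h (\<lambda>b\<in>B. c / d * (\<lambda>b\<in>B. \<xi> b / c) b) = c / d * h (\<lambda>b\<in>B. \<xi> b / c)"
    using c d calculation by (intro H_ext_homogeneous[OF h]) (simp_all only: divide_nonneg_pos less_imp_le)
  ultimately show ?thesis
    using d(1) by simp
qed

text \<open>
  The inverse of restriction to the cube extends \<open>h\<close> by \<open>c * h (\<xi> / c)\<close>. The factor is taken to be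
  \<open>1 + l1 \<xi>\<close> because it is continuous and bounded away from zero, so continuity of the extension is
  immediate even at the origin.
\<close>

lemma riesz_isomorphic_H_Delta_H_real:
  fixes B :: "'b set"
  assumes B: "finite B"
  shows "riesz_isomorphic (H_Delta B) (H_real B)"
proof -
  let ?D = "H_cube B ()"
  let ?R = "H_ext B UNIV ()"
  let ?P = "B \<rightarrow>\<^sub>E (UNIV :: real set)"
  define r where "r \<xi> = 1 + l1 B \<xi>" for \<xi>
  define sc where "sc c \<xi> = (\<lambda>b\<in>B. \<xi> b / c)" for c and \<xi> :: "'b \<Rightarrow> real"
  define E where "E h = (\<lambda>\<xi>\<in>?P. r \<xi> * h (sc (r \<xi>) \<xi>))" for h
  have r: "0 < r \<xi>" for \<xi>
    using l1_nonneg[of B \<xi>] by (simp add: r_def)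
  have sc_cube: "sc c \<xi> \<in> cube B" if "0 < c" "\<And>b. b \<in> B \<Longrightarrow> \<bar>\<xi> b\<bar> \<le> c" for c \<xi>
  proof -
    have "- 1 \<le> \<xi> b / c \<and> \<xi> b / c \<le> 1" if "b \<in> B" for b
    proof -
      have "- c \<le> \<xi> b \<and> \<xi> b \<le> c"
        using \<open>\<And>b. b \<in> B \<Longrightarrow> \<bar>\<xi> b\<bar> \<le> c\<close>[OF that] by linarith
      then show ?thesis
        using \<open>0 < c\<close> by (simp add: field_simps)
    qed
    then show ?thesis
      by (auto simp: sc_def)
  qed
  have r_ge: "\<bar>\<xi> b\<bar> \<le> r \<xi>" if "b \<in> B" for \<xi> b
    using abs_le_l1[OF B that, of \<xi>] by (simp add: r_def)
  have sc_r: "sc (r \<xi>) \<xi> \<in> cube B" for \<xi>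
    using r r_ge by (rule sc_cube)
  have E_val: "E h \<xi> = c * h (sc c \<xi>)"
    if "h \<in> carrier ?D" "0 < c" "sc c \<xi> \<in> cube B" "\<xi> \<in> ?P" for h c \<xi>
    using homogeneous_rescale[OF that(1) r sc_r[unfolded sc_def] that(2) that(3)[unfolded sc_def]] that(4)
    by (simp add: E_def sc_def)
  have E_cube: "E h \<xi> = h \<xi>" if h: "h \<in> carrier ?D" and \<xi>: "\<xi> \<in> cube B" for h \<xi>
  proof -
    have "sc 1 \<xi> = \<xi>"
      using \<xi> by (auto simp: sc_def PiE_def extensional_def fun_eq_iff)
    then show ?thesis
      using E_val[OF h, of 1 \<xi>] \<xi> by auto
  qed
  have E_in: "E h \<in> carrier ?R" if h: "h \<in> carrier ?D" for h
    unfolding E_def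
  proof (rule restrict_in_H_ext)
    have contl1: "continuous_map (cube_topology B UNIV) euclideanreal (l1 B)"
      using continuous_reval[of "L1 B" B UNIV] by (simp add: vars_L1 reval_L1 B)
    then have contr: "continuous_map (cube_topology B UNIV) euclideanreal r"
      unfolding r_def by (intro continuous_intros)
    have "continuous_map (cube_topology B UNIV) (cube_topology B {-1..1}) (\<lambda>\<xi>. sc (r \<xi>) \<xi>)"
    proof (rule continuous_map_coordinatewise_then_product)
      fix b
      assume b: "b \<in> B"
      have "continuous_map (cube_topology B UNIV) euclideanreal (\<lambda>\<xi>. \<xi> b / r \<xi>)"
        using r by (intro continuous_map_real_divide continuous_map_coordinate b contr) (simp add: less_imp_neq[THEN not_sym])
      moreover have "\<xi> b / r \<xi> \<in> {-1..1}" for \<xi>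
        using sc_r[of \<xi>] b by (auto simp: sc_def PiE_iff dest: bspec[of B _ b])
      ultimately show "continuous_map (cube_topology B UNIV) (top_of_set {-1..1}) (\<lambda>\<xi>. sc (r \<xi>) \<xi> b)"
        using b by (intro continuous_map_into_subtopology) (auto simp: sc_def)
    qed (simp add: sc_def)
    from continuous_map_compose[OF this H_ext_continuous[OF h]]
    have "continuous_map (cube_topology B UNIV) euclideanreal (\<lambda>\<xi>. h (sc (r \<xi>) \<xi>))"
      by (simp add: o_def)
    with contr show "continuous_map (cube_topology B UNIV) euclideanreal (\<lambda>\<xi>. r \<xi> * h (sc (r \<xi>) \<xi>))"
      by (rule continuous_map_real_mult)
    fix t :: real and \<xi>
    assume t: "0 \<le> t" and \<xi>: "\<xi> \<in> ?P"
    let ?t\<xi> = "\<lambda>b\<in>B. t * \<xi> b"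
    show "r ?t\<xi> * h (sc (r ?t\<xi>) ?t\<xi>) = t * (r \<xi> * h (sc (r \<xi>) \<xi>))"
    proof (cases "t = 0")
      case True
      have "sc (r ?t\<xi>) ?t\<xi> = (\<lambda>b\<in>B. 0 * sc (r \<xi>) \<xi> b)"
        by (auto simp: sc_def True)
      moreover have "h (\<lambda>b\<in>B. 0 * sc (r \<xi>) \<xi> b) = 0 * h (sc (r \<xi>) \<xi>)"
        using sc_r by (intro H_ext_homogeneous[OF h]) auto
      ultimately show ?thesis
        using True by simp
    next
      case False
      with t have t: "0 < t"
        by simp
      have *: "sc (r ?t\<xi>) ?t\<xi> = sc (r ?t\<xi> / t) \<xi>"
        using t by (auto simp: sc_def)
      have "E h \<xi> = (r ?t\<xi> / t) * h (sc (r ?t\<xi> / t) \<xi>)"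
        using t r sc_r[of ?t\<xi>] by (intro E_val h \<xi>) (simp_all only: * divide_pos_pos)
      then have "t * E h \<xi> = r ?t\<xi> * h (sc (r ?t\<xi>) ?t\<xi>)"
        using t by (simp add: *)
      then show ?thesis
        using \<xi> by (simp add: E_def)
    qed
  qed
  have restr: "restrict g (cube B) \<in> carrier ?D" if g: "g \<in> carrier ?R" for g
  proof (rule restrict_in_H_ext)
    have "continuous_map (cube_topology B {-1..1}) (cube_topology B UNIV) (\<lambda>\<xi>. \<xi>)"
    proof (rule continuous_map_coordinatewise_then_product)
      show "continuous_map (cube_topology B {-1..1}) (top_of_set UNIV) (\<lambda>\<xi>. \<xi> b)" if "b \<in> B" for b
        using continuous_map_coordinate[OF that] by simp
    qed (auto simp: PiE_def extensional_def)
    from continuous_map_compose[OF this H_ext_continuous[OF g]]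
    show "continuous_map (cube_topology B {-1..1}) euclideanreal g"
      by (simp add: o_def)
    show "g (\<lambda>b\<in>B. t * \<xi> b) = t * g \<xi>" if "0 \<le> t" "\<xi> \<in> cube B" for t \<xi>
      using that by (intro H_ext_homogeneous[OF g]) auto
  qed
  have "riesz_hom ?D ?R E"
  proof (rule riesz_homI[OF vector_lattice_H_ext vector_lattice_H_ext])
    show "E \<in> carrier ?D \<rightarrow> carrier ?R"
      using E_in by blast
    fix g h c
    assume gh: "g \<in> carrier ?D" "h \<in> carrier ?D"
    show "E (g \<oplus>\<^bsub>?D\<^esub> h) = E g \<oplus>\<^bsub>?R\<^esub> E h"
      using sc_r by (auto simp: E_def distrib_left intro!: restrict_ext)
    show "E (c \<odot>\<^bsub>?D\<^esub> g) = c \<odot>\<^bsub>?R\<^esub> E g"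
      using sc_r by (auto simp: E_def intro!: restrict_ext)
    show "E (rjoin ?D g h) = rjoin ?R (E g) (E h)"
      using sc_r r less_imp_le[OF r]
      by (auto simp: rjoin_H_ext gh E_in) (auto simp: E_def max_mult_distrib_left intro!: restrict_ext)
  qed
  moreover have "bij_betw E (carrier ?D) (carrier ?R)"
  proof (rule bij_betwI[where g = "\<lambda>g. restrict g (cube B)"])
    show "restrict (E h) (cube B) = h" if "h \<in> carrier ?D" for h
      using that restr E_in E_cube by (intro H_ext_eqI[of _ B "{-1..1}" "()" h "()"]) auto
    show "E (restrict g (cube B)) = g" if g: "g \<in> carrier ?R" for g
    proof (rule H_ext_eqI[OF E_in[OF restr[OF g]] g])
      fix \<xi>
      assume \<xi>: "\<xi> \<in> ?P"
      have "\<xi> = (\<lambda>b\<in>B. r \<xi> * sc (r \<xi>) \<xi> b)"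
        using r[of \<xi>] \<xi> by (auto simp: sc_def PiE_def extensional_def fun_eq_iff)
      moreover have "g (\<lambda>b\<in>B. r \<xi> * sc (r \<xi>) \<xi> b) = r \<xi> * g (sc (r \<xi>) \<xi>)"
        using r[of \<xi>] by (intro H_ext_homogeneous[OF g]) (auto simp: sc_def)
      ultimately show "E (restrict g (cube B)) \<xi> = g \<xi>"
        using \<xi> sc_r[of \<xi>] by (simp add: E_def)
    qed
  qed (use E_in restr in auto)
  ultimately show ?thesis
    unfolding riesz_isomorphic_def H_Delta_eq H_real_def H_lattice_eq_H_ext by blast
qed

theorem theorem2:
  fixes B :: "'b set"
  assumes "finite B" and "B \<noteq> {}"
  shows
    "(\<exists>(F :: (('b \<Rightarrow> real) \<Rightarrow> real) riesz) f. is_FUCVL TYPE('e) B F f) \<and>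
     (\<exists>(X :: (('b \<Rightarrow> real) \<Rightarrow> real) normed_riesz) i. is_FBL TYPE('e) B X i) \<and>
     (\<forall>(F :: 'f riesz) f.
        is_FUCVL TYPE('f) B F f \<and> is_FUCVL TYPE(('b \<Rightarrow> real) \<Rightarrow> real) B F f \<longrightarrow>
          (\<forall>(X :: 'x normed_riesz) i.
             is_FBL TYPE('x) B X i \<and> is_FBL TYPE(('b \<Rightarrow> real) \<Rightarrow> real) B X i \<longrightarrow>
               riesz_isomorphic F X) \<and>
          riesz_isomorphic F (H_Delta B) \<and>
          riesz_isomorphic F (H_real B))"
proof (intro conjI allI impI)
  show "\<exists>(F :: (('b \<Rightarrow> real) \<Rightarrow> real) riesz) f. is_FUCVL TYPE('e) B F f"
    using is_FUCVL_H_Delta[OF assms(1)] by blast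
  show "\<exists>(X :: (('b \<Rightarrow> real) \<Rightarrow> real) normed_riesz) i. is_FBL TYPE('e) B X i"
    using is_FBL_FBL_Delta[OF assms] by blast
next
  fix F :: "'f riesz" and f
  assume F: "is_FUCVL TYPE('f) B F f \<and> is_FUCVL TYPE(('b \<Rightarrow> real) \<Rightarrow> real) B F f"
  then show Delta: "riesz_isomorphic F (H_Delta B)"
    using riesz_isomorphic_H_Delta_of_FUCVL[OF assms(1)] by blast
  then show "riesz_isomorphic F (H_real B)"
    using riesz_isomorphic_H_Delta_H_real[OF assms(1)] by (rule riesz_isomorphic_trans)
  fix X :: "'x normed_riesz" and i
  assume "is_FBL TYPE('x) B X i \<and> is_FBL TYPE(('b \<Rightarrow> real) \<Rightarrow> real) B X i"
  then have "riesz_isomorphic (FBL_Delta B) X"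
    using riesz_isomorphic_of_FBL[OF assms] by blast
  moreover have "riesz_isomorphic (H_Delta B) (FBL_Delta B)"
    unfolding H_Delta_eq FBL_Delta_def by (rule riesz_isomorphic_H_ext)
  ultimately show "riesz_isomorphic F X"
    using Delta by (blast intro: riesz_isomorphic_trans)
qed

end
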